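(* Let $(R,m)$ be a Noetherian local ring of positive prime characteristic $p$. If $S$ is a seed over $R$ and $T$ is an integral extension ring of $S$ (i.e. $S\subseteq T$ is an integral extension, and $T$ is viewed as an $R$-algebra via $S$), then $T$ is a seed over $R$.
   Context: All rings are commutative with identity. For a Noetherian local ring $(R,m)$, a big Cohen-Macaulay $R$-algebra is an $R$-algebra $B$ (not necessarily Noetherian or finitely generated) such that some system of parameters of $R$ is a regular sequence on $B$ (a regular sequence $x_1,\ldots,x_d$ on $B$ is required to satisfy $(x_1,\ldots,x_d)B\neq B$). An $R$-algebra $S$ is a seed over $R$ if there is an $R$-algebra homomorphism from $S$ to some big Cohen-Macaulay $R$-algebra. *)

theory Defs
  imports "HOL-Algebra.Algebra" "HOL-Computational_Algebra.Primes" "HOL-Library.Extended_Nat"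
begin

section \<open>Noetherian local rings and systems of parameters\<close>

locale noetherian_local_ring = noetherian_ring R + cring R for R (structure) +
  fixes m
  assumes maximal: "maximalideal m R"
    and maximal_unique: "maximalideal n R \<Longrightarrow> n = m"

definition has_characteristic :: "('a, 'k) ring_scheme \<Rightarrow> nat \<Rightarrow> bool" where
  "has_characteristic R p \<longleftrightarrow>
     (\<forall>n::nat. [n] \<cdot>\<^bsub>R\<^esub> \<one>\<^bsub>R\<^esub> = \<zero>\<^bsub>R\<^esub> \<longleftrightarrow> p dvd n)"

definition krull_dim :: "('a, 'k) ring_scheme \<Rightarrow> enat" where
  "krull_dim R =
     Sup {enat n | n. \<exists>P :: nat \<Rightarrow> 'a set.
            (\<forall>i\<le>n. primeideal (P i) R) \<and> (\<forall>i<n. P i \<subset> P (Suc i))}"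

definition radical :: "('a, 'k) ring_scheme \<Rightarrow> 'a set \<Rightarrow> 'a set" where
  "radical R I = {a \<in> carrier R. \<exists>n::nat. a [^]\<^bsub>R\<^esub> n \<in> I}"

definition system_of_parameters :: "('a, 'k) ring_scheme \<Rightarrow> 'a set \<Rightarrow> 'a list \<Rightarrow> bool" where
  "system_of_parameters R m xs \<longleftrightarrow>
     set xs \<subseteq> m \<and> enat (length xs) = krull_dim R \<and> radical R (Idl\<^bsub>R\<^esub> (set xs)) = m"


section \<open>Algebras, regular sequences and big Cohen-Macaulay algebras\<close>

text \<open>The expanded ideal \<open>(x\<^sub>1,\<dots>,x\<^sub>n)B\<close>.\<close>
definition expand :: "('r, 'b, 'l) module_scheme \<Rightarrow> 'r list \<Rightarrow> 'b set" where
  "expand B xs = Idl\<^bsub>B\<^esub> ((\<lambda>x. x \<odot>\<^bsub>B\<^esub> \<one>\<^bsub>B\<^esub>) ` set xs)"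

text \<open>The first clause says that \<open>x\<^sub>i\<^sub>+\<^sub>1\<close> is a nonzerodivisor on
  \<open>B/(x\<^sub>1,\<dots>,x\<^sub>i)B\<close>; note that \<^term>\<open>xs ! i\<close> is \<open>x\<^sub>i\<^sub>+\<^sub>1\<close>.\<close>
definition regular_sequence :: "('r, 'b, 'l) module_scheme \<Rightarrow> 'r list \<Rightarrow> bool" where
  "regular_sequence B xs \<longleftrightarrow>
     (\<forall>i<length xs. \<forall>b\<in>carrier B.
        (xs ! i) \<odot>\<^bsub>B\<^esub> b \<in> expand B (take i xs) \<longrightarrow> b \<in> expand B (take i xs)) \<and>
     expand B xs \<noteq> carrier B"

definition big_CM_algebra ::
  "('r, 'k) ring_scheme \<Rightarrow> 'r set \<Rightarrow> ('r, 'b, 'l) module_scheme \<Rightarrow> bool" where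
  "big_CM_algebra R m B \<longleftrightarrow>
     algebra R B \<and> (\<exists>xs. system_of_parameters R m xs \<and> regular_sequence B xs)"

definition algebra_hom ::
  "('r, 'k) ring_scheme \<Rightarrow> ('r, 's, 'l) module_scheme \<Rightarrow> ('r, 't, 'n) module_scheme \<Rightarrow> ('s \<Rightarrow> 't) set"
  where
  "algebra_hom R S T =
     {f \<in> ring_hom S T. \<forall>r\<in>carrier R. \<forall>s\<in>carrier S. f (r \<odot>\<^bsub>S\<^esub> s) = r \<odot>\<^bsub>T\<^esub> f s}"


section \<open>Integral extensions\<close>

text \<open>The list \<^term>\<open>\<one>\<^bsub>T\<^esub> # p\<close> is a monic polynomial, leading coefficient first.\<close>
definition integral_over :: "('t, 'k) ring_scheme \<Rightarrow> 't set \<Rightarrow> 't \<Rightarrow> bool" where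
  "integral_over T K t \<longleftrightarrow>
     (\<exists>p. set p \<subseteq> K \<and> ring.eval T (\<one>\<^bsub>T\<^esub> # p) t = \<zero>\<^bsub>T\<^esub>)"

text \<open>\<open>S \<subseteq> T\<close> as \<open>R\<close>-algebras, via the injection \<open>\<iota>\<close>. As \<open>\<iota>\<close> is \<open>R\<close>-linear, the \<open>R\<close>-algebra
  structure of \<open>T\<close> is the one induced from \<open>S\<close>, \<open>r t = \<iota>(r 1\<^sub>S) t\<close>.\<close>
definition integral_extension ::
  "('r, 'k) ring_scheme \<Rightarrow> ('r, 's, 'l) module_scheme \<Rightarrow> ('r, 't, 'n) module_scheme \<Rightarrow> ('s \<Rightarrow> 't) \<Rightarrow> bool"
  where
  "integral_extension R S T \<iota> \<longleftrightarrow>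
     algebra R S \<and> algebra R T \<and> \<iota> \<in> algebra_hom R S T \<and> inj_on \<iota> (carrier S) \<and>
     (\<forall>t\<in>carrier T. integral_over T (\<iota> ` carrier S) t)"


section \<open>Seeds\<close>

text \<open>HOL cannot quantify over the type of the elements of \<open>B\<close>. Fixing it to be \<^typ>\<open>'s + nat\<close>,
  which is infinite and at least as large as \<open>S\<close>, loses nothing: by the lemma \<open>seedI\<close> below,
  a map from \<open>S\<close> to a big Cohen-Macaulay algebra over any type whatsoever yields one over
  \<^typ>\<open>'s + nat\<close>.\<close>
definition seed ::
  "('r, 'k) ring_scheme \<Rightarrow> 'r set \<Rightarrow> ('r, 's, 'l) module_scheme \<Rightarrow> bool" where
  "seed R m S \<longleftrightarrow>
     algebra R S \<and>
     (\<exists>B :: ('r, 's + nat) module. big_CM_algebra R m B \<and> (\<exists>f. f \<in> algebra_hom R S B))"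


subsection \<open>Independence of the type of the big Cohen-Macaulay algebra\<close>

lemma algebra_pullback:
  fixes R (structure) and B :: "('r, 'b, 'l) module_scheme"
    and A :: "('r, 'c, 'n) module_scheme"
  assumes "algebra R B"
    and inj: "inj_on g (carrier A)"
    and cl: "\<And>x. x \<in> carrier A \<Longrightarrow> g x \<in> carrier B"
    and one: "\<one>\<^bsub>A\<^esub> \<in> carrier A" "g \<one>\<^bsub>A\<^esub> = \<one>\<^bsub>B\<^esub>"
    and zero: "\<zero>\<^bsub>A\<^esub> \<in> carrier A" "g \<zero>\<^bsub>A\<^esub> = \<zero>\<^bsub>B\<^esub>"
    and add: "\<And>x y. x \<in> carrier A \<Longrightarrow> y \<in> carrier A \<Longrightarrow> x \<oplus>\<^bsub>A\<^esub> y \<in> carrier A"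
      "\<And>x y. x \<in> carrier A \<Longrightarrow> y \<in> carrier A \<Longrightarrow> g (x \<oplus>\<^bsub>A\<^esub> y) = g x \<oplus>\<^bsub>B\<^esub> g y"
    and mult: "\<And>x y. x \<in> carrier A \<Longrightarrow> y \<in> carrier A \<Longrightarrow> x \<otimes>\<^bsub>A\<^esub> y \<in> carrier A"
      "\<And>x y. x \<in> carrier A \<Longrightarrow> y \<in> carrier A \<Longrightarrow> g (x \<otimes>\<^bsub>A\<^esub> y) = g x \<otimes>\<^bsub>B\<^esub> g y"
    and neg: "\<And>x. x \<in> carrier A \<Longrightarrow> \<exists>y\<in>carrier A. g y = \<ominus>\<^bsub>B\<^esub> g x"
    and smult: "\<And>r x. r \<in> carrier R \<Longrightarrow> x \<in> carrier A \<Longrightarrow> r \<odot>\<^bsub>A\<^esub> x \<in> carrier A"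
      "\<And>r x. r \<in> carrier R \<Longrightarrow> x \<in> carrier A \<Longrightarrow> g (r \<odot>\<^bsub>A\<^esub> x) = r \<odot>\<^bsub>B\<^esub> g x"
  shows "algebra R A"
proof -
  interpret BM: cring B by (rule algebra.M_cring) fact
  interpret B: algebra R B by fact
  have eq: "x = y" if "g x = g y" "x \<in> carrier A" "y \<in> carrier A" for x y
    using inj_onD[OF inj] that by blast
  note s = cl one zero add mult smult
  have ab: "abelian_group A"
  proof (rule abelian_groupI)
    fix x assume x: "x \<in> carrier A"
    obtain y where y: "y \<in> carrier A" "g y = \<ominus>\<^bsub>B\<^esub> g x" using neg[OF x] by blast
    have "y \<oplus>\<^bsub>A\<^esub> x = \<zero>\<^bsub>A\<^esub>"
      by (rule eq) (simp_all add: s x y BM.l_neg)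
    thus "\<exists>y\<in>carrier A. y \<oplus>\<^bsub>A\<^esub> x = \<zero>\<^bsub>A\<^esub>" using y by blast
  qed (auto intro!: eq simp: s BM.a_ac)
  have mon: "comm_monoid A"
    by (rule comm_monoidI) (auto intro!: eq simp: s BM.m_ac)
  have cr: "cring A"
    by (rule cringI[OF ab mon]) (auto intro!: eq simp: s BM.l_distr)
  show ?thesis
    by (rule algebraI[OF B.R_cring cr])
      (auto intro!: eq simp: s B.smult_l_distr B.smult_r_distr B.smult_assoc1 B.smult_assoc2)
qed

lemma expand_ideal:
  assumes "algebra R B" "set xs \<subseteq> carrier R"
  shows "ideal (expand B xs) B"
proof -
  interpret M: cring B by (rule algebra.M_cring) fact
  interpret algebra R B by fact
  show ?thesis unfolding expand_def
    by (rule M.genideal_ideal) (use assms in auto)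
qed

lemma expand_Nil:
  assumes "algebra R B"
  shows "expand B [] = {\<zero>\<^bsub>B\<^esub>}"
proof -
  interpret M: cring B by (rule algebra.M_cring) fact
  interpret algebra R B by fact
  have "Idl\<^bsub>B\<^esub> {} = {\<zero>\<^bsub>B\<^esub>}"
    using M.genideal_minimal[OF M.zeroideal, of "{}"] additive_subgroup.zero_closed
      ideal.axioms(1)[OF M.genideal_ideal[of "{}"]] by blast
  thus ?thesis by (simp add: expand_def)
qed

lemma expand_snoc_decompose:
  assumes "algebra R B" and xs: "set xs \<subseteq> carrier R" and x: "x \<in> carrier R"
    and b: "b \<in> expand B (xs @ [x])"
  shows "\<exists>c\<in>carrier B. b \<ominus>\<^bsub>B\<^esub> (x \<odot>\<^bsub>B\<^esub> c) \<in> expand B xs"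
proof -
  interpret M: cring B by (rule algebra.M_cring) fact
  interpret algebra R B by fact
  let ?X = "(\<lambda>x. x \<odot>\<^bsub>B\<^esub> \<one>\<^bsub>B\<^esub>) ` set xs" and ?y = "x \<odot>\<^bsub>B\<^esub> \<one>\<^bsub>B\<^esub>"
  have I: "ideal (expand B xs) B" by (rule expand_ideal) fact+
  have y: "?y \<in> carrier B" using x by simp
  have J: "ideal (PIdl\<^bsub>B\<^esub> ?y) B" by (rule M.cgenideal_ideal[OF y])
  have sub: "(\<lambda>x. x \<odot>\<^bsub>B\<^esub> \<one>\<^bsub>B\<^esub>) ` set (xs @ [x]) \<subseteq> expand B xs <+>\<^bsub>B\<^esub> PIdl\<^bsub>B\<^esub> ?y"
  proof -
    have "?X \<subseteq> expand B xs" unfolding expand_def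
      by (rule M.genideal_self) (use xs in auto)
    moreover have "?y \<in> PIdl\<^bsub>B\<^esub> ?y" by (rule M.cgenideal_self[OF y])
    moreover have "expand B xs \<union> PIdl\<^bsub>B\<^esub> ?y \<subseteq> expand B xs <+>\<^bsub>B\<^esub> PIdl\<^bsub>B\<^esub> ?y"
      unfolding M.union_genideal[OF I J, symmetric]
      by (rule M.genideal_self)
        (use I J in \<open>auto dest: additive_subgroup.a_Hcarr[OF ideal.axioms(1)]\<close>)
    ultimately show ?thesis by auto
  qed
  have "expand B (xs @ [x]) \<subseteq> expand B xs <+>\<^bsub>B\<^esub> PIdl\<^bsub>B\<^esub> ?y"
    unfolding expand_def[of B "xs @ [x]"]
    by (rule M.genideal_minimal[OF M.add_ideals[OF I J] sub])
  with b obtain a c where a: "a \<in> expand B xs" and c: "c \<in> carrier B"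
    and eq: "b = a \<oplus>\<^bsub>B\<^esub> c \<otimes>\<^bsub>B\<^esub> ?y"
    unfolding set_add_def' cgenideal_def by blast
  have aB: "a \<in> carrier B" using additive_subgroup.a_Hcarr[OF ideal.axioms(1)[OF I] a] .
  have cy: "c \<otimes>\<^bsub>B\<^esub> ?y = x \<odot>\<^bsub>B\<^esub> c"
    using c x y by (simp add: M.m_comm[of c] smult_assoc2)
  have "b \<ominus>\<^bsub>B\<^esub> (x \<odot>\<^bsub>B\<^esub> c) = a"
    unfolding eq cy using aB c x by (simp add: M.minus_eq M.a_assoc M.r_neg)
  thus ?thesis using a c by auto
qed

lemma expand_snoc_compose:
  assumes "algebra R B" and xs: "set xs \<subseteq> carrier R" and x: "x \<in> carrier R"
    and b: "b \<in> carrier B" and c: "c \<in> carrier B"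
    and d: "b \<ominus>\<^bsub>B\<^esub> (x \<odot>\<^bsub>B\<^esub> c) \<in> expand B xs"
  shows "b \<in> expand B (xs @ [x])"
proof -
  interpret M: cring B by (rule algebra.M_cring) fact
  interpret algebra R B by fact
  let ?y = "x \<odot>\<^bsub>B\<^esub> \<one>\<^bsub>B\<^esub>"
  have I: "ideal (expand B (xs @ [x])) B"
    by (rule expand_ideal[OF assms(1)]) (use xs x in auto)
  then interpret I: ideal "expand B (xs @ [x])" B .
  have gen: "(\<lambda>x. x \<odot>\<^bsub>B\<^esub> \<one>\<^bsub>B\<^esub>) ` set (xs @ [x]) \<subseteq> expand B (xs @ [x])"
    unfolding expand_def by (rule M.genideal_self) (use xs x in auto)
  have "expand B xs \<subseteq> expand B (xs @ [x])"
    unfolding expand_def[of B xs] by (rule M.genideal_minimal[OF I]) (use gen in auto)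
  hence 1: "b \<ominus>\<^bsub>B\<^esub> (x \<odot>\<^bsub>B\<^esub> c) \<in> expand B (xs @ [x])" using d by blast
  have "?y \<in> expand B (xs @ [x])" using gen by auto
  hence "?y \<otimes>\<^bsub>B\<^esub> c \<in> expand B (xs @ [x])" using c by (rule I.I_r_closed)
  hence 2: "x \<odot>\<^bsub>B\<^esub> c \<in> expand B (xs @ [x])" using c x by (simp add: smult_assoc2)
  have "(b \<ominus>\<^bsub>B\<^esub> (x \<odot>\<^bsub>B\<^esub> c)) \<oplus>\<^bsub>B\<^esub> (x \<odot>\<^bsub>B\<^esub> c) = b"
    using b c x by (simp add: M.minus_eq M.a_assoc M.l_neg)
  thus ?thesis using I.a_closed[OF 1 2] by simp
qed

datatype 's alg_term =
    Gen 's
  | Unit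
  | Minus "'s alg_term" "'s alg_term"
  | Times "'s alg_term" "'s alg_term"
  | Wit nat "'s alg_term"

primrec code_term :: "(('s + nat) \<times> ('s + nat) \<Rightarrow> 's + nat) \<Rightarrow> 's alg_term \<Rightarrow> 's + nat" where
  "code_term e (Gen s) = e (Inr 0, Inl s)"
| "code_term e Unit = e (Inr 1, Inr 0)"
| "code_term e (Minus t u) = e (Inr 2, e (code_term e t, code_term e u))"
| "code_term e (Times t u) = e (Inr 3, e (code_term e t, code_term e u))"
| "code_term e (Wit n t) = e (Inr 4, e (Inr n, code_term e t))"

lemma ex_inj_term: "\<exists>e :: 's alg_term \<Rightarrow> 's + nat. inj e"
proof -
  have "infinite (UNIV :: ('s + nat) set)"
    by simp
  hence "|(UNIV :: ('s + nat) set) \<times> (UNIV :: ('s + nat) set)| \<le>o |UNIV :: ('s + nat) set|"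
    by (rule ordIso_imp_ordLeq[OF card_of_Times_same_infinite])
  then obtain e :: "('s + nat) \<times> ('s + nat) \<Rightarrow> 's + nat" where e: "inj e"
    unfolding card_of_ordLeq[symmetric] by auto
  have "code_term e t = code_term e u \<Longrightarrow> t = u" for t u
  proof (induction t arbitrary: u)
    case (Gen s) thus ?case by (cases u) (simp_all add: inj_eq[OF e])
  next
    case Unit thus ?case by (cases u) (simp_all add: inj_eq[OF e])
  next
    case (Minus t1 t2) thus ?case by (cases u) (simp_all add: inj_eq[OF e])
  next
    case (Times t1 t2) thus ?case by (cases u) (simp_all add: inj_eq[OF e])
  next
    case (Wit n t) thus ?case by (cases u) (simp_all add: inj_eq[OF e])
  qed
  thus ?thesis by (auto simp: inj_def)
qed

primrec eval_term ::
  "('b, 'k) ring_scheme \<Rightarrow> ('s \<Rightarrow> 'b) \<Rightarrow> (nat \<Rightarrow> 'b \<Rightarrow> 'b) \<Rightarrow> 's alg_term \<Rightarrow> 'b" where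
  "eval_term B f w (Gen s) = f s"
| "eval_term B f w Unit = \<one>\<^bsub>B\<^esub>"
| "eval_term B f w (Minus t u) = eval_term B f w t \<ominus>\<^bsub>B\<^esub> eval_term B f w u"
| "eval_term B f w (Times t u) = eval_term B f w t \<otimes>\<^bsub>B\<^esub> eval_term B f w u"
| "eval_term B f w (Wit n t) = w n (eval_term B f w t)"

theorem seedI:
  fixes R :: "('r, 'k) ring_scheme" and S :: "('r, 's, 'l) module_scheme"
    and B :: "('r, 'b, 'n) module_scheme"
  assumes S: "algebra R S" and ideal_m: "ideal m R"
    and CM: "big_CM_algebra R m B" and f: "f \<in> algebra_hom R S B"
  shows "seed R m S"
proof -
  obtain xs where B: "algebra R B" and sop: "system_of_parameters R m xs"
    and reg: "regular_sequence B xs"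
    using CM by (auto simp: big_CM_algebra_def)
  interpret S: algebra R S by fact
  interpret BM: cring B by (rule algebra.M_cring) fact
  interpret B: algebra R B by fact
  have xsR: "set xs \<subseteq> carrier R"
    using sop additive_subgroup.a_subset[OF ideal.axioms(1)[OF ideal_m]]
    by (auto simp: system_of_parameters_def)
  have tk: "set (take i xs) \<subseteq> carrier R" for i
    using set_take_subset[of i xs] xsR by blast
  have nth: "xs ! i \<in> carrier R" if "i < length xs" for i
    using that xsR nth_mem by blast
  have fr: "f \<in> ring_hom S B"
    and fs: "\<And>r s. r \<in> carrier R \<Longrightarrow> s \<in> carrier S \<Longrightarrow> f (r \<odot>\<^bsub>S\<^esub> s) = r \<odot>\<^bsub>B\<^esub> f s"
    using f by (auto simp: algebra_hom_def)
  note fhom = ring_hom_closed[OF fr] ring_hom_mult[OF fr] ring_hom_add[OF fr] ring_hom_one[OF fr]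
  \<comment> \<open>a choice of last coefficients for elements of \<open>(x\<^sub>1,\<dots>,x\<^sub>i\<^sub>+\<^sub>1)B\<close>\<close>
  define w where "w i b = (if i < length xs \<and> b \<in> expand B (take (Suc i) xs)
     then (SOME c. c \<in> carrier B \<and> b \<ominus>\<^bsub>B\<^esub> (xs ! i \<odot>\<^bsub>B\<^esub> c) \<in> expand B (take i xs))
     else \<one>\<^bsub>B\<^esub>)" for i b
  have wit: "w i b \<in> carrier B \<and> b \<ominus>\<^bsub>B\<^esub> (xs ! i \<odot>\<^bsub>B\<^esub> w i b) \<in> expand B (take i xs)"
    if "i < length xs" "b \<in> expand B (take (Suc i) xs)" for i b
  proof -
    have "\<exists>c\<in>carrier B. b \<ominus>\<^bsub>B\<^esub> (xs ! i \<odot>\<^bsub>B\<^esub> c) \<in> expand B (take i xs)"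
      by (rule expand_snoc_decompose[OF B tk nth])
        (use that in \<open>simp_all add: take_Suc_conv_app_nth\<close>)
    hence "\<exists>c. c \<in> carrier B \<and> b \<ominus>\<^bsub>B\<^esub> (xs ! i \<odot>\<^bsub>B\<^esub> c) \<in> expand B (take i xs)" by blast
    from someI_ex[OF this] show ?thesis using that by (simp add: w_def)
  qed
  have w_cl: "w i b \<in> carrier B" for i b
    using wit[of i b] by (cases "i < length xs \<and> b \<in> expand B (take (Suc i) xs)") (auto simp: w_def)
  define Tm where "Tm = {t :: 's alg_term. set_alg_term t \<subseteq> carrier S}"
  define K where "K = eval_term B f w ` Tm"
  have "eval_term B f w t \<in> carrier B" if "set_alg_term t \<subseteq> carrier S" for t
    using that by (induction t) (auto simp: fhom w_cl)
  hence KB: "x \<in> K \<Longrightarrow> x \<in> carrier B" for x by (auto simp: K_def Tm_def)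
  have K_gen: "f s \<in> K" if "s \<in> carrier S" for s
    unfolding K_def by (rule image_eqI[of _ _ "Gen s"]) (auto simp: Tm_def that)
  have K_one: "\<one>\<^bsub>B\<^esub> \<in> K"
    unfolding K_def by (rule image_eqI[of _ _ "Unit"]) (auto simp: Tm_def)
  have K_minus: "x \<ominus>\<^bsub>B\<^esub> y \<in> K" if "x \<in> K" "y \<in> K" for x y
  proof -
    from that obtain t u where "t \<in> Tm" "u \<in> Tm" "x = eval_term B f w t" "y = eval_term B f w u"
      by (auto simp: K_def)
    thus ?thesis unfolding K_def by (intro image_eqI[of _ _ "Minus t u"]) (auto simp: Tm_def)
  qed
  have K_mult: "x \<otimes>\<^bsub>B\<^esub> y \<in> K" if "x \<in> K" "y \<in> K" for x y
  proof -
    from that obtain t u where "t \<in> Tm" "u \<in> Tm" "x = eval_term B f w t" "y = eval_term B f w u"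
      by (auto simp: K_def)
    thus ?thesis unfolding K_def by (intro image_eqI[of _ _ "Times t u"]) (auto simp: Tm_def)
  qed
  have K_wit: "w i x \<in> K" if "x \<in> K" for i x
  proof -
    from that obtain t where "t \<in> Tm" "x = eval_term B f w t" by (auto simp: K_def)
    thus ?thesis unfolding K_def by (intro image_eqI[of _ _ "Wit i t"]) (auto simp: Tm_def)
  qed
  have K_zero: "\<zero>\<^bsub>B\<^esub> \<in> K"
    using K_minus[OF K_one K_one] by (simp add: BM.minus_eq BM.r_neg)
  have K_neg: "\<ominus>\<^bsub>B\<^esub> x \<in> K" if "x \<in> K" for x
    using K_minus[OF K_zero that] KB[OF that] by (simp add: BM.minus_eq)
  have K_add: "x \<oplus>\<^bsub>B\<^esub> y \<in> K" if "x \<in> K" "y \<in> K" for x y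
    using K_minus[OF that(1) K_neg[OF that(2)]] KB[OF that(1)] KB[OF that(2)]
    by (simp add: BM.minus_eq)
  have K_smult: "r \<odot>\<^bsub>B\<^esub> x \<in> K" if "r \<in> carrier R" "x \<in> K" for r x
  proof -
    have "f (r \<odot>\<^bsub>S\<^esub> \<one>\<^bsub>S\<^esub>) \<otimes>\<^bsub>B\<^esub> x = r \<odot>\<^bsub>B\<^esub> x"
      using that KB by (simp add: fs fhom B.smult_assoc2)
    thus ?thesis using K_mult[OF K_gen that(2), of "r \<odot>\<^bsub>S\<^esub> \<one>\<^bsub>S\<^esub>"] that by simp
  qed
  obtain e :: "'s alg_term \<Rightarrow> 's + nat" where e: "inj e" using ex_inj_term by blast
  define h where "h = e \<circ> inv_into Tm (eval_term B f w)"
  define g where "g = inv_into K h"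
  have h_inj: "inj_on h K"
    unfolding h_def K_def
    by (rule comp_inj_on) (auto intro: inj_on_inv_into inj_on_subset[OF e])
  have gh: "g (h x) = x" if "x \<in> K" for x
    unfolding g_def by (rule inv_into_f_f[OF h_inj that])
  define A :: "('r, 's + nat) module" where
    "A = \<lparr>carrier = h ` K, monoid.mult = (\<lambda>x y. h (g x \<otimes>\<^bsub>B\<^esub> g y)), one = h \<one>\<^bsub>B\<^esub>,
          ring.zero = h \<zero>\<^bsub>B\<^esub>, ring.add = (\<lambda>x y. h (g x \<oplus>\<^bsub>B\<^esub> g y)),
          smult = (\<lambda>r x. h (r \<odot>\<^bsub>B\<^esub> g x))\<rparr>"
  have g_inj: "inj_on g (carrier A)" by (rule inj_onI) (auto simp: A_def gh)
  have gK: "g x \<in> K" if "x \<in> carrier A" for x using that by (auto simp: A_def gh)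
  have hA: "h x \<in> carrier A" if "x \<in> K" for x using that by (auto simp: A_def)
  have ops:
    "g \<one>\<^bsub>A\<^esub> = \<one>\<^bsub>B\<^esub>" "g \<zero>\<^bsub>A\<^esub> = \<zero>\<^bsub>B\<^esub>"
    "\<And>x y. x \<in> carrier A \<Longrightarrow> y \<in> carrier A \<Longrightarrow> g (x \<oplus>\<^bsub>A\<^esub> y) = g x \<oplus>\<^bsub>B\<^esub> g y"
    "\<And>x y. x \<in> carrier A \<Longrightarrow> y \<in> carrier A \<Longrightarrow> g (x \<otimes>\<^bsub>A\<^esub> y) = g x \<otimes>\<^bsub>B\<^esub> g y"
    "\<And>r x. r \<in> carrier R \<Longrightarrow> x \<in> carrier A \<Longrightarrow> g (r \<odot>\<^bsub>A\<^esub> x) = r \<odot>\<^bsub>B\<^esub> g x"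
    using gK by (simp_all add: A_def gh K_one K_zero K_add K_mult K_smult)
  have cl: "\<one>\<^bsub>A\<^esub> \<in> carrier A" "\<zero>\<^bsub>A\<^esub> \<in> carrier A"
    "\<And>x y. x \<in> carrier A \<Longrightarrow> y \<in> carrier A \<Longrightarrow> x \<oplus>\<^bsub>A\<^esub> y \<in> carrier A"
    "\<And>x y. x \<in> carrier A \<Longrightarrow> y \<in> carrier A \<Longrightarrow> x \<otimes>\<^bsub>A\<^esub> y \<in> carrier A"
    "\<And>r x. r \<in> carrier R \<Longrightarrow> x \<in> carrier A \<Longrightarrow> r \<odot>\<^bsub>A\<^esub> x \<in> carrier A"
    using gK by (simp_all add: A_def gh K_one K_zero K_add K_mult K_smult)
  have A: "algebra R A"
  proof (rule algebra_pullback[OF B g_inj])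
    fix x assume x: "x \<in> carrier A"
    show "\<exists>y\<in>carrier A. g y = \<ominus>\<^bsub>B\<^esub> g x"
      by (rule bexI[of _ "h (\<ominus>\<^bsub>B\<^esub> g x)"]) (simp_all add: gh hA gK x K_neg)
  qed (use gK KB in \<open>auto simp: ops cl\<close>)
  interpret AM: cring A by (rule algebra.M_cring) fact
  interpret A: algebra R A by fact
  have g_hom: "g \<in> ring_hom A B"
    by (rule ring_hom_memI) (auto simp: ops KB gK)
  interpret g: ring_hom_ring A B g
    by (rule ring_hom_ringI2[OF AM.ring_axioms BM.ring_axioms g_hom])
  have g_minus: "g (x \<ominus>\<^bsub>A\<^esub> y) = g x \<ominus>\<^bsub>B\<^esub> g y" if "x \<in> carrier A" "y \<in> carrier A" for x y
    using that by (simp add: AM.minus_eq BM.minus_eq)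
  have down: "g x \<in> expand B ys" if ys: "set ys \<subseteq> carrier R" and x: "x \<in> expand A ys" for x ys
  proof -
    have "ideal {x \<in> carrier A. g x \<in> expand B ys} A"
      by (rule g.ideal_vimage[OF expand_ideal[OF B ys]])
    moreover have "(\<lambda>x. x \<odot>\<^bsub>B\<^esub> \<one>\<^bsub>B\<^esub>) ` set ys \<subseteq> expand B ys"
      unfolding expand_def by (rule BM.genideal_self) (use ys in auto)
    hence "(\<lambda>x. x \<odot>\<^bsub>A\<^esub> \<one>\<^bsub>A\<^esub>) ` set ys \<subseteq> {x \<in> carrier A. g x \<in> expand B ys}"
    proof -
      assume a: "(\<lambda>x. x \<odot>\<^bsub>B\<^esub> \<one>\<^bsub>B\<^esub>) ` set ys \<subseteq> expand B ys"
      have "g (x \<odot>\<^bsub>A\<^esub> \<one>\<^bsub>A\<^esub>) = x \<odot>\<^bsub>B\<^esub> \<one>\<^bsub>B\<^esub>" if "x \<in> set ys" for x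
        using that ys by (auto simp: ops cl)
      thus ?thesis using a ys cl by (auto simp: image_subset_iff)
    qed
    ultimately show ?thesis
      using AM.genideal_minimal x unfolding expand_def[of A] by blast
  qed
  have up: "i \<le> length xs \<Longrightarrow> x \<in> carrier A \<Longrightarrow> g x \<in> expand B (take i xs) \<Longrightarrow>
      x \<in> expand A (take i xs)" for i x
  proof (induction i arbitrary: x)
    case 0
    hence "g x = g \<zero>\<^bsub>A\<^esub>" by (simp add: expand_Nil[OF B] ops)
    hence "x = \<zero>\<^bsub>A\<^esub>" using inj_onD[OF g_inj] 0 cl by blast
    thus ?case by (simp add: expand_Nil[OF A])
  next
    case (Suc i)
    have i: "i < length xs" using Suc by simp
    define c where "c = h (w i (g x))"
    have c: "c \<in> carrier A" "g c = w i (g x)"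
      using Suc by (simp_all add: c_def gh hA K_wit gK)
    have "g (x \<ominus>\<^bsub>A\<^esub> (xs ! i \<odot>\<^bsub>A\<^esub> c)) \<in> expand B (take i xs)"
      using wit[OF i Suc.prems(3)] c Suc.prems nth[OF i] by (simp add: g_minus ops cl)
    hence "x \<ominus>\<^bsub>A\<^esub> (xs ! i \<odot>\<^bsub>A\<^esub> c) \<in> expand A (take i xs)"
      using Suc c nth[OF i] by simp
    from expand_snoc_compose[OF A tk nth[OF i] Suc.prems(2) c(1) this]
    show ?case using i by (simp add: take_Suc_conv_app_nth)
  qed
  have "regular_sequence A xs"
    unfolding regular_sequence_def
  proof (intro conjI allI impI ballI)
    fix i b assume i: "i < length xs" and b: "b \<in> carrier A"
      and "xs ! i \<odot>\<^bsub>A\<^esub> b \<in> expand A (take i xs)"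
    hence "xs ! i \<odot>\<^bsub>B\<^esub> g b \<in> expand B (take i xs)"
      using down[OF tk] nth[OF i] by (metis ops(5))
    hence "g b \<in> expand B (take i xs)"
      using reg i b KB gK by (auto simp: regular_sequence_def)
    thus "b \<in> expand A (take i xs)" using up i b by simp
  next
    interpret I: ideal "expand B xs" B by (rule expand_ideal[OF B xsR])
    show "expand A xs \<noteq> carrier A"
    proof
      assume "expand A xs = carrier A"
      hence "g \<one>\<^bsub>A\<^esub> \<in> expand B xs" by (intro down[OF xsR]) (metis cl(1))
      hence "\<one>\<^bsub>B\<^esub> \<in> expand B xs" by (simp only: ops(1))
      hence "expand B xs = carrier B" by (rule I.one_imp_carrier)
      thus False using reg by (simp add: regular_sequence_def)
    qed
  qed
  hence "big_CM_algebra R m A" using A sop by (auto simp: big_CM_algebra_def)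
  moreover have "h \<circ> f \<in> algebra_hom R S A"
    unfolding algebra_hom_def
  proof (intro CollectI conjI ballI)
    show "h \<circ> f \<in> ring_hom S A"
      by (rule ring_hom_memI) (simp_all only: comp_apply hA K_gen fhom,
          simp_all add: A_def gh K_gen)
    fix r s assume "r \<in> carrier R" "s \<in> carrier S"
    thus "(h \<circ> f) (r \<odot>\<^bsub>S\<^esub> s) = r \<odot>\<^bsub>A\<^esub> (h \<circ> f) s"
      by (simp add: fs A_def gh K_gen)
  qed
  ultimately show ?thesis using S unfolding seed_def by blast
qed

end

theory Submission
  imports Defs
begin

text \<open>
  Let \<open>x\<^sub>1,\<dots>,x\<^sub>d\<close> be the system of parameters that is regular on the given big Cohen-Macaulay
  algebra of \<open>S\<close>. Call a ring homomorphism \<open>f : E \<rightarrow> B\<close> good if the images of the \<open>x\<^sub>i\<close> form a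
  regular sequence on \<open>B\<close> and do not generate the unit ideal. If \<open>E\<close> is an \<open>R\<close>-algebra, then \<open>f\<close>
  determines the \<open>R\<close>-algebra structure of \<open>B\<close>, so the question is about commutative rings only: does
  a good map on the image of \<open>S\<close> entail one on \<open>T\<close>?

  Consider the pairs \<open>(E, P)\<close> of a subring \<open>E\<close> of \<open>T\<close> that contains the \<open>x\<^sub>i\<close>, and a subset
  \<open>P\<close> that is killed by some good map on \<open>E\<close>. The union of a chain of pairs is a pair, because the
  product of the targets modulo eventually vanishing families is again the target of a good map.
  So there is a maximal pair above \<open>S\<close>. For such a pair, \<open>P\<close> is the kernel of every good map
  \<open>f : E \<rightarrow> B\<close> that kills it, and three things hold.

  \<^item> \<open>P\<close> contains every \<open>b\<close> with a power of \<open>f b\<close> in all ideals \<open>(x\<^sub>1\<^sup>Q,\<dots>,x\<^sub>d\<^sup>Q)B\<close>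
    (\<open>maximal_pair_separated\<close>).
  \<^item> \<open>P\<close> is prime (\<open>maximal_pair_prime\<close>). Let \<open>a b \<in> P\<close> and \<open>b \<notin> P\<close>. Map \<open>s\<close> to the sequence
    \<open>(f(s)^(p^n))\<^sub>n\<close> in a product of copies of \<open>B\<close> and invert the constant sequence \<open>\<gamma> = (f b)\<^sub>n\<close>.
    This kills \<open>a\<close>. It stays a good map, since a power of \<open>\<gamma>\<close> in the ideal generated by the
    \<open>x\<^sub>i\<close> would mean that a power of \<open>f b\<close> lies in all \<open>(x\<^sub>1^(p^n),\<dots>,x\<^sub>d^(p^n))B\<close>: relative to
    the Frobenius powers, a fixed element is arbitrarily close to a unit.
  \<^item> \<open>E\<close> is integrally closed in \<open>T\<close> (\<open>maximal_pair_integrally_closed\<close>). For \<open>t\<close> integral over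
    \<open>E\<close>, the module \<open>M = E[t]\<close> is finite over \<open>E\<close>, and \<open>1\<close> is not torsion in \<open>M/PM\<close>. As \<open>E/P\<close> is a
    domain, \<open>M/PM\<close> is, up to a factor \<open>c \<notin> P\<close>, a direct summand of a free module. Hence \<open>c\<close> kills
    the failure of the \<open>x\<^sub>i\<close> to be regular on \<open>M \<otimes> B\<close>, and inverting \<open>c\<close> along Frobenius powers
    as before yields a good map on \<open>M\<close> that kills \<open>P\<close>. By maximality \<open>M = E\<close>.

  The third point makes \<open>E = T\<close> for integral \<open>T\<close>. All good maps but the given one arise from a
  single construction, \<open>localized_filtered_product\<close>: a product of rings, divided by a directed union of
  products of ideals, with one element inverted.
\<close>

section \<open>Regular sequences modulo an ideal\<close>

text \<open>The ideal \<open>J + y A\<close>, if \<open>J\<close> is an ideal.\<close>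
definition adj :: "('a, 'k) ring_scheme \<Rightarrow> 'a set \<Rightarrow> 'a \<Rightarrow> 'a set" where
  "adj A J y = {u \<in> carrier A. \<exists>v\<in>carrier A. u \<ominus>\<^bsub>A\<^esub> (y \<otimes>\<^bsub>A\<^esub> v) \<in> J}"

text \<open>The ideal \<open>J + (y\<^sub>1,\<dots>,y\<^sub>n) A\<close>, if \<open>J\<close> is an ideal. Folding gives recursion equations at
  both ends of the list; the order of the generators is irrelevant by \<open>spn_eq_genideal\<close>.\<close>
definition spn :: "('a, 'k) ring_scheme \<Rightarrow> 'a set \<Rightarrow> 'a list \<Rightarrow> 'a set" where
  "spn A J ys = foldl (adj A) J ys"

lemma spn_Nil [simp]: "spn A J [] = J"
  and spn_Cons: "spn A J (y # ys) = spn A (adj A J y) ys"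
  and spn_snoc: "spn A J (ys @ [y]) = adj A (spn A J ys) y"
  by (simp_all add: spn_def)

context cring
begin

lemma ideal_minus_closed:
  assumes "ideal J R" "a \<in> J" "b \<in> J"
  shows "a \<ominus> b \<in> J"
  using assms by (simp add: a_minus_def ideal.axioms(1) additive_subgroup.a_closed
      additive_subgroup.a_inv_closed)

lemma ideal_add_closed:
  assumes "ideal J R" "a \<in> J" "b \<in> J"
  shows "a \<oplus> b \<in> J"
  using assms by (simp add: ideal.axioms(1) additive_subgroup.a_closed)

lemma ideal_carrier: "ideal J R \<Longrightarrow> a \<in> J \<Longrightarrow> a \<in> carrier R"
  by (meson additive_subgroup.a_Hcarr ideal.axioms(1))

lemma ideal_diff_mem:
  assumes "ideal J R" "a \<in> carrier R" "b \<in> J" "a \<ominus> b \<in> J"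
  shows "a \<in> J"
proof -
  have "(a \<ominus> b) \<oplus> b = a"
    using assms ideal_carrier[of J b] by algebra
  thus ?thesis using ideal_add_closed[OF assms(1,4,3)] by simp
qed

lemma adj_ideal:
  assumes J: "ideal J R" and y: "y \<in> carrier R"
  shows "ideal (adj R J y) R"
proof -
  interpret J: ideal J R by fact
  show ?thesis
  proof (rule idealI[OF ring_axioms])
    show "subgroup (adj R J y) (add_monoid R)"
    proof (rule add.subgroupI)
      show "adj R J y \<subseteq> carrier R" by (auto simp: adj_def)
      have "\<zero> \<ominus> y \<otimes> \<zero> \<in> J" using y by (simp add: a_minus_def)
      thus "adj R J y \<noteq> {}" unfolding adj_def by blast
    next
      fix a assume "a \<in> adj R J y"
      then obtain v where a: "a \<in> carrier R" "v \<in> carrier R" "a \<ominus> y \<otimes> v \<in> J"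
        by (auto simp: adj_def)
      have "\<ominus> a \<ominus> y \<otimes> (\<ominus> v) = \<ominus> (a \<ominus> y \<otimes> v)" using a y by algebra
      thus "\<ominus> a \<in> adj R J y" unfolding adj_def using a by (auto intro!: bexI[of _ "\<ominus> v"])
    next
      fix a b assume "a \<in> adj R J y" "b \<in> adj R J y"
      then obtain v w where a: "a \<in> carrier R" "v \<in> carrier R" "a \<ominus> y \<otimes> v \<in> J"
        and b: "b \<in> carrier R" "w \<in> carrier R" "b \<ominus> y \<otimes> w \<in> J"
        by (auto simp: adj_def)
      have "a \<oplus> b \<ominus> y \<otimes> (v \<oplus> w) = (a \<ominus> y \<otimes> v) \<oplus> (b \<ominus> y \<otimes> w)"
        using a b y by algebra
      thus "a \<oplus> b \<in> adj R J y" unfolding adj_def using a b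
        by (auto intro!: bexI[of _ "v \<oplus> w"])
    qed
  next
    fix a x assume "a \<in> adj R J y" and x: "x \<in> carrier R"
    then obtain v where a: "a \<in> carrier R" "v \<in> carrier R" "a \<ominus> y \<otimes> v \<in> J"
      by (auto simp: adj_def)
    have "x \<otimes> a \<ominus> y \<otimes> (x \<otimes> v) = x \<otimes> (a \<ominus> y \<otimes> v)" using a x y by algebra
    thus "x \<otimes> a \<in> adj R J y" unfolding adj_def using a x J.I_l_closed
      by (auto intro!: bexI[of _ "x \<otimes> v"])
    thus "a \<otimes> x \<in> adj R J y" using a x by (simp add: m_comm)
  qed
qed

lemma adj_eq_genideal:
  assumes J: "ideal J R" and y: "y \<in> carrier R"
  shows "adj R J y = Idl (insert y J)"
proof
  interpret J: ideal J R by fact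
  have sub: "insert y J \<subseteq> carrier R" using y J.a_subset by auto
  have G: "ideal (Idl (insert y J)) R" by (rule genideal_ideal[OF sub])
  then interpret G: ideal "Idl (insert y J)" R .
  have gen: "insert y J \<subseteq> Idl (insert y J)" by (rule genideal_self[OF sub])
  show "adj R J y \<subseteq> Idl (insert y J)"
  proof
    fix u assume "u \<in> adj R J y"
    then obtain v where u: "u \<in> carrier R" "v \<in> carrier R" "u \<ominus> y \<otimes> v \<in> J"
      by (auto simp: adj_def)
    have "y \<otimes> v \<in> Idl (insert y J)" using gen u G.I_r_closed by auto
    thus "u \<in> Idl (insert y J)" using gen u G ideal_diff_mem by blast
  qed
  have "y \<ominus> y \<otimes> \<one> \<in> J" using y by (simp add: a_minus_def r_neg)
  hence "y \<in> adj R J y" unfolding adj_def using y by blast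
  moreover have "J \<subseteq> adj R J y"
  proof
    fix u assume u: "u \<in> J"
    hence "u \<ominus> y \<otimes> \<zero> \<in> J" using y J.a_Hcarr by (simp add: a_minus_def)
    thus "u \<in> adj R J y" unfolding adj_def using u J.a_Hcarr by blast
  qed
  ultimately show "Idl (insert y J) \<subseteq> adj R J y"
    by (intro genideal_minimal[OF adj_ideal[OF J y]]) auto
qed

lemma genideal_ideal_id: "ideal J R \<Longrightarrow> Idl J = J"
  by (intro equalityI genideal_minimal genideal_self) (auto dest: ideal_carrier)

lemma spn_ideal:
  assumes "ideal J R" "set ys \<subseteq> carrier R"
  shows "ideal (spn R J ys) R"
  using assms by (induction ys arbitrary: J) (simp_all add: spn_Cons adj_ideal)

lemma spn_eq_genideal:
  assumes "ideal J R" "set ys \<subseteq> carrier R"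
  shows "spn R J ys = Idl (J \<union> set ys)"
  using assms
proof (induction ys arbitrary: J)
  case Nil thus ?case by (simp add: genideal_ideal_id)
next
  case (Cons y ys)
  hence y: "y \<in> carrier R" and ys: "set ys \<subseteq> carrier R" by auto
  have sub: "insert y J \<subseteq> carrier R" using y ideal_carrier[OF Cons.prems(1)] by auto
  hence sub2: "J \<union> set (y # ys) \<subseteq> carrier R" using ys by auto
  have "spn R J (y # ys) = Idl (Idl (insert y J) \<union> set ys)"
    using Cons.IH[OF adj_ideal[OF Cons.prems(1) y] ys] Cons.prems(1) y
    by (simp add: spn_Cons adj_eq_genideal)
  also have "\<dots> = Idl (J \<union> set (y # ys))"
  proof
    have "Idl (insert y J) \<subseteq> Idl (J \<union> set (y # ys))"
      by (intro genideal_minimal genideal_ideal[OF sub2])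
        (use genideal_self[OF sub2] in auto)
    thus "Idl (Idl (insert y J) \<union> set ys) \<subseteq> Idl (J \<union> set (y # ys))"
      by (intro genideal_minimal genideal_ideal[OF sub2])
        (use genideal_self[OF sub2] in auto)
    have s: "Idl (insert y J) \<union> set ys \<subseteq> carrier R"
      using ys ideal_carrier[OF genideal_ideal[OF sub]] by auto
    show "Idl (J \<union> set (y # ys)) \<subseteq> Idl (Idl (insert y J) \<union> set ys)"
      by (intro genideal_minimal genideal_ideal[OF s])
        (use genideal_self[OF s] genideal_self[OF sub] in auto)
  qed
  finally show ?case .
qed

lemma spn_least:
  assumes "ideal K R" "J \<subseteq> K" "set ys \<subseteq> K" "ideal J R"
  shows "spn R J ys \<subseteq> K"
proof -
  have "set ys \<subseteq> carrier R" using assms ideal_carrier by blast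
  thus ?thesis using assms by (simp add: spn_eq_genideal genideal_minimal)
qed

lemma spn_superset:
  assumes "ideal J R" "set ys \<subseteq> carrier R"
  shows "J \<subseteq> spn R J ys" "set ys \<subseteq> spn R J ys"
  using genideal_self[of "J \<union> set ys"] assms ideal_carrier[of J]
  by (auto simp: spn_eq_genideal)

lemma adj_eq_spn: "adj R J y = spn R J [y]"
  by (simp add: spn_Cons)

lemma adj_superset:
  assumes "ideal J R" "y \<in> carrier R"
  shows "J \<subseteq> adj R J y" "y \<in> adj R J y"
  using spn_superset[of J "[y]"] assms by (auto simp: adj_eq_spn)

lemma adj_mono: "J \<subseteq> K \<Longrightarrow> adj R J y \<subseteq> adj R K y"
  by (auto simp: adj_def)

lemma spn_mono: "J \<subseteq> K \<Longrightarrow> spn R J ys \<subseteq> spn R K ys"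
  by (induction ys arbitrary: J K) (simp_all add: spn_Cons adj_mono)

lemma spn_adj_commute:
  assumes "ideal J R" "y \<in> carrier R" "set xs \<subseteq> carrier R"
  shows "spn R (adj R J y) xs = adj R (spn R J xs) y"
proof -
  have "spn R J (y # xs) = spn R J (xs @ [y])"
    using assms by (simp add: spn_eq_genideal)
  thus ?thesis by (simp add: spn_Cons spn_snoc)
qed

lemma adjE:
  assumes "u \<in> adj R J y"
  obtains v where "v \<in> carrier R" "u \<ominus> y \<otimes> v \<in> J"
  using assms by (auto simp: adj_def)

lemma adjI:
  assumes "u \<in> carrier R" "v \<in> carrier R" "u \<ominus> y \<otimes> v \<in> J"
  shows "u \<in> adj R J y"
  using assms by (auto simp: adj_def)

end

text \<open>The inclusion \<open>c ((J + (y\<^sub>1,\<dots>,y\<^sub>k)) : y\<^sub>k\<^sub>+\<^sub>1) \<subseteq> J' + (y\<^sub>1,\<dots>,y\<^sub>k)\<close> for all \<open>k\<close>. For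
  \<open>J = J'\<close> it says that \<open>c\<close> kills all obstructions to regularity modulo \<open>J\<close>. A larger \<open>J'\<close> occurs
  where \<open>J\<close> runs through a directed family of ideals, whose union then absorbs the difference.\<close>
definition kills_colons ::
  "('a, 'k) ring_scheme \<Rightarrow> 'a \<Rightarrow> 'a set \<Rightarrow> 'a set \<Rightarrow> 'a list \<Rightarrow> bool" where
  "kills_colons A c J J' ys \<longleftrightarrow>
     (\<forall>k<length ys. \<forall>u\<in>carrier A. ys ! k \<otimes>\<^bsub>A\<^esub> u \<in> spn A J (take k ys) \<longrightarrow>
        c \<otimes>\<^bsub>A\<^esub> u \<in> spn A J' (take k ys))"

definition regular_mod :: "('a, 'k) ring_scheme \<Rightarrow> 'a set \<Rightarrow> 'a list \<Rightarrow> bool" where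
  "regular_mod A J ys \<longleftrightarrow>
     (\<forall>k<length ys. \<forall>u\<in>carrier A. ys ! k \<otimes>\<^bsub>A\<^esub> u \<in> spn A J (take k ys) \<longrightarrow>
        u \<in> spn A J (take k ys))"

lemma regular_mod_Nil [simp]: "regular_mod A J []"
  by (simp add: regular_mod_def)

lemma regular_mod_Cons:
  "regular_mod A J (y # ys) \<longleftrightarrow>
     (\<forall>u\<in>carrier A. y \<otimes>\<^bsub>A\<^esub> u \<in> J \<longrightarrow> u \<in> J) \<and> regular_mod A (adj A J y) ys"
  unfolding regular_mod_def by (auto simp: All_less_Suc2 spn_Cons)

lemma regular_mod_append:
  "regular_mod A J (xs @ ys) \<longleftrightarrow> regular_mod A J xs \<and> regular_mod A (spn A J xs) ys"
  by (induction xs arbitrary: J) (auto simp: regular_mod_Cons spn_Cons)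

context cring
begin

text \<open>A first element \<open>y\<close> of a regular sequence can be moved past the others in this direction: in
  \<open>y e = \<Sum> w\<^sub>i x\<^sub>i\<close>, regularity of the \<open>x\<^sub>i\<close> modulo \<open>y\<close> makes the last coefficient a multiple of \<open>y\<close>,
  modulo the earlier \<open>x\<^sub>i\<close>. Cancelling that summand shortens the sum.\<close>
lemma regular_mod_cancel:
  assumes J: "ideal J R" and y: "y \<in> carrier R" and xs: "set xs \<subseteq> carrier R"
    and nzd: "\<forall>u\<in>carrier R. y \<otimes> u \<in> J \<longrightarrow> u \<in> J"
    and reg: "regular_mod R (adj R J y) xs"
    and e: "e \<in> carrier R" "y \<otimes> e \<in> spn R J xs"
  shows "e \<in> spn R J xs"
  using xs reg e
proof (induction xs arbitrary: e rule: rev_induct)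
  case Nil thus ?case using nzd by simp
next
  case (snoc x xs)
  have x: "x \<in> carrier R" and xs: "set xs \<subseteq> carrier R" using snoc.prems by auto
  have I: "ideal (spn R J xs) R" by (rule spn_ideal[OF J xs])
  obtain w where w: "w \<in> carrier R" "y \<otimes> e \<ominus> x \<otimes> w \<in> spn R J xs"
    using snoc.prems(4) unfolding spn_snoc by (rule adjE)
  have "x \<otimes> w \<ominus> y \<otimes> e = \<ominus> (y \<otimes> e \<ominus> x \<otimes> w)" using x y w snoc.prems by algebra
  hence "x \<otimes> w \<ominus> y \<otimes> e \<in> spn R J xs"
    using w I additive_subgroup.a_inv_closed ideal.axioms(1) by fastforce
  hence "x \<otimes> w \<in> spn R (adj R J y) xs"
    unfolding spn_adj_commute[OF J y xs] using x w snoc.prems by (intro adjI) auto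
  hence "w \<in> spn R (adj R J y) xs"
    using snoc.prems(2) w by (simp add: regular_mod_append regular_mod_Cons)
  then obtain s where s: "s \<in> carrier R" "w \<ominus> y \<otimes> s \<in> spn R J xs"
    unfolding spn_adj_commute[OF J y xs] by (rule adjE)
  have "y \<otimes> (e \<ominus> x \<otimes> s) = (y \<otimes> e \<ominus> x \<otimes> w) \<oplus> x \<otimes> (w \<ominus> y \<otimes> s)"
    using x y w s snoc.prems by algebra
  hence "y \<otimes> (e \<ominus> x \<otimes> s) \<in> spn R J xs"
    using w s x I by (simp add: ideal_add_closed ideal.I_l_closed)
  moreover have "regular_mod R (adj R J y) xs"
    using snoc.prems(2) by (simp add: regular_mod_append)
  ultimately have "e \<ominus> x \<otimes> s \<in> spn R J xs"
    using snoc.IH[of "e \<ominus> x \<otimes> s"] snoc.prems x s xs by simp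
  thus ?case unfolding spn_snoc using snoc.prems x s by (intro adjI) auto
qed

lemma adj_one: "ideal J R \<Longrightarrow> adj R J \<one> = carrier R"
  using ideal.one_imp_carrier[OF adj_ideal[of J \<one>]] adj_superset[of J \<one>] by simp

lemma spn_carrier: "set ys \<subseteq> carrier R \<Longrightarrow> spn R (carrier R) ys = carrier R"
  using spn_superset[of "carrier R" ys] oneideal ideal_carrier[OF spn_ideal[of "carrier R" ys]] by blast

lemma regular_mod_carrier: "set ys \<subseteq> carrier R \<Longrightarrow> regular_mod R (carrier R) ys"
  by (auto simp: regular_mod_def spn_carrier[OF subset_trans[OF set_take_subset]])

text \<open>\<open>A/(J + y\<^sup>a\<^sup>+\<^sup>1)\<close> is an extension of \<open>A/(J + y)\<close> by \<open>A/(J + y\<^sup>a)\<close>, and a sequence that is regular on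
  the outer terms of an extension is regular on the middle one. For \<open>a = 0\<close> the quotient is zero.\<close>
lemma regular_mod_first_power:
  assumes J: "ideal J R" and y: "y \<in> carrier R" and xs: "set xs \<subseteq> carrier R"
    and nzd: "\<forall>u\<in>carrier R. y \<otimes> u \<in> J \<longrightarrow> u \<in> J"
    and reg: "regular_mod R (adj R J y) xs"
  shows "regular_mod R (adj R J (y [^] (a::nat))) xs"
proof (induction a)
  case 0
  show ?case using J xs by (simp add: adj_one regular_mod_carrier)
next
  case (Suc a)
  define Y where "Y = y [^] a"
  have Y: "Y \<in> carrier R" "y [^] Suc a = y \<otimes> Y" using y by (simp_all add: Y_def m_comm)
  show ?case unfolding regular_mod_def
  proof (intro allI impI ballI)
    fix k u assume k: "k < length xs" and u: "u \<in> carrier R"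
      and xu: "xs ! k \<otimes> u \<in> spn R (adj R J (y [^] Suc a)) (take k xs)"
    define x where "x = xs ! k"
    define as where "as = take k xs"
    have x: "x \<in> carrier R" using xs k by (auto simp: x_def)
    have as: "set as \<subseteq> carrier R" using xs by (auto simp: as_def dest: in_set_takeD)
    have I: "ideal (spn R J as) R" by (rule spn_ideal[OF J as])
    have YY: "y \<otimes> Y \<in> carrier R" using y Y by simp
    obtain v where v: "v \<in> carrier R" "x \<otimes> u \<ominus> (y \<otimes> Y) \<otimes> v \<in> spn R J as"
      using xu unfolding Y(2) x_def[symmetric] as_def[symmetric] spn_adj_commute[OF J YY as]
      by (rule adjE)
    have "x \<otimes> u \<ominus> y \<otimes> (Y \<otimes> v) \<in> spn R J as" using v y Y by (simp add: m_assoc)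
    hence "x \<otimes> u \<in> spn R (adj R J y) as"
      unfolding spn_adj_commute[OF J y as] using u v x y Y by (intro adjI) auto
    hence "u \<in> spn R (adj R J y) as"
      using reg k u by (simp add: regular_mod_def x_def as_def)
    then obtain u' where u': "u' \<in> carrier R" "u \<ominus> y \<otimes> u' \<in> spn R J as"
      unfolding spn_adj_commute[OF J y as] by (rule adjE)
    have "y \<otimes> (x \<otimes> u' \<ominus> Y \<otimes> v) = (x \<otimes> u \<ominus> (y \<otimes> Y) \<otimes> v) \<ominus> x \<otimes> (u \<ominus> y \<otimes> u')"
      using x y u v u' Y by algebra
    hence "y \<otimes> (x \<otimes> u' \<ominus> Y \<otimes> v) \<in> spn R J as"
      using v u' x I by (simp add: ideal_minus_closed ideal.I_l_closed)
    moreover have "regular_mod R (adj R J y) as"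
      using reg by (metis append_take_drop_id as_def regular_mod_append)
    ultimately have "x \<otimes> u' \<ominus> Y \<otimes> v \<in> spn R J as"
      by (rule regular_mod_cancel[OF J y as nzd, rotated 2]) (use x u' Y v in simp_all)
    hence "x \<otimes> u' \<in> spn R (adj R J Y) as"
      unfolding spn_adj_commute[OF J Y(1) as] using u' v x Y by (intro adjI) auto
    hence "u' \<in> spn R (adj R J Y) as"
      using Suc.IH k u' by (simp add: regular_mod_def x_def as_def Y_def)
    then obtain w where w: "w \<in> carrier R" "u' \<ominus> Y \<otimes> w \<in> spn R J as"
      unfolding spn_adj_commute[OF J Y(1) as] by (rule adjE)
    have "u \<ominus> (y \<otimes> Y) \<otimes> w = (u \<ominus> y \<otimes> u') \<oplus> y \<otimes> (u' \<ominus> Y \<otimes> w)"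
      using y u w u' Y by algebra
    hence "u \<ominus> (y \<otimes> Y) \<otimes> w \<in> spn R J as"
      using w u' y I by (simp add: ideal_add_closed ideal.I_l_closed)
    thus "u \<in> spn R (adj R J (y [^] Suc a)) (take k xs)"
      unfolding Y(2) as_def[symmetric] spn_adj_commute[OF J YY as] using u w by (intro adjI) auto
  qed
qed

lemma regular_mod_powers:
  assumes "ideal J R" "set ys \<subseteq> carrier R" "regular_mod R J ys"
  shows "regular_mod R J (map (\<lambda>y. y [^] (a::nat)) ys)"
  using assms
proof (induction ys arbitrary: J)
  case (Cons y ys)
  have y: "y \<in> carrier R" and ys: "set ys \<subseteq> carrier R" using Cons.prems by auto
  have nzd: "\<forall>u\<in>carrier R. y \<otimes> u \<in> J \<longrightarrow> u \<in> J"
    using Cons.prems by (simp add: regular_mod_Cons)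
  have "u \<in> carrier R \<Longrightarrow> y [^] a \<otimes> u \<in> J \<Longrightarrow> u \<in> J" for u
  proof (induction a arbitrary: u)
    case (Suc a)
    have "y \<otimes> (y [^] a \<otimes> u) \<in> J" using Suc.prems y by (simp add: m_ac)
    hence "y [^] a \<otimes> u \<in> J" using nzd Suc.prems(1) y by blast
    thus ?case using Suc.prems(1) Suc.IH by blast
  qed simp
  moreover have "regular_mod R (adj R J (y [^] a)) ys"
  proof (rule regular_mod_first_power[OF Cons.prems(1) y ys nzd])
    show "regular_mod R (adj R J y) ys" using Cons.prems(3) by (simp add: regular_mod_Cons)
  qed
  ultimately show ?case
    using Cons.IH[OF adj_ideal[OF Cons.prems(1)] ys] y by (auto simp: regular_mod_Cons)
qed simp

text \<open>Modulo \<open>z\<^sub>1,\<dots>,z\<^sub>k\<close> the sequence \<open>z = z\<^sub>k\<^sub>+\<^sub>1, z\<^sub>k\<^sub>+\<^sub>2,\<dots>\<close> is regular. If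
  \<open>z u = z\<^sup>Q\<^sup>+\<^sup>1 v + \<dots>\<close> with the remaining terms in \<open>(z\<^sub>k\<^sub>+\<^sub>2\<^sup>Q\<^sup>+\<^sup>1,\<dots>)\<close>, then \<open>z\<close> can be cancelled
  from \<open>z (u - z\<^sup>Q v)\<close>. So dividing by \<open>z\<close> costs one in the exponent, uniformly in \<open>Q\<close>.\<close>
lemma kills_colons_powers:
  assumes J: "ideal J R" and zs: "set zs \<subseteq> carrier R" and reg: "regular_mod R J zs"
  shows "kills_colons R \<one> (spn R J (map (\<lambda>z. z [^] Suc Q) zs)) (spn R J (map (\<lambda>z. z [^] Q) zs)) zs"
  unfolding kills_colons_def
proof (intro allI impI ballI)
  fix k u assume k: "k < length zs" and u: "u \<in> carrier R"
    and zu: "zs ! k \<otimes> u \<in> spn R (spn R J (map (\<lambda>z. z [^] Suc Q) zs)) (take k zs)"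
  define z where "z = zs ! k"
  define as where "as = take k zs"
  define bs where "bs = map (\<lambda>z. z [^] Suc Q) (drop (Suc k) zs)"
  have zs_eq: "zs = as @ z # drop (Suc k) zs"
    using k by (simp add: as_def z_def id_take_nth_drop)
  have set_zs: "set zs = set (as @ z # drop (Suc k) zs)"
    using zs_eq by (rule arg_cong)
  have as: "set as \<subseteq> carrier R" and z: "z \<in> carrier R" and
    ds: "set (drop (Suc k) zs) \<subseteq> carrier R"
    using zs unfolding set_zs by auto
  have bs: "set bs \<subseteq> carrier R" using ds by (auto simp: bs_def)
  have P: "set (map (\<lambda>z. z [^] n) zs) \<subseteq> carrier R" for n :: nat using zs by auto
  let ?I = "spn R J as"
  have I: "ideal ?I R" by (rule spn_ideal[OF J as])
  have zQ: "z [^] n \<in> carrier R" for n :: nat using z by simp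
  have "regular_mod R J (as @ z # drop (Suc k) zs)" using reg zs_eq by simp
  hence nzd: "\<forall>u\<in>carrier R. z \<otimes> u \<in> ?I \<longrightarrow> u \<in> ?I"
    and rg: "regular_mod R (adj R ?I z) (drop (Suc k) zs)"
    by (simp_all add: regular_mod_append regular_mod_Cons)
  have rg': "regular_mod R (adj R ?I z) bs"
    unfolding bs_def by (rule regular_mod_powers[OF adj_ideal[OF I z] ds rg])
  have K: "ideal (spn R (adj R ?I (z [^] Suc Q)) bs) R"
    by (rule spn_ideal[OF adj_ideal[OF I zQ] bs])
  have sup1: "?I \<subseteq> spn R (adj R ?I (z [^] Suc Q)) bs"
    using spn_superset(1)[OF adj_ideal[OF I zQ] bs] adj_superset(1)[OF I zQ] by blast
  have pw: "a [^] Suc Q \<in> ?I" if "a \<in> set as" for a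
  proof -
    have "a \<in> ?I" using spn_superset(2)[OF J as] that by blast
    thus ?thesis using ideal.I_l_closed[OF I, of a "a [^] Q"] that as by auto
  qed
  have "set (map (\<lambda>z. z [^] Suc Q) zs) \<subseteq> spn R (adj R ?I (z [^] Suc Q)) bs"
  proof -
    have "set (map (\<lambda>z. z [^] Suc Q) zs) =
        (\<lambda>z. z [^] Suc Q) ` set as \<union> {z [^] Suc Q} \<union> set bs"
      using set_zs by (auto simp: bs_def)
    thus ?thesis
      using pw sup1 spn_superset[OF adj_ideal[OF I zQ[of "Suc Q"]] bs]
        adj_superset(2)[OF I zQ[of "Suc Q"]] by auto
  qed
  moreover have "J \<subseteq> ?I" "set as \<subseteq> ?I" by (rule spn_superset[OF J as])+
  ultimately have "spn R (spn R J (map (\<lambda>z. z [^] Suc Q) zs)) as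
      \<subseteq> spn R (adj R ?I (z [^] Suc Q)) bs"
    using sup1 by (intro spn_least K spn_ideal J P) auto
  hence "z \<otimes> u \<in> adj R (spn R ?I bs) (z [^] Suc Q)"
    using zu unfolding z_def[symmetric] as_def[symmetric] spn_adj_commute[OF I zQ bs] by blast
  then obtain v where v: "v \<in> carrier R" "z \<otimes> u \<ominus> z [^] Suc Q \<otimes> v \<in> spn R ?I bs"
    by (rule adjE)
  have "z \<otimes> (u \<ominus> z [^] Q \<otimes> v) = z \<otimes> u \<ominus> (z [^] Q \<otimes> z) \<otimes> v"
    using z zQ[of Q] u v by algebra
  hence "z \<otimes> (u \<ominus> z [^] Q \<otimes> v) \<in> spn R ?I bs" using v by simp
  hence 1: "u \<ominus> z [^] Q \<otimes> v \<in> spn R ?I bs"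
    by (rule regular_mod_cancel[OF I z bs nzd rg', rotated]) (use u v z in simp_all)
  let ?K = "spn R (spn R J (map (\<lambda>z. z [^] Q) zs)) as"
  have K': "ideal ?K R" by (intro spn_ideal J P as)
  have sup2: "spn R J (map (\<lambda>z. z [^] Q) zs) \<subseteq> ?K" "set as \<subseteq> ?K"
    by (rule spn_superset[OF spn_ideal[OF J P] as])+
  have pwK: "d [^] Q \<in> ?K" if "d \<in> set zs" for d
    using that sup2 spn_superset(2)[OF J P[of Q]] by auto
  have inzs: "set (drop (Suc k) zs) \<subseteq> set zs" "z \<in> set zs"
    using k by (auto simp: z_def dest: in_set_dropD)
  have "set bs \<subseteq> ?K"
  proof
    fix b assume "b \<in> set bs"
    then obtain d where d: "d \<in> set (drop (Suc k) zs)" "b = d [^] Q \<otimes> d" by (auto simp: bs_def)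
    thus "b \<in> ?K" using pwK[of d] inzs ds ideal.I_r_closed[OF K'] by blast
  qed
  moreover have "J \<subseteq> ?K" using sup2 spn_superset(1)[OF J P[of Q]] by blast
  ultimately have "spn R ?I bs \<subseteq> ?K" using sup2
    by (intro spn_least K' I J) auto
  moreover have "z [^] Q \<otimes> v \<in> ?K" using pwK inzs v ideal.I_r_closed[OF K'] by blast
  ultimately have "u \<in> ?K" using 1 ideal_diff_mem[OF K' u] by blast
  thus "\<one> \<otimes> u \<in> spn R (spn R J (map (\<lambda>z. z [^] Q) zs)) (take k zs)"
    using u by (simp add: as_def)
qed

lemma kills_colons_regular:
  "regular_mod R J ys \<Longrightarrow> kills_colons R \<one> J J ys"
  by (auto simp: kills_colons_def regular_mod_def)

end

section \<open>Powers of the Frobenius endomorphism\<close>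

context cring
begin

lemma binomial_expansion:
  assumes a: "a \<in> carrier R" and b: "b \<in> carrier R"
  shows "(a \<oplus> b) [^] (n::nat) = (\<Oplus>i\<in>{..n}. [(n choose i)] \<cdot>\<^bsub>R\<^esub> (a [^] i \<otimes> b [^] (n - i)))"
proof (induction n)
  case 0
  show ?case by simp
next
  case (Suc n)
  define t where "t n i = [(n choose i)] \<cdot>\<^bsub>R\<^esub> (a [^] i \<otimes> b [^] (n - i))" for n i :: nat
  have t: "t n i \<in> carrier R" for n i using a b by (simp add: t_def)
  have t0: "t (Suc n) 0 = b \<otimes> t n 0"
    using a b by (simp add: t_def m_comm)
  have tS: "t (Suc n) (Suc i) = a \<otimes> t n i \<oplus> b \<otimes> t n (Suc i)" if "i \<le> n" for i
  proof -
    have 1: "[(n choose i)] \<cdot>\<^bsub>R\<^esub> (a [^] Suc i \<otimes> b [^] (n - i)) = a \<otimes> t n i"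
      using a b by (simp add: t_def add_pow_rdistr m_ac)
    have 2: "[(n choose Suc i)] \<cdot>\<^bsub>R\<^esub> (a [^] Suc i \<otimes> b [^] (n - i)) = b \<otimes> t n (Suc i)"
    proof (cases "i = n")
      case False
      hence "n - i = Suc (n - Suc i)" using that by simp
      hence "b [^] (n - i) = b \<otimes> b [^] (n - Suc i)" using b by (simp add: m_comm)
      thus ?thesis using a b by (simp add: t_def add_pow_rdistr m_ac)
    qed (use a b in \<open>simp add: t_def binomial_eq_0\<close>)
    have "t (Suc n) (Suc i) = [(n choose i)] \<cdot>\<^bsub>R\<^esub> (a [^] Suc i \<otimes> b [^] (n - i)) \<oplus>
        [(n choose Suc i)] \<cdot>\<^bsub>R\<^esub> (a [^] Suc i \<otimes> b [^] (n - i))"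
      unfolding t_def using a b by (simp add: add.nat_pow_mult del: nat_pow_Suc)
    thus ?thesis by (simp only: 1 2)
  qed
  have z: "t n (Suc n) = \<zero>" by (simp add: t_def binomial_eq_0)
  have s0: "(\<Oplus>i\<in>{..n}. t n (Suc i)) \<oplus> t n 0 = (\<Oplus>i\<in>{..n}. t n i)"
    using finsum_Suc2[of "t n" n] finsum_Suc[of "t n" n] t z by simp
  have c: "(\<Oplus>i\<in>{..n}. t n i) \<in> carrier R" "(\<Oplus>i\<in>{..n}. t n (Suc i)) \<in> carrier R"
    using t by simp_all
  have "(\<Oplus>i\<in>{..Suc n}. t (Suc n) i) = (\<Oplus>i\<in>{..n}. t (Suc n) (Suc i)) \<oplus> t (Suc n) 0"
    using t by (intro finsum_Suc2) simp
  also have "(\<Oplus>i\<in>{..n}. t (Suc n) (Suc i)) = (\<Oplus>i\<in>{..n}. a \<otimes> t n i \<oplus> b \<otimes> t n (Suc i))"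
    using t a b tS by (intro finsum_cong') auto
  also have "\<dots> = a \<otimes> (\<Oplus>i\<in>{..n}. t n i) \<oplus> b \<otimes> (\<Oplus>i\<in>{..n}. t n (Suc i))"
    using t a b by (simp add: finsum_addf finsum_rdistr)
  also have "\<dots> \<oplus> t (Suc n) 0 = a \<otimes> (\<Oplus>i\<in>{..n}. t n i) \<oplus> b \<otimes> ((\<Oplus>i\<in>{..n}. t n (Suc i)) \<oplus> t n 0)"
    unfolding t0 using t[of n 0] a b c by (simp add: r_distr a_assoc)
  also have "\<dots> = (\<Oplus>i\<in>{..n}. t n i) \<otimes> (a \<oplus> b)"
    unfolding s0 using a b c by (simp add: l_distr m_comm[of _ "a \<oplus> b"])
  also have "(\<Oplus>i\<in>{..n}. t n i) = (a \<oplus> b) [^] n" using Suc.IH by (simp add: t_def)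
  finally show ?case unfolding t_def by simp
qed

lemma char_add_pow_eq_zero:
  assumes "[p] \<cdot>\<^bsub>R\<^esub> \<one> = \<zero>" "(p::nat) dvd k" "x \<in> carrier R"
  shows "[k] \<cdot>\<^bsub>R\<^esub> x = \<zero>"
proof -
  obtain l where k: "k = p * l" using assms(2) by auto
  have "[p] \<cdot>\<^bsub>R\<^esub> x = [p] \<cdot>\<^bsub>R\<^esub> \<one> \<otimes> x" using assms(3) by (simp add: add_pow_ldistr)
  hence "[p] \<cdot>\<^bsub>R\<^esub> x = \<zero>" using assms by simp
  thus ?thesis unfolding k using assms(3) add.nat_pow_pow[of x l p] by (simp add: mult.commute)
qed

lemma frobenius_add:
  assumes p: "Factorial_Ring.prime (p::nat)" and ch: "[p] \<cdot>\<^bsub>R\<^esub> \<one> = \<zero>"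
    and a: "a \<in> carrier R" and b: "b \<in> carrier R"
  shows "(a \<oplus> b) [^] (p ^ n) = a [^] (p ^ n) \<oplus> b [^] (p ^ n)"
proof (induction n)
  case (Suc n)
  have base: "(x \<oplus> y) [^] p = x [^] p \<oplus> y [^] p" if x: "x \<in> carrier R" and y: "y \<in> carrier R" for x y
  proof -
    obtain q where q: "p = Suc q" using prime_gt_0_nat[OF p] by (cases p) auto
    define t where "t i = [(p choose i)] \<cdot>\<^bsub>R\<^esub> (x [^] i \<otimes> y [^] (p - i))" for i
    have t: "t i \<in> carrier R" for i using x y by (simp add: t_def)
    have "(x \<oplus> y) [^] p = (\<Oplus>i\<in>{..Suc q}. t i)"
      using binomial_expansion[OF x y, of p] by (simp add: t_def q)
    also have "\<dots> = t p \<oplus> (\<Oplus>i\<in>{..q}. t i)" using t q by simp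
    also have "(\<Oplus>i\<in>{..q}. t i) = (\<Oplus>i\<in>{..q}. if 0 = i then t i else \<zero>)"
    proof (rule finsum_cong')
      fix i assume i: "i \<in> {..q}"
      show "t i = (if 0 = i then t i else \<zero>)"
      proof (cases "i = 0")
        case False
        hence "p dvd (p choose i)" using p i q by (intro dvd_choose_prime) auto
        thus ?thesis using False x y by (simp add: t_def char_add_pow_eq_zero[OF ch])
      qed simp
    qed (use t in auto)
    also have "\<dots> = t 0" using t by (intro finsum_singleton) auto
    finally show ?thesis using x y by (simp add: t_def)
  qed
  have "z [^] (p ^ Suc n) = (z [^] (p ^ n)) [^] p" if "z \<in> carrier R" for z
    using that by (simp add: nat_pow_pow mult.commute)
  thus ?case using Suc.IH a b by (simp add: base)
qed (use a b in \<open>simp add: nat_pow_eone\<close>)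

lemma frobenius_minus:
  assumes p: "Factorial_Ring.prime (p::nat)" and ch: "[p] \<cdot>\<^bsub>R\<^esub> \<one> = \<zero>"
    and a: "a \<in> carrier R" and b: "b \<in> carrier R"
  shows "(a \<ominus> b) [^] (p ^ n) = a [^] (p ^ n) \<ominus> b [^] (p ^ n)"
proof -
  let ?q = "p ^ n"
  have eq: "(a \<ominus> b) [^] ?q \<oplus> b [^] ?q = a [^] ?q"
  proof -
    have "(a \<ominus> b) \<oplus> b = a" using a b by algebra
    thus ?thesis using frobenius_add[OF p ch, of "a \<ominus> b" b n] a b by simp
  qed
  have "a [^] ?q \<ominus> b [^] ?q = (a \<ominus> b) [^] ?q" 
    unfolding eq[symmetric] using nat_pow_closed[of "a \<ominus> b" ?q] nat_pow_closed[of b ?q] a b by algebra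
  thus ?thesis by simp
qed

end


section \<open>Polynomials with coefficients in an ideal\<close>

text \<open>The extended ideal \<open>J[X]\<close>.\<close>
definition poly_ideal :: "('a, 'k) ring_scheme \<Rightarrow> 'a set \<Rightarrow> (nat \<Rightarrow> 'a) set" where
  "poly_ideal A J = {u \<in> carrier (UP A). \<forall>n. up_ring.coeff (UP A) u n \<in> J}"

abbreviation const_poly :: "('a, 'k) ring_scheme \<Rightarrow> 'a \<Rightarrow> nat \<Rightarrow> 'a" where
  "const_poly A a \<equiv> up_ring.monom (UP A) a 0"

lemma (in cring) ideal_finsum_closed:
  assumes J: "ideal J R" and f: "\<And>i. i \<in> I \<Longrightarrow> f i \<in> J"
  shows "finsum R f I \<in> J"
proof (cases "finite I")
  case True
  thus ?thesis using f
  proof (induction I)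
    case empty
    show ?case using additive_subgroup.zero_closed[OF ideal.axioms(1)[OF J]] by simp
  next
    case (insert i I)
    moreover have "f \<in> insert i I \<rightarrow> carrier R" using insert.prems ideal_carrier[OF J] by auto
    ultimately show ?case by (simp add: ideal_add_closed[OF J] Pi_def)
  qed
next
  case False
  thus ?thesis using additive_subgroup.zero_closed[OF ideal.axioms(1)[OF J]]
    by (simp add: finsum_infinite)
qed

context UP_cring
begin

abbreviation "cf \<equiv> up_ring.coeff P"
abbreviation "mnm \<equiv> up_ring.monom P"

lemma poly_ideal_alt: "poly_ideal R J = {u \<in> carrier P. \<forall>n. cf u n \<in> J}"
  by (simp add: poly_ideal_def P_def)

lemma poly_ideal_ideal:
  assumes J: "ideal J R"
  shows "ideal (poly_ideal R J) P"
proof (rule idealI[OF P.ring_axioms])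
  have z: "\<zero> \<in> J" using additive_subgroup.zero_closed[OF ideal.axioms(1)[OF J]] .
  show "subgroup (poly_ideal R J) (add_monoid P)"
  proof (rule P.add.subgroupI)
    show "poly_ideal R J \<subseteq> carrier P" by (auto simp: poly_ideal_alt)
    show "poly_ideal R J \<noteq> {}" using z by (auto simp: poly_ideal_alt intro!: exI[of _ "\<zero>\<^bsub>P\<^esub>"])
    fix a b assume "a \<in> poly_ideal R J" "b \<in> poly_ideal R J"
    thus "a \<oplus>\<^bsub>P\<^esub> b \<in> poly_ideal R J"
      by (auto simp: poly_ideal_alt R.ideal_add_closed[OF J])
  next
    fix a assume "a \<in> poly_ideal R J"
    thus "\<ominus>\<^bsub>P\<^esub> a \<in> poly_ideal R J"
      by (auto simp: poly_ideal_alt additive_subgroup.a_inv_closed[OF ideal.axioms(1)[OF J]])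
  qed
next
  fix a x assume a: "a \<in> poly_ideal R J" and x: "x \<in> carrier P"
  have aP: "a \<in> carrier P" and an: "\<And>n. cf a n \<in> J" using a by (auto simp: poly_ideal_alt)
  have "cf (x \<otimes>\<^bsub>P\<^esub> a) n \<in> J" for n
    unfolding coeff_mult[OF x aP]
    by (intro R.ideal_finsum_closed[OF J] ideal.I_l_closed[OF J] an) (use x in simp)
  thus "x \<otimes>\<^bsub>P\<^esub> a \<in> poly_ideal R J" using x aP by (simp add: poly_ideal_alt)
  thus "a \<otimes>\<^bsub>P\<^esub> x \<in> poly_ideal R J" using x aP by (simp add: P.m_comm)
qed

lemma poly_of_coeffs:
  assumes "\<And>n. f n \<in> carrier R" "\<And>n. n > N \<Longrightarrow> f n = \<zero>"
  obtains v where "v \<in> carrier P" "\<And>n. cf v n = f n"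
proof -
  have "\<exists>n. bound \<zero> n f" using bound.intro[of N f \<zero>] assms(2) by blast
  hence f: "f \<in> up R" using mem_upI[of f R] assms(1) by blast
  have "f \<in> carrier P" unfolding P_def UP_def using f by simp
  moreover have "cf f n = f n" for n unfolding P_def UP_def using f by simp
  ultimately show thesis by (rule that)
qed

lemma coeff_const_mult:
  assumes "a \<in> carrier R" "u \<in> carrier P"
  shows "cf (mnm a 0 \<otimes>\<^bsub>P\<^esub> u) n = a \<otimes> cf u n"
  using assms by (simp add: monom_mult_is_smult)

\<comment> \<open>products with constants have the simpler rule \<open>coeff_const_mult\<close>\<close>
declare coeff_mult [simp del]

text \<open>\<open>J[X] + y A[X] = (J + y A)[X]\<close>: cofactors are chosen for each coefficient, and set to \<open>0\<close>
  above the degree so that they form a polynomial.\<close>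
lemma adj_poly_ideal:
  assumes J: "ideal J R" and y: "y \<in> carrier R"
  shows "adj P (poly_ideal R J) (mnm y 0) = poly_ideal R (adj R J y)"
proof
  show "adj P (poly_ideal R J) (mnm y 0) \<subseteq> poly_ideal R (adj R J y)"
  proof
    fix u assume u: "u \<in> adj P (poly_ideal R J) (mnm y 0)"
    then obtain v where v: "v \<in> carrier P" "u \<ominus>\<^bsub>P\<^esub> mnm y 0 \<otimes>\<^bsub>P\<^esub> v \<in> poly_ideal R J"
      by (rule P.adjE)
    have uP: "u \<in> carrier P" using u by (simp add: adj_def)
    have "cf u n \<in> adj R J y" for n
    proof (rule R.adjI[of _ "cf v n"])
      show "cf u n \<ominus> y \<otimes> cf v n \<in> J"
        using v uP y by (auto simp: poly_ideal_alt coeff_minus coeff_const_mult)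
    qed (use uP v in auto)
    thus "u \<in> poly_ideal R (adj R J y)" using uP by (simp add: poly_ideal_alt)
  qed
  show "poly_ideal R (adj R J y) \<subseteq> adj P (poly_ideal R J) (mnm y 0)"
  proof
    fix u assume u: "u \<in> poly_ideal R (adj R J y)"
    hence uP: "u \<in> carrier P" and un: "\<And>n. cf u n \<in> adj R J y" by (auto simp: poly_ideal_alt)
    have "\<forall>n. \<exists>v. v \<in> carrier R \<and> cf u n \<ominus> y \<otimes> v \<in> J"
      using un by (auto simp: adj_def)
    then obtain f where f: "\<And>n. f n \<in> carrier R" "\<And>n. cf u n \<ominus> y \<otimes> f n \<in> J" by metis
    define f' where "f' n = (if n \<le> deg R u then f n else \<zero>)" for n
    obtain v where v: "v \<in> carrier P" "\<And>n. cf v n = f' n"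
      by (rule poly_of_coeffs[of f' "deg R u"]) (auto simp: f'_def f)
    have z: "\<zero> \<in> J" using additive_subgroup.zero_closed[OF ideal.axioms(1)[OF J]] .
    have "cf u n \<ominus> y \<otimes> f' n \<in> J" for n
      using f z y uP deg_aboveD[of u n] by (auto simp: f'_def R.minus_eq)
    hence "u \<ominus>\<^bsub>P\<^esub> mnm y 0 \<otimes>\<^bsub>P\<^esub> v \<in> poly_ideal R J"
      using v uP y by (auto simp: poly_ideal_alt coeff_minus coeff_const_mult)
    thus "u \<in> adj P (poly_ideal R J) (mnm y 0)" using uP v(1) by (intro P.adjI)
  qed
qed

lemma spn_poly_ideal:
  assumes "ideal J R" "set ys \<subseteq> carrier R"
  shows "spn P (poly_ideal R J) (map (\<lambda>y. mnm y 0) ys) = poly_ideal R (spn R J ys)"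
  using assms by (induction ys arbitrary: J) (simp_all add: spn_Cons adj_poly_ideal R.adj_ideal)


section \<open>Inverting a colon-killing element\<close>

text \<open>\<open>P/(K[X] + (1 - \<gamma> X))\<close> is the localization of \<open>R/K\<close> at \<open>\<gamma>\<close>. Let \<open>y u \<equiv> g w\<close> modulo
  \<open>J = K + (y\<^sub>1,\<dots>,y\<^sub>k)\<close>, where \<open>g = 1 - \<gamma> X\<close>. As \<open>g\<close> is a nonzerodivisor modulo every ideal extended
  from \<open>R\<close>, in particular modulo \<open>J + (y)\<close>, we get \<open>w \<equiv> y w'\<close>, and \<open>y (u - g w') \<equiv> 0\<close>. So \<open>\<gamma>\<close> kills
  the coefficients of \<open>u - g w'\<close> modulo \<open>J\<close>, and \<open>\<gamma>\<close> is invertible.\<close>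
lemma localization_regular:
  fixes \<gamma>
  defines "g \<equiv> \<one>\<^bsub>P\<^esub> \<ominus>\<^bsub>P\<^esub> mnm \<gamma> 1"
  assumes K: "ideal K R" and \<gamma>: "\<gamma> \<in> carrier R" and ys: "set ys \<subseteq> carrier R"
    and kills: "kills_colons R \<gamma> K K ys"
    and durable: "\<And>N::nat. \<gamma> [^] N \<notin> spn R K ys"
  shows "regular_mod P (adj P (poly_ideal R K) g) (map (\<lambda>y. mnm y 0) ys)"
    and "\<one>\<^bsub>P\<^esub> \<notin> spn P (adj P (poly_ideal R K) g) (map (\<lambda>y. mnm y 0) ys)"
    and "\<And>a. a \<in> carrier R \<Longrightarrow> \<gamma> \<otimes> a \<in> K \<Longrightarrow> mnm a 0 \<in> adj P (poly_ideal R K) g"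
    and "g \<in> carrier P"
proof -
  let ?y = "\<lambda>y. mnm y 0"
  show g: "g \<in> carrier P" using \<gamma> by (simp add: g_def)
  have X: "mnm \<gamma> 1 \<in> carrier P" using \<gamma> by simp
  have gw: "g \<otimes>\<^bsub>P\<^esub> w = w \<ominus>\<^bsub>P\<^esub> mnm \<gamma> 1 \<otimes>\<^bsub>P\<^esub> w" if "w \<in> carrier P" for w
    unfolding g_def using that X P.one_closed by algebra
  have Xw: "cf (mnm \<gamma> 1 \<otimes>\<^bsub>P\<^esub> w) 0 = \<zero>" "cf (mnm \<gamma> 1 \<otimes>\<^bsub>P\<^esub> w) (Suc n) = \<gamma> \<otimes> cf w n"
    if "w \<in> carrier P" for w n
    using that \<gamma> coeff_monom_mult[of \<gamma> w 1 n] coeff_mult[of "mnm \<gamma> 1" w 0] by simp_all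
  have cfg: "cf (g \<otimes>\<^bsub>P\<^esub> w) 0 = cf w 0" "cf (g \<otimes>\<^bsub>P\<^esub> w) (Suc n) = cf w (Suc n) \<ominus> \<gamma> \<otimes> cf w n"
    if "w \<in> carrier P" for w n
    using that X Xw[OF that] by (simp_all add: gw coeff_minus R.minus_eq)
  have J: "ideal (spn R K (take k ys)) R" "set (take k ys) \<subseteq> carrier R" for k
    using ys by (auto intro!: R.spn_ideal K dest: in_set_takeD)
  have yP: "set (map ?y ys) \<subseteq> carrier P" "set (map ?y (take k ys)) \<subseteq> carrier P" for k
    using ys by (auto dest: in_set_takeD)
  have PK: "ideal (poly_ideal R K) P" by (rule poly_ideal_ideal[OF K])
  have span: "spn P (adj P (poly_ideal R K) g) (map ?y (take k ys)) =
      adj P (poly_ideal R (spn R K (take k ys))) g" for k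
    using P.spn_adj_commute[OF PK g yP(2)] spn_poly_ideal[OF K J(2)] by simp
  \<comment> \<open>modulo any ideal, \<open>1 - \<gamma>X\<close> is a nonzerodivisor, as its constant term is a unit\<close>
  have nzd: "w \<in> poly_ideal R J'" if "ideal J' R" "w \<in> carrier P" "g \<otimes>\<^bsub>P\<^esub> w \<in> poly_ideal R J'" for J' w
  proof -
    have c: "\<And>n. cf (g \<otimes>\<^bsub>P\<^esub> w) n \<in> J'" using that by (simp add: poly_ideal_alt)
    have "cf w n \<in> J'" for n
    proof (induction n)
      case 0 thus ?case using c[of 0] cfg that by simp
    next
      case (Suc n)
      show ?case
        by (rule R.ideal_diff_mem[OF that(1), of _ "\<gamma> \<otimes> cf w n"])
          (use c[of "Suc n"] cfg(2)[of w n] that \<gamma> Suc.IH in \<open>simp_all add: ideal.I_l_closed\<close>)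
    qed
    thus ?thesis using that by (simp add: poly_ideal_alt)
  qed
  \<comment> \<open>modulo \<open>1 - \<gamma>X\<close>, the element \<open>\<gamma>\<close> has the inverse \<open>X\<close>\<close>
  have divide: "v \<in> adj P (poly_ideal R J') g"
    if "ideal J' R" "v \<in> carrier P" "\<And>n. \<gamma> \<otimes> cf v n \<in> J'" for v J'
  proof (intro P.adjI[OF that(2,2)])
    have "cf (mnm \<gamma> 1 \<otimes>\<^bsub>P\<^esub> v) n \<in> J'" for n
      using that Xw[OF that(2)] additive_subgroup.zero_closed[OF ideal.axioms(1)[OF that(1)]]
      by (cases n) auto
    moreover have "v \<ominus>\<^bsub>P\<^esub> g \<otimes>\<^bsub>P\<^esub> v = mnm \<gamma> 1 \<otimes>\<^bsub>P\<^esub> v"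
      unfolding gw[OF that(2)] using X that(2) P.m_closed[OF X that(2)] by algebra
    ultimately show "v \<ominus>\<^bsub>P\<^esub> g \<otimes>\<^bsub>P\<^esub> v \<in> poly_ideal R J'" using X that by (simp add: poly_ideal_alt)
  qed
  show "mnm a 0 \<in> adj P (poly_ideal R K) g" if "a \<in> carrier R" "\<gamma> \<otimes> a \<in> K" for a
    using that \<gamma> additive_subgroup.zero_closed[OF ideal.axioms(1)[OF K]]
    by (intro divide[OF K]) (auto simp: coeff_monom)
  show "regular_mod P (adj P (poly_ideal R K) g) (map ?y ys)"
    unfolding regular_mod_def
  proof (intro allI impI ballI)
    fix k u assume k: "k < length (map ?y ys)" and u: "u \<in> carrier P"
      and "map ?y ys ! k \<otimes>\<^bsub>P\<^esub> u \<in> spn P (adj P (poly_ideal R K) g) (take k (map ?y ys))"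
    define y where "y = ys ! k"
    define J where "J = spn R K (take k ys)"
    have y: "y \<in> carrier R" using ys k by (auto simp: y_def)
    have J: "ideal J R" unfolding J_def by (rule J)
    have IJ: "ideal (poly_ideal R J) P" by (rule poly_ideal_ideal[OF J])
    have "?y y \<otimes>\<^bsub>P\<^esub> u \<in> adj P (poly_ideal R J) g"
      using \<open>map ?y ys ! k \<otimes>\<^bsub>P\<^esub> u \<in> _\<close> k by (simp add: span take_map y_def J_def)
    then obtain w where w: "w \<in> carrier P" "?y y \<otimes>\<^bsub>P\<^esub> u \<ominus>\<^bsub>P\<^esub> g \<otimes>\<^bsub>P\<^esub> w \<in> poly_ideal R J"
      by (rule P.adjE)
    have yC: "?y y \<in> carrier P" using y by simp
    have "g \<otimes>\<^bsub>P\<^esub> w \<ominus>\<^bsub>P\<^esub> ?y y \<otimes>\<^bsub>P\<^esub> u = \<ominus>\<^bsub>P\<^esub> (?y y \<otimes>\<^bsub>P\<^esub> u \<ominus>\<^bsub>P\<^esub> g \<otimes>\<^bsub>P\<^esub> w)"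
      using yC u w g by algebra
    hence "g \<otimes>\<^bsub>P\<^esub> w \<in> adj P (poly_ideal R J) (?y y)"
      using w u g additive_subgroup.a_inv_closed[OF ideal.axioms(1)[OF IJ]]
      by (intro P.adjI[of _ u]) auto
    hence "w \<in> adj P (poly_ideal R J) (?y y)"
      unfolding adj_poly_ideal[OF J y] using nzd[OF R.adj_ideal[OF J y]] w by blast
    then obtain w' where w': "w' \<in> carrier P" "w \<ominus>\<^bsub>P\<^esub> ?y y \<otimes>\<^bsub>P\<^esub> w' \<in> poly_ideal R J"
      by (rule P.adjE)
    define v where "v = u \<ominus>\<^bsub>P\<^esub> g \<otimes>\<^bsub>P\<^esub> w'"
    have v: "v \<in> carrier P" using u g w' by (simp add: v_def)
    have "?y y \<otimes>\<^bsub>P\<^esub> v = (?y y \<otimes>\<^bsub>P\<^esub> u \<ominus>\<^bsub>P\<^esub> g \<otimes>\<^bsub>P\<^esub> w) \<oplus>\<^bsub>P\<^esub> g \<otimes>\<^bsub>P\<^esub> (w \<ominus>\<^bsub>P\<^esub> ?y y \<otimes>\<^bsub>P\<^esub> w')"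
      unfolding v_def using yC u w w' g by algebra
    hence "?y y \<otimes>\<^bsub>P\<^esub> v \<in> poly_ideal R J"
      using w w' g IJ by (simp add: P.ideal_add_closed ideal.I_l_closed)
    hence "y \<otimes> cf v n \<in> J" for n using coeff_const_mult[OF y v] by (auto simp: poly_ideal_alt)
    hence "\<gamma> \<otimes> cf v n \<in> J" for n
      using kills k v by (auto simp: kills_colons_def J_def y_def)
    hence "v \<in> adj P (poly_ideal R J) g" by (rule divide[OF J v])
    then obtain s where s: "s \<in> carrier P" "v \<ominus>\<^bsub>P\<^esub> g \<otimes>\<^bsub>P\<^esub> s \<in> poly_ideal R J" by (rule P.adjE)
    have "u \<ominus>\<^bsub>P\<^esub> g \<otimes>\<^bsub>P\<^esub> (s \<oplus>\<^bsub>P\<^esub> w') = v \<ominus>\<^bsub>P\<^esub> g \<otimes>\<^bsub>P\<^esub> s"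
      unfolding v_def using u g s w' by algebra
    hence "u \<in> adj P (poly_ideal R J) g" using s u w' by (intro P.adjI[of _ "s \<oplus>\<^bsub>P\<^esub> w'"]) auto
    thus "u \<in> spn P (adj P (poly_ideal R K) g) (take k (map ?y ys))"
      by (simp add: span take_map J_def)
  qed
  show "\<one>\<^bsub>P\<^esub> \<notin> spn P (adj P (poly_ideal R K) g) (map ?y ys)"
  proof
    let ?J = "spn R K ys"
    have J: "ideal ?J R" using J(1)[of "length ys"] by simp
    assume "\<one>\<^bsub>P\<^esub> \<in> spn P (adj P (poly_ideal R K) g) (map ?y ys)"
    hence "\<one>\<^bsub>P\<^esub> \<in> adj P (poly_ideal R ?J) g" using span[of "length ys"] by simp
    then obtain w where w: "w \<in> carrier P" "\<one>\<^bsub>P\<^esub> \<ominus>\<^bsub>P\<^esub> g \<otimes>\<^bsub>P\<^esub> w \<in> poly_ideal R ?J" by (rule P.adjE)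
    have c: "cf \<one>\<^bsub>P\<^esub> n \<ominus> cf (g \<otimes>\<^bsub>P\<^esub> w) n \<in> ?J" for n
      using w g by (auto simp: poly_ideal_alt coeff_minus)
    \<comment> \<open>\<open>w\<close> agrees with the geometric series modulo \<open>(y\<^sub>1,\<dots>,y\<^sub>d)\<close>, but it is a polynomial\<close>
    have "\<gamma> [^] n \<ominus> cf w n \<in> ?J" for n
    proof (induction n)
      case 0 thus ?case using c[of 0] w cfg(1)[OF w(1)] by simp
    next
      case (Suc n)
      have 1: "\<zero> \<ominus> (cf w (Suc n) \<ominus> \<gamma> \<otimes> cf w n) \<in> ?J"
        using c[of "Suc n"] cfg(2)[OF w(1)] by simp
      have cw: "cf w n \<in> carrier R" "cf w (Suc n) \<in> carrier R" "\<gamma> [^] n \<in> carrier R"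
        using w \<gamma> by auto
      have "\<gamma> [^] n \<otimes> \<gamma> \<ominus> cf w (Suc n) =
          \<gamma> \<otimes> (\<gamma> [^] n \<ominus> cf w n) \<oplus> (\<zero> \<ominus> (cf w (Suc n) \<ominus> \<gamma> \<otimes> cf w n))"
        using cw \<gamma> R.zero_closed by algebra
      thus ?case using 1 Suc.IH J \<gamma> by (simp add: R.ideal_add_closed ideal.I_l_closed)
    qed
    from this[of "Suc (deg R w)"] have "\<gamma> [^] Suc (deg R w) \<in> ?J"
      using deg_aboveD[of w "Suc (deg R w)"] w \<gamma> by (simp add: R.minus_eq)
    thus False using durable by blast
  qed
qed

end

section \<open>Quotients on a prescribed type\<close>

text \<open>The ring analogue of \<^const>\<open>regular_sequence\<close>, with elements of the ring itself.\<close>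
definition proper_regular :: "('a, 'k) ring_scheme \<Rightarrow> 'a list \<Rightarrow> bool" where
  "proper_regular A ys \<longleftrightarrow> regular_mod A {\<zero>\<^bsub>A\<^esub>} ys \<and> \<one>\<^bsub>A\<^esub> \<notin> spn A {\<zero>\<^bsub>A\<^esub>} ys"

text \<open>Quotients are realized on representatives instead of cosets, and transported along an injection.
  So the type of the elements of a quotient can be prescribed, which allows Zorn's lemma to range
  over rings of one fixed type.\<close>
lemma (in cring) quotient_realization:
  fixes e :: "'a \<Rightarrow> 'q"
  assumes I: "ideal I R" and e: "inj e"
  obtains Q :: "'q ring" and \<pi> where "cring Q" "\<pi> \<in> ring_hom R Q" "\<pi> ` carrier R = carrier Q"
    "\<And>u. u \<in> carrier R \<Longrightarrow> \<pi> u = \<zero>\<^bsub>Q\<^esub> \<longleftrightarrow> u \<in> I"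
proof -
  interpret I: ideal I R by fact
  have IA: "abelian_subgroup I R"
    by (intro abelian_subgroupI3 I.additive_subgroup_axioms is_abelian_group)
  define \<pi> where "\<pi> u = e (SOME v. v \<in> I +> u)" for u
  have rep: "(SOME v. v \<in> I +> u) \<in> I +> u" if "u \<in> carrier R" for u
    using abelian_subgroup.a_rcos_self[OF IA that] by (rule someI)
  have eq: "\<pi> a = \<pi> b \<longleftrightarrow> a \<ominus> b \<in> I" if ab: "a \<in> carrier R" "b \<in> carrier R" for a b
  proof
    assume "\<pi> a = \<pi> b"
    hence "(SOME v. v \<in> I +> a) = (SOME v. v \<in> I +> b)" using e by (simp add: \<pi>_def inj_eq)
    hence "I +> a = I +> b" using rep ab a_repr_independence[OF _ _ I.a_subgroup] by metis
    thus "a \<ominus> b \<in> I" using quotient_eq_iff_same_a_r_cos[OF I ab] by simp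
  next
    assume "a \<ominus> b \<in> I"
    thus "\<pi> a = \<pi> b" using quotient_eq_iff_same_a_r_cos[OF I ab] by (simp add: \<pi>_def)
  qed
  have w: "weak_ring_morphism \<pi> I R" by (rule weak_ring_morphismI[OF I eq])
  let ?Q = "image_ring \<pi> R"
  have hom: "\<pi> \<in> ring_hom R ?Q" by (rule weak_ring_morphism_is_hom[OF w])
  interpret Q: ring ?Q by (rule image_ring_is_ring[OF w])
  have car: "\<pi> ` carrier R = carrier ?Q" by (simp add: image_ring_carrier)
  have "cring ?Q"
  proof (unfold_locales)
    fix x y assume "x \<in> carrier ?Q" "y \<in> carrier ?Q"
    then obtain a b where "a \<in> carrier R" "b \<in> carrier R" "x = \<pi> a" "y = \<pi> b"
      using car by (metis imageE)
    thus "x \<otimes>\<^bsub>?Q\<^esub> y = y \<otimes>\<^bsub>?Q\<^esub> x"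
      using ring_hom_mult[OF hom, of a b] ring_hom_mult[OF hom, of b a] by (simp add: m_comm)
  qed
  moreover have "\<pi> u = \<zero>\<^bsub>?Q\<^esub> \<longleftrightarrow> u \<in> I" if "u \<in> carrier R" for u
    using eq[OF that zero_closed] that by (simp add: image_ring_zero minus_eq)
  ultimately show thesis using that hom car by blast
qed

lemma adj_surjective_image:
  assumes "cring A" "cring Q" and hom: "\<pi> \<in> ring_hom A Q" and surj: "\<pi> ` carrier A = carrier Q"
    and J: "\<And>u. u \<in> carrier A \<Longrightarrow> \<pi> u \<in> J' \<longleftrightarrow> u \<in> J" and y: "y \<in> carrier A" and u: "u \<in> carrier A"
  shows "\<pi> u \<in> adj Q J' (\<pi> y) \<longleftrightarrow> u \<in> adj A J y"
proof -
  interpret A: cring A by fact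
  interpret Q: cring Q by fact
  interpret h: ring_hom_cring A Q \<pi> using hom by unfold_locales
  have "\<pi> u \<ominus>\<^bsub>Q\<^esub> \<pi> y \<otimes>\<^bsub>Q\<^esub> \<pi> v \<in> J' \<longleftrightarrow> u \<ominus>\<^bsub>A\<^esub> y \<otimes>\<^bsub>A\<^esub> v \<in> J" if v: "v \<in> carrier A" for v
    using J[of "u \<ominus>\<^bsub>A\<^esub> y \<otimes>\<^bsub>A\<^esub> v"] u y v by (simp add: A.minus_eq Q.minus_eq)
  thus ?thesis using u surj unfolding adj_def
    by (auto simp flip: surj)
qed

lemma spn_surjective_image:
  assumes "cring A" "cring Q" "\<pi> \<in> ring_hom A Q" "\<pi> ` carrier A = carrier Q"
    and "\<And>u. u \<in> carrier A \<Longrightarrow> \<pi> u \<in> J' \<longleftrightarrow> u \<in> J" and "set ys \<subseteq> carrier A"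
    and "u \<in> carrier A"
  shows "\<pi> u \<in> spn Q J' (map \<pi> ys) \<longleftrightarrow> u \<in> spn A J ys"
  using assms(5-)
proof (induction ys arbitrary: J J' u)
  case (Cons y ys)
  have y: "y \<in> carrier A" using Cons.prems by simp
  have "\<pi> v \<in> adj Q J' (\<pi> y) \<longleftrightarrow> v \<in> adj A J y" if "v \<in> carrier A" for v
    by (rule adj_surjective_image[OF assms(1-4) Cons.prems(1) y that])
  thus ?case using Cons.IH[of "adj Q J' (\<pi> y)" "adj A J y"] Cons.prems by (simp add: spn_Cons)
qed simp

lemma proper_regular_surjective_image:
  assumes A: "cring A" and Q: "cring Q" and hom: "\<pi> \<in> ring_hom A Q"
    and surj: "\<pi> ` carrier A = carrier Q"
    and ker: "\<And>u. u \<in> carrier A \<Longrightarrow> \<pi> u = \<zero>\<^bsub>Q\<^esub> \<longleftrightarrow> u \<in> I" and ys: "set ys \<subseteq> carrier A"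
    and reg: "regular_mod A I ys" and pr: "\<one>\<^bsub>A\<^esub> \<notin> spn A I ys"
  shows "proper_regular Q (map \<pi> ys)"
proof -
  interpret A: cring A by fact
  have ker': "\<pi> u \<in> {\<zero>\<^bsub>Q\<^esub>} \<longleftrightarrow> u \<in> I" if "u \<in> carrier A" for u using ker that by simp
  have span: "\<pi> u \<in> spn Q {\<zero>\<^bsub>Q\<^esub>} (take k (map \<pi> ys)) \<longleftrightarrow> u \<in> spn A I (take k ys)"
    if "u \<in> carrier A" for u k
    unfolding take_map using ys that
    by (intro spn_surjective_image[OF A Q hom surj ker']) (auto dest: in_set_takeD)
  have "regular_mod Q {\<zero>\<^bsub>Q\<^esub>} (map \<pi> ys)"
    unfolding regular_mod_def
  proof (intro allI impI ballI)
    fix k u assume k: "k < length (map \<pi> ys)" and "u \<in> carrier Q"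
      and m: "map \<pi> ys ! k \<otimes>\<^bsub>Q\<^esub> u \<in> spn Q {\<zero>\<^bsub>Q\<^esub>} (take k (map \<pi> ys))"
    then obtain v where v: "v \<in> carrier A" "u = \<pi> v" using surj by blast
    have yk: "ys ! k \<in> carrier A" using ys k by auto
    have "\<pi> (ys ! k \<otimes>\<^bsub>A\<^esub> v) \<in> spn Q {\<zero>\<^bsub>Q\<^esub>} (take k (map \<pi> ys))"
      using m k v by (simp add: ring_hom_mult[OF hom yk v(1)])
    hence "ys ! k \<otimes>\<^bsub>A\<^esub> v \<in> spn A I (take k ys)" using span yk v by simp
    hence "v \<in> spn A I (take k ys)" using reg k v by (simp add: regular_mod_def)
    thus "u \<in> spn Q {\<zero>\<^bsub>Q\<^esub>} (take k (map \<pi> ys))" using span v by simp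
  qed
  moreover have "\<one>\<^bsub>Q\<^esub> \<notin> spn Q {\<zero>\<^bsub>Q\<^esub>} (map \<pi> ys)"
    using span[of "\<one>\<^bsub>A\<^esub>" "length ys"] pr ring_hom_one[OF hom] by simp
  ultimately show ?thesis by (simp add: proper_regular_def)
qed


section \<open>Localized filtered products\<close>

definition prod_ring :: "('j \<Rightarrow> ('a, 'k) ring_scheme) \<Rightarrow> ('j \<Rightarrow> 'a) ring" where
  "prod_ring A = \<lparr>carrier = {u. \<forall>j. u j \<in> carrier (A j)},
     monoid.mult = (\<lambda>u v j. u j \<otimes>\<^bsub>A j\<^esub> v j), one = (\<lambda>j. \<one>\<^bsub>A j\<^esub>),
     ring.zero = (\<lambda>j. \<zero>\<^bsub>A j\<^esub>), ring.add = (\<lambda>u v j. u j \<oplus>\<^bsub>A j\<^esub> v j)\<rparr>"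

lemma prod_ring_simps [simp]:
  "u \<in> carrier (prod_ring A) \<longleftrightarrow> (\<forall>j. u j \<in> carrier (A j))"
  "(u \<otimes>\<^bsub>prod_ring A\<^esub> v) j = u j \<otimes>\<^bsub>A j\<^esub> v j"
  "(u \<oplus>\<^bsub>prod_ring A\<^esub> v) j = u j \<oplus>\<^bsub>A j\<^esub> v j"
  "\<one>\<^bsub>prod_ring A\<^esub> j = \<one>\<^bsub>A j\<^esub>"
  "\<zero>\<^bsub>prod_ring A\<^esub> j = \<zero>\<^bsub>A j\<^esub>"
  by (simp_all add: prod_ring_def)

lemma prod_ring_cring:
  assumes A: "\<And>j. cring (A j)"
  shows "cring (prod_ring A)"
proof (rule cringI)
  interpret A: cring "A j" for j by (rule A)
  show "abelian_group (prod_ring A)"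
  proof (rule abelian_groupI)
    fix x assume x: "x \<in> carrier (prod_ring A)"
    show "\<exists>y\<in>carrier (prod_ring A). y \<oplus>\<^bsub>prod_ring A\<^esub> x = \<zero>\<^bsub>prod_ring A\<^esub>"
      using x by (intro bexI[of _ "\<lambda>j. \<ominus>\<^bsub>A j\<^esub> x j"] ext) (simp_all add: A.l_neg)
  qed (auto intro!: ext simp: A.a_ac)
  show "comm_monoid (prod_ring A)"
    by (rule comm_monoidI) (auto intro!: ext simp: A.m_ac)
qed (use A in \<open>auto intro!: ext simp: cring.cring_simprules\<close>)

lemma prod_ring_minus:
  assumes A: "\<And>j. cring (A j)" and "u \<in> carrier (prod_ring A)" "v \<in> carrier (prod_ring A)"
  shows "(u \<ominus>\<^bsub>prod_ring A\<^esub> v) j = u j \<ominus>\<^bsub>A j\<^esub> v j"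
proof -
  interpret Aj: cring "A j" by (rule A)
  interpret P: cring "prod_ring A" by (rule prod_ring_cring[OF A])
  have "(\<ominus>\<^bsub>prod_ring A\<^esub> v) j \<oplus>\<^bsub>A j\<^esub> v j = \<zero>\<^bsub>A j\<^esub>"
    using P.l_neg[OF assms(3)] prod_ring_simps(3,5) by metis
  moreover have "(\<ominus>\<^bsub>prod_ring A\<^esub> v) j \<in> carrier (A j)" "v j \<in> carrier (A j)"
    using P.a_inv_closed[OF assms(3)] assms(3) by simp_all
  ultimately have *: "\<ominus>\<^bsub>A j\<^esub> v j = (\<ominus>\<^bsub>prod_ring A\<^esub> v) j"
    by (intro Aj.minus_equality)
  thus ?thesis by (simp add: a_minus_def)
qed

lemma prod_ring_pow: "(u [^]\<^bsub>prod_ring A\<^esub> (n::nat)) j = u j [^]\<^bsub>A j\<^esub> n"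
  by (induction n) (simp_all add: nat_pow_def)

text \<open>The families that lie in \<open>\<Prod> K\<^sub>j\<close> for some \<open>K\<close> in \<open>KK\<close>. For the families \<open>K\<close> that are zero from
  some index on and the unit ideal before, these are the eventually vanishing families.\<close>
definition filtered_ideal ::
  "('j \<Rightarrow> ('a, 'k) ring_scheme) \<Rightarrow> ('j \<Rightarrow> 'a set) set \<Rightarrow> ('j \<Rightarrow> 'a) set" where
  "filtered_ideal A KK = {u \<in> carrier (prod_ring A). \<exists>K\<in>KK. \<forall>j. u j \<in> K j}"

lemma filtered_ideal_ideal:
  assumes A: "\<And>j. cring (A j)" and ne: "KK \<noteq> {}"
    and K: "\<And>K j. K \<in> KK \<Longrightarrow> ideal (K j) (A j)"
    and dir: "\<And>K L. K \<in> KK \<Longrightarrow> L \<in> KK \<Longrightarrow> \<exists>M\<in>KK. \<forall>j. K j \<union> L j \<subseteq> M j"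
  shows "ideal (filtered_ideal A KK) (prod_ring A)"
proof -
  interpret A: cring "A j" for j by (rule A)
  interpret P: cring "prod_ring A" by (rule prod_ring_cring[OF A])
  have minus: "u \<ominus>\<^bsub>prod_ring A\<^esub> v \<in> filtered_ideal A KK"
    if "u \<in> filtered_ideal A KK" "v \<in> filtered_ideal A KK" for u v
  proof -
    from that obtain K L where KL: "K \<in> KK" "\<forall>j. u j \<in> K j" "L \<in> KK" "\<forall>j. v j \<in> L j"
      and uv: "u \<in> carrier (prod_ring A)" "v \<in> carrier (prod_ring A)"
      by (auto simp: filtered_ideal_def simp del: prod_ring_simps(1))
    obtain M where M: "M \<in> KK" "\<forall>j. K j \<union> L j \<subseteq> M j" using dir KL by blast
    have "(u \<ominus>\<^bsub>prod_ring A\<^esub> v) j \<in> M j" for j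
      unfolding prod_ring_minus[OF A uv]
      by (rule A.ideal_minus_closed[OF K[OF M(1)]]) (use KL M in blast)+
    thus ?thesis unfolding filtered_ideal_def using M P.minus_closed[OF uv] by blast
  qed
  have zero: "\<zero>\<^bsub>prod_ring A\<^esub> \<in> filtered_ideal A KK"
    using ne additive_subgroup.zero_closed[OF ideal.axioms(1)[OF K]]
    by (auto simp: filtered_ideal_def)
  have sub: "filtered_ideal A KK \<subseteq> carrier (prod_ring A)"
    unfolding filtered_ideal_def by blast
  have neg: "\<ominus>\<^bsub>prod_ring A\<^esub> v \<in> filtered_ideal A KK" if "v \<in> filtered_ideal A KK" for v
    using minus[OF zero that] sub that by (auto simp: P.minus_eq simp del: prod_ring_simps(1))
  show ?thesis
  proof (rule idealI[OF P.ring_axioms])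
    show "subgroup (filtered_ideal A KK) (add_monoid (prod_ring A))"
    proof (rule P.add.subgroupI)
      fix u v assume uv: "u \<in> filtered_ideal A KK" "v \<in> filtered_ideal A KK"
      hence "u \<oplus>\<^bsub>prod_ring A\<^esub> v = u \<ominus>\<^bsub>prod_ring A\<^esub> (\<ominus>\<^bsub>prod_ring A\<^esub> v)"
        using sub by (auto simp: P.minus_eq simp del: prod_ring_simps(1))
      thus "u \<oplus>\<^bsub>prod_ring A\<^esub> v \<in> filtered_ideal A KK" using minus[OF uv(1) neg[OF uv(2)]] by simp
    qed (use sub zero neg in auto)
  next
    fix u x assume u: "u \<in> filtered_ideal A KK" and x: "x \<in> carrier (prod_ring A)"
    then obtain K where "K \<in> KK" "\<forall>j. u j \<in> K j" by (auto simp: filtered_ideal_def)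
    hence "\<forall>j. (x \<otimes>\<^bsub>prod_ring A\<^esub> u) j \<in> K j"
      using x by (auto intro: ideal.I_l_closed[OF K])
    moreover have uc: "u \<in> carrier (prod_ring A)" using u sub by blast
    ultimately show xu: "x \<otimes>\<^bsub>prod_ring A\<^esub> u \<in> filtered_ideal A KK"
      unfolding filtered_ideal_def using \<open>K \<in> KK\<close> P.m_closed[OF x uc] by blast
    show "u \<otimes>\<^bsub>prod_ring A\<^esub> x \<in> filtered_ideal A KK"
      using xu P.m_comm[OF x uc] by simp
  qed
qed

text \<open>Products commute with finitely generated ideals: cofactors can be chosen in each factor.\<close>
lemma adj_filtered_ideal:
  assumes A: "\<And>j. cring (A j)" and y: "y \<in> carrier (prod_ring A)"
  shows "adj (prod_ring A) (filtered_ideal A KK) y =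
    filtered_ideal A ((\<lambda>K j. adj (A j) (K j) (y j)) ` KK)"
proof
  interpret A: cring "A j" for j by (rule A)
  interpret P: cring "prod_ring A" by (rule prod_ring_cring[OF A])
  show "adj (prod_ring A) (filtered_ideal A KK) y \<subseteq>
      filtered_ideal A ((\<lambda>K j. adj (A j) (K j) (y j)) ` KK)"
  proof
    fix u assume u: "u \<in> adj (prod_ring A) (filtered_ideal A KK) y"
    then obtain v where v: "v \<in> carrier (prod_ring A)"
      "u \<ominus>\<^bsub>prod_ring A\<^esub> y \<otimes>\<^bsub>prod_ring A\<^esub> v \<in> filtered_ideal A KK" by (rule P.adjE)
    have uc: "u \<in> carrier (prod_ring A)" using u unfolding adj_def by blast
    obtain K where K: "K \<in> KK" "\<And>j. (u \<ominus>\<^bsub>prod_ring A\<^esub> y \<otimes>\<^bsub>prod_ring A\<^esub> v) j \<in> K j"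
      using v(2) by (auto simp: filtered_ideal_def)
    have "u j \<in> adj (A j) (K j) (y j)" for j
      using K(2)[of j] uc v(1) y unfolding prod_ring_minus[OF A uc P.m_closed[OF y v(1)]]
      by (intro A.adjI[of _ j "v j"]) auto
    thus "u \<in> filtered_ideal A ((\<lambda>K j. adj (A j) (K j) (y j)) ` KK)"
      using K(1) uc by (auto simp: filtered_ideal_def)
  qed
  show "filtered_ideal A ((\<lambda>K j. adj (A j) (K j) (y j)) ` KK) \<subseteq>
      adj (prod_ring A) (filtered_ideal A KK) y"
  proof
    fix u assume "u \<in> filtered_ideal A ((\<lambda>K j. adj (A j) (K j) (y j)) ` KK)"
    then obtain K where uc: "u \<in> carrier (prod_ring A)" and K: "K \<in> KK"
      "\<forall>j. u j \<in> adj (A j) (K j) (y j)"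
      unfolding filtered_ideal_def by blast
    hence "\<forall>j. \<exists>w. w \<in> carrier (A j) \<and> u j \<ominus>\<^bsub>A j\<^esub> y j \<otimes>\<^bsub>A j\<^esub> w \<in> K j"
      by (auto simp: adj_def)
    then obtain v where v: "\<forall>j. v j \<in> carrier (A j) \<and> u j \<ominus>\<^bsub>A j\<^esub> y j \<otimes>\<^bsub>A j\<^esub> v j \<in> K j"
      by metis
    hence vc: "v \<in> carrier (prod_ring A)" by simp
    have "u \<ominus>\<^bsub>prod_ring A\<^esub> y \<otimes>\<^bsub>prod_ring A\<^esub> v \<in> filtered_ideal A KK"
      unfolding filtered_ideal_def using K(1) v P.minus_closed[OF uc P.m_closed[OF y vc]]
      by (auto simp: prod_ring_minus[OF A uc P.m_closed[OF y vc]] simp del: prod_ring_simps(1))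
    thus "u \<in> adj (prod_ring A) (filtered_ideal A KK) y" by (rule P.adjI[OF uc vc])
  qed
qed

lemma spn_filtered_ideal:
  assumes A: "\<And>j. cring (A j)" and ys: "set ys \<subseteq> carrier (prod_ring A)"
  shows "spn (prod_ring A) (filtered_ideal A KK) ys =
    filtered_ideal A ((\<lambda>K j. spn (A j) (K j) (map (\<lambda>y. y j) ys)) ` KK)"
  using ys
proof (induction ys arbitrary: KK)
  case (Cons y ys)
  have y: "y \<in> carrier (prod_ring A)" and ys: "set ys \<subseteq> carrier (prod_ring A)"
    using Cons.prems by (auto simp del: prod_ring_simps)
  show ?case
    unfolding spn_Cons adj_filtered_ideal[OF A y] Cons.IH[OF ys] by (simp add: image_image spn_Cons)
qed simp

text \<open>The source of all good maps. The ring \<open>\<Prod> A\<^sub>j\<close> is divided by the directed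
  union of the ideals \<open>\<Prod> K\<^sub>j\<close> with \<open>K\<close> in \<open>KK\<close>, and \<open>\<gamma> = (c\<^sub>j)\<close> is inverted. The maps \<open>f\<^sub>j\<close> need
  to be multiplicative and additive only modulo this union. Regularity holds because \<open>\<gamma>\<close> kills the
  obstructions, at the price of passing to a larger \<open>K\<close>. The quotient is proper because no single
  exponent \<open>N\<close> brings \<open>c\<^sub>j\<^sup>N\<close> into the ideal generated by the sequence for all \<open>j\<close>.\<close>
theorem localized_filtered_product:
  fixes A :: "'j \<Rightarrow> ('a, 'k) ring_scheme" and S :: "('s, 'l) ring_scheme"
    and f :: "'j \<Rightarrow> 's \<Rightarrow> 'a" and e :: "(nat \<Rightarrow> 'j \<Rightarrow> 'a) \<Rightarrow> 'b"
  assumes e: "inj e" and S: "cring S" and A: "\<And>j. cring (A j)"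
    and ne: "KK \<noteq> {}"
    and K: "\<And>K j. K \<in> KK \<Longrightarrow> ideal (K j) (A j)"
    and dir: "\<And>K L. K \<in> KK \<Longrightarrow> L \<in> KK \<Longrightarrow> \<exists>M\<in>KK. \<forall>j. K j \<union> L j \<subseteq> M j"
    and f: "\<And>j s. s \<in> carrier S \<Longrightarrow> f j s \<in> carrier (A j)"
    and f_one: "\<exists>K\<in>KK. \<forall>j. f j \<one>\<^bsub>S\<^esub> \<ominus>\<^bsub>A j\<^esub> \<one>\<^bsub>A j\<^esub> \<in> K j"
    and f_add: "\<And>s t. s \<in> carrier S \<Longrightarrow> t \<in> carrier S \<Longrightarrow>
      \<exists>K\<in>KK. \<forall>j. f j (s \<oplus>\<^bsub>S\<^esub> t) \<ominus>\<^bsub>A j\<^esub> (f j s \<oplus>\<^bsub>A j\<^esub> f j t) \<in> K j"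
    and f_mult: "\<And>s t. s \<in> carrier S \<Longrightarrow> t \<in> carrier S \<Longrightarrow>
      \<exists>K\<in>KK. \<forall>j. f j (s \<otimes>\<^bsub>S\<^esub> t) \<ominus>\<^bsub>A j\<^esub> (f j s \<otimes>\<^bsub>A j\<^esub> f j t) \<in> K j"
    and c: "\<And>j. c j \<in> carrier (A j)"
    and zs: "set zs \<subseteq> carrier S"
    and kills: "\<And>K. K \<in> KK \<Longrightarrow>
      \<exists>L\<in>KK. \<forall>j. kills_colons (A j) (c j) (K j) (L j) (map (f j) zs)"
    and durable: "\<And>K N. K \<in> KK \<Longrightarrow>
      \<exists>j. c j [^]\<^bsub>A j\<^esub> (N::nat) \<notin> spn (A j) (K j) (map (f j) zs)"
  obtains B :: "'b ring" and h where "cring B" "h \<in> ring_hom S B" "proper_regular B (map h zs)"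
    "\<And>s. s \<in> carrier S \<Longrightarrow> \<exists>K\<in>KK. \<forall>j. c j \<otimes>\<^bsub>A j\<^esub> f j s \<in> K j \<Longrightarrow> h s = \<zero>\<^bsub>B\<^esub>"
proof -
  interpret A: cring "A j" for j by (rule A)
  interpret S: cring S by fact
  let ?P = "prod_ring A" and ?K = "filtered_ideal A KK"
  interpret P: cring ?P by (rule prod_ring_cring[OF A])
  interpret U: UP_cring ?P "UP ?P" by unfold_locales simp
  define F where "F s = (\<lambda>j. f j s)" for s
  have F: "F s \<in> carrier ?P" if "s \<in> carrier S" for s using f that by (simp add: F_def)
  have cP: "c \<in> carrier ?P" using c by simp
  have IK: "ideal ?K ?P" using filtered_ideal_ideal[of A KK] A ne K dir by blast
  have ys: "set (map F zs) \<subseteq> carrier ?P" using F zs by (auto simp del: prod_ring_simps)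
  have span: "u \<in> spn ?P ?K (take k (map F zs)) \<longleftrightarrow>
      (\<exists>K\<in>KK. \<forall>j. u j \<in> spn (A j) (K j) (take k (map (f j) zs)))"
    if "u \<in> carrier ?P" for u k
  proof -
    have "set (take k (map F zs)) \<subseteq> carrier ?P"
      using ys set_take_subset[of k "map F zs"] by (rule subset_trans[rotated])
    moreover have "map (\<lambda>y. y j) (take k (map F zs)) = take k (map (f j) zs)" for j
      by (simp add: take_map F_def)
    ultimately show ?thesis using that
      unfolding spn_filtered_ideal[OF A \<open>set (take k (map F zs)) \<subseteq> _\<close>]
      by (simp add: filtered_ideal_def del: prod_ring_simps)
  qed
  have killsP: "kills_colons ?P c ?K ?K (map F zs)"
    unfolding kills_colons_def
  proof (intro allI impI ballI)
    fix k u assume k: "k < length (map F zs)" and u: "u \<in> carrier ?P"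
      and m: "map F zs ! k \<otimes>\<^bsub>?P\<^esub> u \<in> spn ?P ?K (take k (map F zs))"
    have zk: "map F zs ! k \<in> carrier ?P" using ys k nth_mem by blast
    obtain K' where K': "K' \<in> KK"
      "\<forall>j. (map F zs ! k \<otimes>\<^bsub>?P\<^esub> u) j \<in> spn (A j) (K' j) (take k (map (f j) zs))"
      using m span[OF P.m_closed[OF zk u]] by blast
    obtain L where L: "L \<in> KK" "\<forall>j. kills_colons (A j) (c j) (K' j) (L j) (map (f j) zs)"
      using kills[OF K'(1)] by blast
    have "(c \<otimes>\<^bsub>?P\<^esub> u) j \<in> spn (A j) (L j) (take k (map (f j) zs))" for j
      using L(2) K'(2) k u unfolding kills_colons_def by (auto simp: F_def)
    thus "c \<otimes>\<^bsub>?P\<^esub> u \<in> spn ?P ?K (take k (map F zs))"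
      using span[OF P.m_closed[OF cP u]] L(1) by blast
  qed
  have durableP: "c [^]\<^bsub>?P\<^esub> N \<notin> spn ?P ?K (map F zs)" for N :: nat
    using durable span[OF P.nat_pow_closed[OF cP, of N], of "length zs"]
    by (auto simp: prod_ring_pow)
  define g where "g = \<one>\<^bsub>UP ?P\<^esub> \<ominus>\<^bsub>UP ?P\<^esub> up_ring.monom (UP ?P) c 1"
  define I where "I = adj (UP ?P) (poly_ideal ?P ?K) g"
  define y where "y = (\<lambda>a. const_poly ?P a)"
  note loc = U.localization_regular[OF IK cP ys killsP durableP, folded g_def, folded I_def]
  have I: "ideal I (UP ?P)"
    unfolding I_def by (rule U.P.adj_ideal[OF U.poly_ideal_ideal[OF IK] loc(4)])
  obtain B :: "'b ring" and \<pi> where B: "cring B" and \<pi>: "\<pi> \<in> ring_hom (UP ?P) B"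
    and surj: "\<pi> ` carrier (UP ?P) = carrier B"
    and ker: "\<And>u. u \<in> carrier (UP ?P) \<Longrightarrow> \<pi> u = \<zero>\<^bsub>B\<^esub> \<longleftrightarrow> u \<in> I"
    using U.P.quotient_realization[OF I e] by metis
  interpret B: cring B by fact
  interpret \<pi>: ring_hom_cring "UP ?P" B \<pi> using \<pi> by unfold_locales
  define h where "h s = \<pi> (y (F s))" for s
  have yc: "y a \<in> carrier (UP ?P)" if "a \<in> carrier ?P" for a
    unfolding y_def using that by (rule U.monom_closed)
  have hom_y: "y \<in> ring_hom ?P (UP ?P)" unfolding y_def by (rule U.const_ring_hom)
  have KI: "y a \<in> I" if "a \<in> ?K" for a
  proof -
    have ac: "a \<in> carrier ?P" using that P.ideal_carrier[OF IK] by blast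
    have "U.cf (y a) n \<in> ?K" for n
      using that ac additive_subgroup.zero_closed[OF ideal.axioms(1)[OF IK]]
      unfolding y_def by (simp del: prod_ring_simps)
    hence "y a \<in> poly_ideal ?P ?K" using yc[OF ac] by (simp add: U.poly_ideal_alt)
    thus ?thesis unfolding I_def
      using U.P.adj_superset(1)[OF U.poly_ideal_ideal[OF IK] loc(4)] by blast
  qed
  have \<pi>_eq: "\<pi> (y a) = \<pi> (y b)"
    if ab: "a \<in> carrier ?P" "b \<in> carrier ?P" "a \<ominus>\<^bsub>?P\<^esub> b \<in> ?K" for a b
  proof -
    interpret y: ring_hom_cring ?P "UP ?P" y using hom_y by unfold_locales
    have "\<pi> (y (a \<ominus>\<^bsub>?P\<^esub> b)) = \<zero>\<^bsub>B\<^esub>" using ker KI[OF that(3)] yc P.minus_closed[OF ab(1,2)] by simp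
    hence "\<pi> (y a) \<ominus>\<^bsub>B\<^esub> \<pi> (y b) = \<zero>\<^bsub>B\<^esub>"
      using ab yc by (simp add: a_minus_def del: prod_ring_simps)
    thus ?thesis using B.r_right_minus_eq yc ab by (metis \<pi>.hom_closed)
  qed
  have memK: "u \<ominus>\<^bsub>?P\<^esub> v \<in> ?K" if "u \<in> carrier ?P" "v \<in> carrier ?P"
    "\<exists>K\<in>KK. \<forall>j. u j \<ominus>\<^bsub>A j\<^esub> v j \<in> K j" for u v
    unfolding filtered_ideal_def using that P.minus_closed[OF that(1,2)]
    by (auto simp: prod_ring_minus[OF A that(1,2)] simp del: prod_ring_simps)
  have h: "h \<in> ring_hom S B"
  proof (rule ring_hom_memI)
    fix s t assume s: "s \<in> carrier S" and t: "t \<in> carrier S"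
    show "h s \<in> carrier B" unfolding h_def using yc F s by simp
    have "h (s \<otimes>\<^bsub>S\<^esub> t) = \<pi> (y (F s \<otimes>\<^bsub>?P\<^esub> F t))"
      unfolding h_def using F s t f_mult[OF s t]
      by (intro \<pi>_eq memK) (simp_all add: F_def del: prod_ring_simps(1))
    also have "\<dots> = h s \<otimes>\<^bsub>B\<^esub> h t"
      unfolding h_def ring_hom_mult[OF hom_y F[OF s] F[OF t]] using yc F s t by simp
    finally show "h (s \<otimes>\<^bsub>S\<^esub> t) = h s \<otimes>\<^bsub>B\<^esub> h t" .
    have "h (s \<oplus>\<^bsub>S\<^esub> t) = \<pi> (y (F s \<oplus>\<^bsub>?P\<^esub> F t))"
      unfolding h_def using F s t f_add[OF s t]
      by (intro \<pi>_eq memK) (simp_all add: F_def del: prod_ring_simps(1))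
    also have "\<dots> = h s \<oplus>\<^bsub>B\<^esub> h t"
      unfolding h_def ring_hom_add[OF hom_y F[OF s] F[OF t]] using yc F s t by simp
    finally show "h (s \<oplus>\<^bsub>S\<^esub> t) = h s \<oplus>\<^bsub>B\<^esub> h t" .
  next
    have "h \<one>\<^bsub>S\<^esub> = \<pi> (y \<one>\<^bsub>?P\<^esub>)"
      unfolding h_def using F f_one
      by (intro \<pi>_eq memK) (simp_all add: F_def del: prod_ring_simps(1))
    thus "h \<one>\<^bsub>S\<^esub> = \<one>\<^bsub>B\<^esub>" using ring_hom_one[OF hom_y] by simp
  qed
  have "proper_regular B (map \<pi> (map y (map F zs)))"
    using loc(1,2) ys yc unfolding y_def
    by (intro proper_regular_surjective_image[OF U.P.cring_axioms B \<pi> surj ker]) auto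
  moreover have "map \<pi> (map y (map F zs)) = map h zs" by (simp add: h_def)
  ultimately have "proper_regular B (map h zs)" by (rule subst[rotated])
  moreover have "h s = \<zero>\<^bsub>B\<^esub>" if s: "s \<in> carrier S" and "\<exists>K\<in>KK. \<forall>j. c j \<otimes>\<^bsub>A j\<^esub> f j s \<in> K j" for s
  proof -
    have "c \<otimes>\<^bsub>?P\<^esub> F s \<in> ?K" unfolding filtered_ideal_def
      using that P.m_closed[OF cP F[OF s]] by (auto simp: F_def)
    hence "y (F s) \<in> I" unfolding y_def by (rule loc(3)[OF F[OF s]])
    thus ?thesis using ker yc F[OF s] by (simp add: h_def)
  qed
  ultimately show thesis using that B h by blast
qed

section \<open>Frobenius-twisted products\<close>

context cring
begin

lemma ideal_pow_closed:
  assumes I: "ideal I R" and a: "a \<in> I" and n: "n > 0"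
  shows "a [^] (n::nat) \<in> I"
proof -
  obtain k where k: "n = Suc k" using n by (cases n) auto
  show ?thesis unfolding k using ideal.I_l_closed[OF I a, of "a [^] k"] ideal_carrier[OF I a] by simp
qed

lemma pow_mem_mono:
  assumes I: "ideal I R" and a: "a \<in> carrier R" and "a [^] (n::nat) \<in> I" "n \<le> k"
  shows "a [^] k \<in> I"
proof -
  have "a [^] k = a [^] (k - n) \<otimes> a [^] n" using a assms(4) by (simp add: nat_pow_mult)
  thus ?thesis using ideal.I_l_closed[OF I assms(3), of "a [^] (k - n)"] a by simp
qed

lemma spn_powers_mono:
  assumes I: "ideal I R" and ys: "set ys \<subseteq> carrier R" and ab: "a \<le> b"
  shows "spn R I (map (\<lambda>y. y [^] (b::nat)) ys) \<subseteq> spn R I (map (\<lambda>y. y [^] (a::nat)) ys)"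
proof -
  have A: "set (map (\<lambda>y. y [^] n) ys) \<subseteq> carrier R" for n :: nat using ys by auto
  have J: "ideal (spn R I (map (\<lambda>y. y [^] a) ys)) R" by (rule spn_ideal[OF I A])
  show ?thesis
  proof (rule spn_least[OF J _ _ I])
    show "set (map (\<lambda>y. y [^] b) ys) \<subseteq> spn R I (map (\<lambda>y. y [^] a) ys)"
    proof
      fix x assume "x \<in> set (map (\<lambda>y. y [^] b) ys)"
      then obtain y where y: "y \<in> set ys" "x = y [^] b" by auto
      have "y [^] a \<in> spn R I (map (\<lambda>y. y [^] a) ys)"
        using spn_superset(2)[OF I A[of a]] y by auto
      thus "x \<in> spn R I (map (\<lambda>y. y [^] a) ys)"
        unfolding y(2) using pow_mem_mono[OF J _ _ ab, of y] y ys by blast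
    qed
  qed (rule spn_superset(1)[OF I A])
qed

end

text \<open>In characteristic \<open>p\<close>, a map that is a homomorphism modulo \<open>I\<close> stays one after composition with
  the Frobenius powers \<open>u \<mapsto> u^(p^n)\<close>. The product over all \<open>n\<close> of copies of \<open>A\<close>, with the sequence raised
  to the powers \<open>p\<^sup>n\<close>, makes a fixed element \<open>c\<close> harmless to invert: it is enough that no power of
  \<open>c\<close> lies in all the ideals \<open>I + (y\<^sub>1^(p^n),\<dots>,y\<^sub>d^(p^n))\<close>.\<close>
lemma frobenius_localization:
  fixes A :: "('a, 'k) ring_scheme" and S :: "('s, 'l) ring_scheme"
    and e :: "(nat \<Rightarrow> nat \<Rightarrow> 'a) \<Rightarrow> 'b"
  assumes e: "inj e" and S: "cring S" and A: "cring A" and I: "ideal I A"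
    and p: "Factorial_Ring.prime (p::nat)" and ch: "[p] \<cdot>\<^bsub>A\<^esub> \<one>\<^bsub>A\<^esub> = \<zero>\<^bsub>A\<^esub>"
    and f: "\<And>s. s \<in> carrier S \<Longrightarrow> f s \<in> carrier A"
    and f_one: "f \<one>\<^bsub>S\<^esub> \<ominus>\<^bsub>A\<^esub> \<one>\<^bsub>A\<^esub> \<in> I"
    and f_add: "\<And>s t. s \<in> carrier S \<Longrightarrow> t \<in> carrier S \<Longrightarrow>
      f (s \<oplus>\<^bsub>S\<^esub> t) \<ominus>\<^bsub>A\<^esub> (f s \<oplus>\<^bsub>A\<^esub> f t) \<in> I"
    and f_mult: "\<And>s t. s \<in> carrier S \<Longrightarrow> t \<in> carrier S \<Longrightarrow>
      f (s \<otimes>\<^bsub>S\<^esub> t) \<ominus>\<^bsub>A\<^esub> (f s \<otimes>\<^bsub>A\<^esub> f t) \<in> I"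
    and c: "c \<in> carrier A" and zs: "set zs \<subseteq> carrier S"
    and kills: "\<And>n. kills_colons A c I I (map (\<lambda>z. f z [^]\<^bsub>A\<^esub> (p ^ n)) zs)"
    and durable: "\<And>N::nat. \<exists>n. c [^]\<^bsub>A\<^esub> N \<notin> spn A I (map (\<lambda>z. f z [^]\<^bsub>A\<^esub> (p ^ n)) zs)"
  obtains B :: "'b ring" and h where "cring B" "h \<in> ring_hom S B" "proper_regular B (map h zs)"
    "\<And>s. s \<in> carrier S \<Longrightarrow> c \<otimes>\<^bsub>A\<^esub> f s \<in> I \<Longrightarrow> h s = \<zero>\<^bsub>B\<^esub>"
proof -
  interpret A: cring A by fact
  interpret S: cring S by fact
  define F where "F n s = f s [^]\<^bsub>A\<^esub> (p ^ n)" for n s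
  have pos: "p ^ n > 0" for n using prime_gt_0_nat[OF p] by simp
  note frob_add = A.frobenius_add[OF p ch] and frob_minus = A.frobenius_minus[OF p ch]
  have "\<And>n s. s \<in> carrier S \<Longrightarrow> F n s \<in> carrier A" using f by (simp add: F_def)
  moreover have "F n \<one>\<^bsub>S\<^esub> \<ominus>\<^bsub>A\<^esub> \<one>\<^bsub>A\<^esub> \<in> I" for n
    using A.ideal_pow_closed[OF I f_one pos[of n]] frob_minus[of "f \<one>\<^bsub>S\<^esub>" "\<one>\<^bsub>A\<^esub>" n] f
    by (simp add: F_def)
  moreover have "F n (s \<oplus>\<^bsub>S\<^esub> t) \<ominus>\<^bsub>A\<^esub> (F n s \<oplus>\<^bsub>A\<^esub> F n t) \<in> I"
    if st: "s \<in> carrier S" "t \<in> carrier S" for n s t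
    using A.ideal_pow_closed[OF I f_add[OF st] pos[of n]] f st
    by (simp add: F_def frob_minus frob_add)
  moreover have "F n (s \<otimes>\<^bsub>S\<^esub> t) \<ominus>\<^bsub>A\<^esub> (F n s \<otimes>\<^bsub>A\<^esub> F n t) \<in> I"
    if st: "s \<in> carrier S" "t \<in> carrier S" for n s t
    using A.ideal_pow_closed[OF I f_mult[OF st] pos[of n]] f st
    by (simp add: F_def frob_minus A.nat_pow_distrib)
  moreover have "c \<otimes>\<^bsub>A\<^esub> F n s \<in> I" if s: "s \<in> carrier S" "c \<otimes>\<^bsub>A\<^esub> f s \<in> I" for n s
  proof -
    obtain k where k: "p ^ n = Suc k" using pos[of n] by (cases "p ^ n") auto
    have "c \<otimes>\<^bsub>A\<^esub> F n s = f s [^]\<^bsub>A\<^esub> k \<otimes>\<^bsub>A\<^esub> (c \<otimes>\<^bsub>A\<^esub> f s)"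
      using f s c by (simp add: F_def k A.m_ac)
    thus ?thesis using ideal.I_l_closed[OF I s(2)] f s by simp
  qed
  ultimately show thesis
    using localized_filtered_product[OF e S A, of "{\<lambda>_. I}" F "\<lambda>_. c" zs thesis]
      I c zs kills durable that unfolding F_def by auto
qed

text \<open>The ideals \<open>(y\<^sub>1^q(n),\<dots>,y\<^sub>d^q(n))\<close> for the \<open>n\<close>-th sequence \<open>y\<close>. The convention for \<open>q(n) = 0\<close>
  makes it the unit ideal even for the empty sequence.\<close>
definition power_family :: "('a, 'k) ring_scheme \<Rightarrow> (nat \<Rightarrow> 'a list) \<Rightarrow> (nat \<Rightarrow> nat) \<Rightarrow> nat \<Rightarrow> 'a set" where
  "power_family A ys q n = (if q n = 0 then carrier A
     else spn A {\<zero>\<^bsub>A\<^esub>} (map (\<lambda>y. y [^]\<^bsub>A\<^esub> q n) (ys n)))"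

definition to_infinity :: "(nat \<Rightarrow> nat) \<Rightarrow> bool" where
  "to_infinity q \<longleftrightarrow> (\<forall>N. \<exists>m. \<forall>n\<ge>m. q n \<ge> N)"

text \<open>The product of the Frobenius twists of \<open>A\<close> is divided by all sequences whose \<open>n\<close>-th member lies in
  \<open>(y\<^sub>1^(p^n q(n)),\<dots>,y\<^sub>d^(p^n q(n)))\<close> for some \<open>q\<close> that tends to infinity. This replaces a completion:
  solving for a cofactor of \<open>y\<^sub>k\<^sub>+\<^sub>1\<close> only turns \<open>q\<close> into \<open>q - 1\<close>, which still tends to infinity. The
  twist allows the hypothesis to be about a power of \<open>f b\<close>, since \<open>p\<^sup>n \<ge> M\<close> for large \<open>n\<close>.\<close>
lemma kill_infinitely_divisible:
  fixes A :: "('a, 'k) ring_scheme" and S :: "('s, 'l) ring_scheme"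
    and e :: "(nat \<Rightarrow> nat \<Rightarrow> 'a) \<Rightarrow> 'b"
  assumes e: "inj e" and S: "cring S" and A: "cring A"
    and p: "Factorial_Ring.prime (p::nat)" and ch: "[p] \<cdot>\<^bsub>A\<^esub> \<one>\<^bsub>A\<^esub> = \<zero>\<^bsub>A\<^esub>"
    and f: "f \<in> ring_hom S A" and zs: "set zs \<subseteq> carrier S"
    and reg: "proper_regular A (map f zs)"
    and b: "b \<in> carrier S"
    and div: "\<And>Q::nat. f b [^]\<^bsub>A\<^esub> (M::nat) \<in> spn A {\<zero>\<^bsub>A\<^esub>} (map (\<lambda>z. f z [^]\<^bsub>A\<^esub> Q) zs)"
  obtains B :: "'b ring" and h where "cring B" "h \<in> ring_hom S B" "proper_regular B (map h zs)"
    "h b = \<zero>\<^bsub>B\<^esub>" "\<And>s. s \<in> carrier S \<Longrightarrow> f s = \<zero>\<^bsub>A\<^esub> \<Longrightarrow> h s = \<zero>\<^bsub>B\<^esub>"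
proof -
  interpret A: cring A by fact
  interpret S: cring S by fact
  interpret f: ring_hom_cring S A f using f by unfold_locales
  have Z: "ideal {\<zero>\<^bsub>A\<^esub>} A" by (rule A.zeroideal)
  define F where "F n s = f s [^]\<^bsub>A\<^esub> (p ^ n)" for n s
  define K where "K = power_family A (\<lambda>n. map (F n) zs)"
  define KK where "KK = {K q | q. to_infinity q}"
  have pos: "p ^ n > 0" for n using prime_gt_0_nat[OF p] by simp
  have le: "n \<le> p ^ n" for n using prime_gt_1_nat[OF p] by (simp add: less_imp_le less_exp)
  have Fc: "F n s \<in> carrier A" if "s \<in> carrier S" for n s using that by (simp add: F_def)
  have ys: "set (map (F n) zs) \<subseteq> carrier A" for n using Fc zs by auto
  have pys: "set (map (\<lambda>y. y [^]\<^bsub>A\<^esub> (a::nat)) (map (F n) zs)) \<subseteq> carrier A" for a n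
    using ys[of n] by auto
  have fz: "set (map f zs) \<subseteq> carrier A" using zs by auto
  have regF: "regular_mod A {\<zero>\<^bsub>A\<^esub>} (map (F n) zs)" for n
    using A.regular_mod_powers[OF Z fz, of "p ^ n"] reg
    by (simp add: F_def[abs_def] comp_def proper_regular_def)
  have K: "ideal (K q n) A" for q n
    unfolding K_def power_family_def using A.oneideal A.spn_ideal[OF Z pys[of "q n" n]]
    by (simp del: map_map)
  have K_mono: "K q n \<subseteq> K r n" if "r n \<le> q n" for q r n
  proof (cases "r n = 0")
    case True
    hence "K r n = carrier A" by (simp add: K_def power_family_def)
    thus ?thesis using A.ideal_carrier[OF K] by blast
  next
    case False
    thus ?thesis using A.spn_powers_mono[OF Z ys that] that
      by (simp add: K_def power_family_def del: map_map)
  qed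
  have zero: "\<zero>\<^bsub>A\<^esub> \<in> K q n" for q n
    using additive_subgroup.zero_closed[OF ideal.axioms(1)[OF K]] .
  have id: "to_infinity (\<lambda>n. n)" by (auto simp: to_infinity_def)
  hence some: "K (\<lambda>n. n) \<in> KK" by (auto simp: KK_def)
  show thesis
  proof (rule localized_filtered_product[OF e S A, of KK F "\<lambda>_. \<one>\<^bsub>A\<^esub>" zs])
    show "KK \<noteq> {}" using some by blast
    show "ideal (L j) A" if "L \<in> KK" for L j using that K by (auto simp: KK_def)
    show "\<exists>M\<in>KK. \<forall>j. L j \<union> L' j \<subseteq> M j" if LL: "L \<in> KK" "L' \<in> KK" for L L'
    proof -
      obtain q r where q: "L = K q" "to_infinity q" and r: "L' = K r" "to_infinity r"
        using LL by (auto simp: KK_def)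
      have "\<exists>m. \<forall>n\<ge>m. min (q n) (r n) \<ge> N" for N
      proof -
        obtain m m' where "\<forall>n\<ge>m. q n \<ge> N" "\<forall>n\<ge>m'. r n \<ge> N"
          using q(2) r(2) unfolding to_infinity_def by meson
        thus ?thesis by (intro exI[of _ "max m m'"]) auto
      qed
      hence "to_infinity (\<lambda>n. min (q n) (r n))" by (simp add: to_infinity_def)
      moreover have "L j \<union> L' j \<subseteq> K (\<lambda>n. min (q n) (r n)) j" for j
        unfolding q(1) r(1) using K_mono[of "\<lambda>n. min (q n) (r n)" j q]
          K_mono[of "\<lambda>n. min (q n) (r n)" j r] by simp
      ultimately show ?thesis by (intro bexI[of _ "K (\<lambda>n. min (q n) (r n))"]) (auto simp: KK_def)
    qed
    show "F j s \<in> carrier A" if "s \<in> carrier S" for j s using that by (rule Fc)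
    show "\<exists>K\<in>KK. \<forall>j. F j \<one>\<^bsub>S\<^esub> \<ominus>\<^bsub>A\<^esub> \<one>\<^bsub>A\<^esub> \<in> K j"
      using zero by (intro bexI[OF _ some]) (simp add: F_def A.minus_eq A.r_neg)
    show "\<exists>K\<in>KK. \<forall>j. F j (s \<oplus>\<^bsub>S\<^esub> t) \<ominus>\<^bsub>A\<^esub> (F j s \<oplus>\<^bsub>A\<^esub> F j t) \<in> K j"
      if "s \<in> carrier S" "t \<in> carrier S" for s t
      using zero that by (intro bexI[OF _ some])
        (simp add: F_def A.minus_eq A.r_neg A.frobenius_add[OF p ch])
    show "\<exists>K\<in>KK. \<forall>j. F j (s \<otimes>\<^bsub>S\<^esub> t) \<ominus>\<^bsub>A\<^esub> (F j s \<otimes>\<^bsub>A\<^esub> F j t) \<in> K j"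
      if "s \<in> carrier S" "t \<in> carrier S" for s t
      using zero that by (intro bexI[OF _ some])
        (simp add: F_def A.minus_eq A.r_neg A.nat_pow_distrib)
    show "\<exists>L'\<in>KK. \<forall>j. kills_colons A \<one>\<^bsub>A\<^esub> (L j) (L' j) (map (F j) zs)" if L: "L \<in> KK" for L
    proof -
      obtain q where q: "L = K q" "to_infinity q" using L by (auto simp: KK_def)
      have "\<exists>m. \<forall>n\<ge>m. q n - 1 \<ge> N" for N
        using q(2)[unfolded to_infinity_def, rule_format, of "Suc N"] by fastforce
      hence "to_infinity (\<lambda>n. q n - 1)" by (simp add: to_infinity_def)
      moreover have "kills_colons A \<one>\<^bsub>A\<^esub> (K q n) (K (\<lambda>n. q n - 1) n) (map (F n) zs)" for n
      proof (cases "q n \<le> 1")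
        case True
        hence "K (\<lambda>n. q n - 1) n = carrier A" by (simp add: K_def power_family_def)
        moreover have "spn A (carrier A) (take k (map (F n) zs)) = carrier A" for k
          using ys[of n] set_take_subset[of k "map (F n) zs"] by (intro A.spn_carrier) blast
        ultimately show ?thesis by (simp add: kills_colons_def)
      next
        case False
        then obtain Q where Q: "q n = Suc Q" "Q > 0" by (cases "q n") auto
        thus ?thesis using A.kills_colons_powers[OF Z ys regF, of Q n]
          by (simp add: K_def power_family_def)
      qed
      ultimately show ?thesis unfolding q(1)
        by (intro bexI[of _ "K (\<lambda>n. q n - 1)"]) (auto simp: KK_def)
    qed
    show "\<exists>j. \<one>\<^bsub>A\<^esub> [^]\<^bsub>A\<^esub> (N::nat) \<notin> spn A (L j) (map (F j) zs)" if L: "L \<in> KK" for L N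
    proof -
      obtain q where q: "L = K q" "to_infinity q" using L by (auto simp: KK_def)
      then obtain n where n: "q n \<ge> 1" unfolding to_infinity_def by blast
      let ?J = "spn A {\<zero>\<^bsub>A\<^esub>} (map f zs)"
      have J: "ideal ?J A" by (rule A.spn_ideal[OF Z fz])
      have zJ: "f z \<in> ?J" if "z \<in> set zs" for z using A.spn_superset(2)[OF Z fz] that by auto
      have 1: "set (map (F n) zs) \<subseteq> ?J"
        using zJ A.ideal_pow_closed[OF J _ pos] by (auto simp: F_def)
      hence "set (map (\<lambda>y. y [^]\<^bsub>A\<^esub> q n) (map (F n) zs)) \<subseteq> ?J"
        using A.ideal_pow_closed[OF J, of _ "q n"] n by force
      hence "spn A {\<zero>\<^bsub>A\<^esub>} (map (\<lambda>y. y [^]\<^bsub>A\<^esub> q n) (map (F n) zs)) \<subseteq> ?J"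
        by (rule A.spn_least[OF J A.spn_superset(1)[OF Z fz] _ Z])
      hence "K q n \<subseteq> ?J" using n by (simp add: K_def power_family_def del: map_map)
      hence "spn A (K q n) (map (F n) zs) \<subseteq> ?J" by (rule A.spn_least[OF J _ 1 K])
      thus ?thesis using reg q(1) by (auto simp: proper_regular_def)
    qed
  next
    fix B :: "'b ring" and h
    assume B: "cring B" "h \<in> ring_hom S B" "proper_regular B (map h zs)"
      and z: "\<And>s. s \<in> carrier S \<Longrightarrow> \<exists>K\<in>KK. \<forall>j. \<one>\<^bsub>A\<^esub> \<otimes>\<^bsub>A\<^esub> F j s \<in> K j \<Longrightarrow> h s = \<zero>\<^bsub>B\<^esub>"
    have "h s = \<zero>\<^bsub>B\<^esub>" if s: "s \<in> carrier S" "f s = \<zero>\<^bsub>A\<^esub>" for s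
      using zero pos Fc s by (intro z bexI[OF _ some]) (simp_all add: F_def A.nat_pow_zero)
    moreover have "h b = \<zero>\<^bsub>B\<^esub>"
    proof (rule z[OF b])
      define q where "q n = (if n \<ge> M then n else 0)" for n
      have "to_infinity q" unfolding to_infinity_def q_def
        by (intro allI exI[of _ "max M N" for N]) auto
      moreover have "F n b \<in> K q n" for n
      proof (cases "q n = 0")
        case True thus ?thesis using Fc b by (simp add: K_def power_family_def)
      next
        case False
        hence n: "q n = n" "M \<le> n" "n \<noteq> 0" by (auto simp: q_def split: if_splits)
        have eq: "map (\<lambda>y. y [^]\<^bsub>A\<^esub> q n) (map (F n) zs) = map (\<lambda>z. f z [^]\<^bsub>A\<^esub> (p ^ n * n)) zs"
          using zs by (auto simp: F_def A.nat_pow_pow n(1))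
        show ?thesis
          using A.pow_mem_mono[OF K _ _ order_trans[OF n(2) le], of "f b" q n] div[of "p ^ n * n"] b False
          unfolding K_def power_family_def eq by (simp add: F_def)
      qed
      ultimately show "\<exists>K\<in>KK. \<forall>j. \<one>\<^bsub>A\<^esub> \<otimes>\<^bsub>A\<^esub> F j b \<in> K j"
        using Fc b by (intro bexI[of _ "K q"]) (auto simp: KK_def)
    qed
    ultimately show thesis using that B by blast
  qed (use zs in auto)
qed

section \<open>A universe closed under the constructions\<close>

text \<open>A family of sets is encoded by its graph, \<open>{(c, v). v \<in> g c}\<close>, and pairs of indices by single ones.\<close>
lemma ex_inj_fun_set:
  fixes i :: "'c \<Rightarrow> 'i"
  assumes inf: "infinite (UNIV :: 'i set)" and i: "inj i"
  shows "\<exists>e :: ('c \<Rightarrow> 'i set) \<Rightarrow> 'i set. inj e"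
proof -
  have "|(UNIV :: 'i set) \<times> (UNIV :: 'i set)| \<le>o |UNIV :: 'i set|"
    by (rule ordIso_imp_ordLeq[OF card_of_Times_same_infinite[OF inf]])
  then obtain q :: "'i \<times> 'i \<Rightarrow> 'i" where q: "inj q"
    unfolding card_of_ordLeq[symmetric] by auto
  define e where "e g = {q (i c, v) | c v. v \<in> g c}" for g :: "'c \<Rightarrow> 'i set"
  have mem: "v \<in> g c \<longleftrightarrow> q (i c, v) \<in> e g" for g c v
    using q i by (auto simp: e_def inj_eq)
  have "inj e"
  proof (rule injI)
    fix g g' assume "e g = e g'"
    thus "g = g'" using mem[where g = g] mem[where g = g'] by (intro ext) blast
  qed
  thus ?thesis by blast
qed

lemma ex_inj_fun_comp:
  assumes "\<exists>e :: ('c \<Rightarrow> 'u) \<Rightarrow> 'u. inj e" "\<exists>e :: 'x \<Rightarrow> 'u. inj e"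
  shows "\<exists>e :: ('c \<Rightarrow> 'x) \<Rightarrow> 'u. inj e"
proof -
  obtain e :: "('c \<Rightarrow> 'u) \<Rightarrow> 'u" and d :: "'x \<Rightarrow> 'u" where "inj e" "inj d" using assms by blast
  hence "inj (\<lambda>g. e (d \<circ> g))" unfolding inj_def
    by (metis comp_apply ext)
  thus ?thesis by blast
qed

text \<open>A type large enough to hold all the rings below. It is a power set over an infinite type that
  contains the pairs of subsets of \<open>T\<close>. So it contains a copy of the function spaces from which the
  products over chains of pairs and the Frobenius products are cut out.\<close>
type_synonym 't universe = "('t set \<times> 't set \<times> nat) set"

lemma ex_inj_universe:
  "\<exists>e :: (nat \<Rightarrow> nat \<Rightarrow> 't universe) \<Rightarrow> 't universe. inj e"
  "\<exists>e :: (nat \<Rightarrow> nat \<Rightarrow> nat \<Rightarrow> 't universe) \<Rightarrow> 't universe. inj e"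
  "\<exists>e :: (nat \<Rightarrow> 't set \<times> 't set \<Rightarrow> 't universe) \<Rightarrow> 't universe. inj e"
proof -
  have inf: "infinite (UNIV :: ('t set \<times> 't set \<times> nat) set)"
    by (simp add: finite_prod)
  have nat: "\<exists>e :: (nat \<Rightarrow> 't universe) \<Rightarrow> 't universe. inj e"
    by (rule ex_inj_fun_set[OF inf, of "\<lambda>n. ({}, {}, n)"]) (auto simp: inj_def)
  have pair: "\<exists>e :: ('t set \<times> 't set \<Rightarrow> 't universe) \<Rightarrow> 't universe. inj e"
    by (rule ex_inj_fun_set[OF inf, of "\<lambda>x. (fst x, snd x, 0)"]) (auto simp: inj_def prod_eq_iff)
  note nat2 = ex_inj_fun_comp[OF nat nat]
  show "\<exists>e :: (nat \<Rightarrow> nat \<Rightarrow> 't universe) \<Rightarrow> 't universe. inj e" by (rule nat2)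
  show "\<exists>e :: (nat \<Rightarrow> nat \<Rightarrow> nat \<Rightarrow> 't universe) \<Rightarrow> 't universe. inj e"
    by (rule ex_inj_fun_comp[OF nat nat2])
  show "\<exists>e :: (nat \<Rightarrow> 't set \<times> 't set \<Rightarrow> 't universe) \<Rightarrow> 't universe. inj e"
    by (rule ex_inj_fun_comp[OF nat pair])
qed

section \<open>Killable ideals and maximal pairs\<close>

lemma char_ring_hom:
  assumes S: "ring S" and B: "ring B" and h: "h \<in> ring_hom S B"
    and ch: "[(p::nat)] \<cdot>\<^bsub>S\<^esub> \<one>\<^bsub>S\<^esub> = \<zero>\<^bsub>S\<^esub>"
  shows "[p] \<cdot>\<^bsub>B\<^esub> \<one>\<^bsub>B\<^esub> = \<zero>\<^bsub>B\<^esub>"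
proof -
  interpret S: ring S by fact
  interpret B: ring B by fact
  interpret h: ring_hom_ring S B h by (rule ring_hom_ringI2[OF S B h])
  have "h ([n] \<cdot>\<^bsub>S\<^esub> \<one>\<^bsub>S\<^esub>) = [n] \<cdot>\<^bsub>B\<^esub> \<one>\<^bsub>B\<^esub>" for n :: nat
    by (induction n) simp_all
  from this[of p] show ?thesis by (simp add: ch)
qed

lemma spn_power_witness:
  assumes B: "cring B" and ys: "set ys \<subseteq> carrier B" and p: "Factorial_Ring.prime (p::nat)"
    and mem: "\<And>n. c \<in> spn B {\<zero>\<^bsub>B\<^esub>} (map (\<lambda>y. y [^]\<^bsub>B\<^esub> (p ^ n)) ys)"
  shows "c \<in> spn B {\<zero>\<^bsub>B\<^esub>} (map (\<lambda>y. y [^]\<^bsub>B\<^esub> (Q::nat)) ys)"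
proof -
  interpret B: cring B by fact
  have "Q \<le> p ^ Q" using prime_gt_1_nat[OF p] by (simp add: less_imp_le less_exp)
  from B.spn_powers_mono[OF B.zeroideal ys this] show ?thesis using mem by blast
qed

text \<open>In the application \<open>zs\<close> holds the images in \<open>T\<close> of a system of parameters of the base ring.\<close>
locale char_p_base = cring T for T :: "('t, 'k) ring_scheme" (structure) +
  fixes zs :: "'t list" and p :: nat
  assumes prime_p: "Factorial_Ring.prime p" and char_p: "[p] \<cdot>\<^bsub>T\<^esub> \<one> = \<zero>"
begin

definition realizes :: "'t set \<Rightarrow> 't set \<Rightarrow> 't universe ring \<Rightarrow> ('t \<Rightarrow> 't universe) \<Rightarrow> bool" where
  "realizes E P B f \<longleftrightarrow> cring B \<and> f \<in> ring_hom (T\<lparr>carrier := E\<rparr>) B \<and>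
     proper_regular B (map f zs) \<and> (\<forall>s\<in>P. f s = \<zero>\<^bsub>B\<^esub>)"

definition killable :: "'t set \<Rightarrow> 't set \<Rightarrow> bool" where
  "killable E P \<longleftrightarrow> subring E T \<and> set zs \<subseteq> E \<and> P \<subseteq> E \<and> (\<exists>B f. realizes E P B f)"

lemma subring_cring:
  assumes "subring E T"
  shows "cring (T\<lparr>carrier := E\<rparr>)"
  using subcring_iff[of E] subcringI'[OF assms] subringE(1)[OF assms] by simp

lemma realizes_char:
  assumes "subring E T" "realizes E P B f"
  shows "[p] \<cdot>\<^bsub>B\<^esub> \<one>\<^bsub>B\<^esub> = \<zero>\<^bsub>B\<^esub>"
proof (rule char_ring_hom)
  show "ring (T\<lparr>carrier := E\<rparr>)" using subring_cring[OF assms(1)] by (rule cring.axioms(1))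
  show "ring B" using assms(2) by (auto simp: realizes_def cring.axioms(1))
  show "f \<in> ring_hom (T\<lparr>carrier := E\<rparr>) B" using assms(2) by (simp add: realizes_def)
  show "[p] \<cdot>\<^bsub>T\<lparr>carrier := E\<rparr>\<^esub> \<one>\<^bsub>T\<lparr>carrier := E\<rparr>\<^esub> = \<zero>\<^bsub>T\<lparr>carrier := E\<rparr>\<^esub>"
    using char_p by (simp add: add_pow_def nat_pow_def)
qed

lemma realizes_hom:
  assumes "realizes E P B f"
  shows "s \<in> E \<Longrightarrow> f s \<in> carrier B"
    "s \<in> E \<Longrightarrow> t \<in> E \<Longrightarrow> f (s \<oplus> t) = f s \<oplus>\<^bsub>B\<^esub> f t"
    "s \<in> E \<Longrightarrow> t \<in> E \<Longrightarrow> f (s \<otimes> t) = f s \<otimes>\<^bsub>B\<^esub> f t"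
    "f \<one> = \<one>\<^bsub>B\<^esub>"
proof -
  have f: "f \<in> ring_hom (T\<lparr>carrier := E\<rparr>) B" using assms by (simp add: realizes_def)
  show "s \<in> E \<Longrightarrow> f s \<in> carrier B" using ring_hom_closed[OF f, of s] by simp
  show "s \<in> E \<Longrightarrow> t \<in> E \<Longrightarrow> f (s \<oplus> t) = f s \<oplus>\<^bsub>B\<^esub> f t"
    using ring_hom_add[OF f, of s t] by simp
  show "s \<in> E \<Longrightarrow> t \<in> E \<Longrightarrow> f (s \<otimes> t) = f s \<otimes>\<^bsub>B\<^esub> f t"
    using ring_hom_mult[OF f, of s t] by simp
  show "f \<one> = \<one>\<^bsub>B\<^esub>" using ring_hom_one[OF f] by simp
qed

text \<open>The product of the targets modulo the families that vanish on a final segment of the chain. A map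
  that is not defined at \<open>s\<close> yet gets the value \<open>0\<close> there, which is invisible in the quotient.
  Indices outside the chain carry a ring of the chain with the unit ideal.\<close>
lemma killable_chain_union:
  fixes C :: "('t set \<times> 't set) set"
  assumes ne: "C \<noteq> {}" and kill: "\<And>U. U \<in> C \<Longrightarrow> killable (fst U) (snd U)"
    and chain: "\<And>U V. U \<in> C \<Longrightarrow> V \<in> C \<Longrightarrow>
      (fst U \<subseteq> fst V \<and> snd U \<subseteq> snd V) \<or> (fst V \<subseteq> fst U \<and> snd V \<subseteq> snd U)"
  shows "killable (\<Union>U\<in>C. fst U) (\<Union>U\<in>C. snd U)"
proof -
  let ?E = "\<Union>U\<in>C. fst U" and ?P = "\<Union>U\<in>C. snd U"
  define le where "le U V \<longleftrightarrow> fst U \<subseteq> fst V \<and> snd U \<subseteq> snd V" for U V :: "'t set \<times> 't set"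
  have le_refl: "le U U" for U by (simp add: le_def)
  have le_trans: "le U V \<Longrightarrow> le V Z \<Longrightarrow> le U Z" for U V Z by (auto simp: le_def)
  have total: "le U V \<or> le V U" if "U \<in> C" "V \<in> C" for U V using chain[OF that] by (simp add: le_def)
  obtain U0 where U0: "U0 \<in> C" using ne by blast
  have sub: "subring (fst U) T" "set zs \<subseteq> fst U" "snd U \<subseteq> fst U" if "U \<in> C" for U
    using kill[OF that] by (auto simp: killable_def)
  have common: "\<exists>Z\<in>C. s \<in> fst Z \<and> t \<in> fst Z" if "s \<in> ?E" "t \<in> ?E" for s t
    using that total unfolding le_def by blast
  have E: "subring ?E T"
  proof (rule subringI)
    show "?E \<subseteq> carrier T" using sub(1) subringE(1) by blast
    show "\<one> \<in> ?E" using U0 subringE(3)[OF sub(1)] by blast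
    show "\<ominus> h \<in> ?E" if "h \<in> ?E" for h using that subringE(5)[OF sub(1)] by blast
    show "h1 \<otimes> h2 \<in> ?E" if "h1 \<in> ?E" "h2 \<in> ?E" for h1 h2
      using common[OF that] subringE(6)[OF sub(1)] by blast
    show "h1 \<oplus> h2 \<in> ?E" if "h1 \<in> ?E" "h2 \<in> ?E" for h1 h2
      using common[OF that] subringE(7)[OF sub(1)] by blast
  qed
  have "\<forall>U\<in>C. \<exists>Bf. realizes (fst U) (snd U) (fst Bf) (snd Bf)"
    using kill by (simp add: killable_def)
  then obtain Bf where Bf: "\<And>U. U \<in> C \<Longrightarrow> realizes (fst U) (snd U) (fst (Bf U)) (snd (Bf U))"
    by metis
  define A where "A U = (if U \<in> C then fst (Bf U) else fst (Bf U0))" for U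
  define F where "F U s = (if U \<in> C \<and> s \<in> fst U then snd (Bf U) s else \<zero>\<^bsub>A U\<^esub>)" for U s
  define K where "K U V = (if V \<in> C \<and> le U V then {\<zero>\<^bsub>A V\<^esub>} else carrier (A V))" for U V
  have real: "realizes (fst U) (snd U) (A U) (snd (Bf U))" if "U \<in> C" for U
    using Bf[OF that] that by (simp add: A_def)
  have A: "cring (A U)" for U
    using Bf[of U] Bf[OF U0] by (auto simp: A_def realizes_def)
  interpret A: cring "A U" for U by (rule A)
  have F_eq: "F U s = snd (Bf U) s" if "U \<in> C" "s \<in> fst U" for U s using that by (simp add: F_def)
  have F_cl: "F U s \<in> carrier (A U)" for U s
    using realizes_hom(1)[OF real, of U s] by (simp add: F_def)
  have zsF: "map (F U) zs = map (snd (Bf U)) zs" if "U \<in> C" for U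
    using sub(2)[OF that] that by (auto simp: F_def)
  have K: "ideal (K U V) (A V)" for U V by (simp add: K_def A.zeroideal A.oneideal)
  have zsA: "set (map (F U) zs) \<subseteq> carrier (A U)" for U using F_cl[of U] by auto
  \<comment> \<open>to test membership in \<open>K Z U\<close>, only the members \<open>U\<close> of the chain above \<open>Z\<close> matter\<close>
  have memK: "a \<ominus>\<^bsub>A U\<^esub> b \<in> K Z U" if "a \<in> carrier (A U)" "b \<in> carrier (A U)"
    "U \<in> C \<Longrightarrow> le Z U \<Longrightarrow> a = b" for a b U Z
    using that by (auto simp: K_def A.minus_eq A.r_neg)
  obtain e :: "(nat \<Rightarrow> 't set \<times> 't set \<Rightarrow> 't universe) \<Rightarrow> 't universe" where e: "inj e"
    using ex_inj_universe(3) by blast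
  let ?T = "T\<lparr>carrier := ?E\<rparr>"
  obtain B :: "'t universe ring" and h where B: "cring B" "h \<in> ring_hom ?T B"
    "proper_regular B (map h zs)"
    and h0: "\<And>s. s \<in> carrier ?T \<Longrightarrow> \<exists>L\<in>K ` C. \<forall>U. \<one>\<^bsub>A U\<^esub> \<otimes>\<^bsub>A U\<^esub> F U s \<in> L U \<Longrightarrow> h s = \<zero>\<^bsub>B\<^esub>"
  proof (rule localized_filtered_product[where A = A and KK = "K ` C" and f = F
        and c = "\<lambda>U. \<one>\<^bsub>A U\<^esub>" and zs = zs, OF e subring_cring[OF E] A])
    show "K ` C \<noteq> {}" using ne by simp
    show "ideal (L U) (A U)" if "L \<in> K ` C" for L U using that K[of _ U] by blast
    show "\<exists>M\<in>K ` C. \<forall>U. L U \<union> L' U \<subseteq> M U" if LL: "L \<in> K ` C" "L' \<in> K ` C" for L L'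
    proof -
      obtain U V where UV: "U \<in> C" "V \<in> C" "L = K U" "L' = K V" using LL by auto
      have mono: "K U Z \<subseteq> K V Z" if "le U V" for U V Z
        using le_trans[OF that, of Z] by (auto simp: K_def)
      from total[OF UV(1,2)] show ?thesis unfolding UV(3,4) using mono UV(1,2) by blast
    qed
    show "F U s \<in> carrier (A U)" for U s by (rule F_cl)
    show "\<exists>L\<in>K ` C. \<forall>U. F U \<one>\<^bsub>?T\<^esub> \<ominus>\<^bsub>A U\<^esub> \<one>\<^bsub>A U\<^esub> \<in> L U"
    proof (intro bexI[OF _ imageI[OF U0]] allI memK)
      fix U assume "U \<in> C"
      thus "F U \<one>\<^bsub>?T\<^esub> = \<one>\<^bsub>A U\<^esub>"
        using realizes_hom(4)[OF real] subringE(3)[OF sub(1)] by (simp add: F_eq)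
    qed (simp_all add: F_cl)
    show "\<exists>L\<in>K ` C. \<forall>U. F U (s \<oplus>\<^bsub>?T\<^esub> t) \<ominus>\<^bsub>A U\<^esub> (F U s \<oplus>\<^bsub>A U\<^esub> F U t) \<in> L U"
      if st: "s \<in> carrier ?T" "t \<in> carrier ?T" for s t
    proof -
      obtain Z where Z: "Z \<in> C" "s \<in> fst Z" "t \<in> fst Z" using common[of s t] st by auto
      show ?thesis
      proof (intro bexI[OF _ imageI[OF Z(1)]] allI memK)
        fix U assume U: "U \<in> C" "le Z U"
        hence st: "s \<in> fst U" "t \<in> fst U" using Z by (auto simp: le_def)
        thus "F U (s \<oplus>\<^bsub>?T\<^esub> t) = F U s \<oplus>\<^bsub>A U\<^esub> F U t"
          using realizes_hom(2)[OF real[OF U(1)] st] subringE(7)[OF sub(1)[OF U(1)] st] U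
          by (simp add: F_eq)
      qed (simp_all add: F_cl)
    qed
    show "\<exists>L\<in>K ` C. \<forall>U. F U (s \<otimes>\<^bsub>?T\<^esub> t) \<ominus>\<^bsub>A U\<^esub> (F U s \<otimes>\<^bsub>A U\<^esub> F U t) \<in> L U"
      if st: "s \<in> carrier ?T" "t \<in> carrier ?T" for s t
    proof -
      obtain Z where Z: "Z \<in> C" "s \<in> fst Z" "t \<in> fst Z" using common[of s t] st by auto
      show ?thesis
      proof (intro bexI[OF _ imageI[OF Z(1)]] allI memK)
        fix U assume U: "U \<in> C" "le Z U"
        hence st: "s \<in> fst U" "t \<in> fst U" using Z by (auto simp: le_def)
        thus "F U (s \<otimes>\<^bsub>?T\<^esub> t) = F U s \<otimes>\<^bsub>A U\<^esub> F U t"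
          using realizes_hom(3)[OF real[OF U(1)] st] subringE(6)[OF sub(1)[OF U(1)] st] U
          by (simp add: F_eq)
      qed (simp_all add: F_cl)
    qed
    show "set zs \<subseteq> carrier ?T" using sub(2)[OF U0] U0 by auto
    show "\<exists>L'\<in>K ` C. \<forall>U. kills_colons (A U) \<one>\<^bsub>A U\<^esub> (L U) (L' U) (map (F U) zs)"
      if L: "L \<in> K ` C" for L
    proof (rule bexI[OF _ L], rule allI)
      fix U
      obtain Z where Z: "L = K Z" using L by blast
      show "kills_colons (A U) \<one>\<^bsub>A U\<^esub> (L U) (L U) (map (F U) zs)"
      proof (rule A.kills_colons_regular)
        show "regular_mod (A U) (L U) (map (F U) zs)"
        proof (cases "U \<in> C \<and> le Z U")
          case True
          hence U: "U \<in> C" "K Z U = {\<zero>\<^bsub>A U\<^esub>}" by (simp_all add: K_def)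
          have "regular_mod (A U) {\<zero>\<^bsub>A U\<^esub>} (map (snd (Bf U)) zs)"
            using real[OF U(1)] by (simp add: realizes_def proper_regular_def)
          thus ?thesis unfolding Z zsF[OF U(1)] U(2) .
        next
          case False
          hence "L U = carrier (A U)" unfolding Z K_def by auto
          thus ?thesis using A.regular_mod_carrier[OF zsA] by simp
        qed
      qed
    qed
    show "\<exists>U. \<one>\<^bsub>A U\<^esub> [^]\<^bsub>A U\<^esub> (N::nat) \<notin> spn (A U) (L U) (map (F U) zs)" if L: "L \<in> K ` C" for L N
    proof -
      obtain Z where Z: "Z \<in> C" "L = K Z" using L by blast
      have "\<one>\<^bsub>A Z\<^esub> \<notin> spn (A Z) {\<zero>\<^bsub>A Z\<^esub>} (map (snd (Bf Z)) zs)"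
        using real[OF Z(1)] by (simp add: realizes_def proper_regular_def)
      moreover have "L Z = {\<zero>\<^bsub>A Z\<^esub>}" using Z le_refl by (simp add: K_def)
      ultimately show ?thesis unfolding zsF[OF Z(1), symmetric] by (intro exI[of _ Z]) simp
    qed
  qed auto
  have "h s = \<zero>\<^bsub>B\<^esub>" if "s \<in> ?P" for s
  proof -
    obtain Z where Z: "Z \<in> C" "s \<in> snd Z" using \<open>s \<in> ?P\<close> by blast
    have "F U s \<in> K Z U" for U
    proof (cases "U \<in> C \<and> le Z U")
      case True
      hence "s \<in> snd U" "s \<in> fst U" using Z sub(3)[of U] by (auto simp: le_def)
      thus ?thesis using True real[of U] by (simp add: K_def F_eq realizes_def)
    next
      case False
      thus ?thesis using F_cl by (auto simp: K_def)
    qed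
    thus ?thesis using Z sub(3)[OF Z(1)] F_cl by (intro h0) auto
  qed
  hence "realizes ?E ?P B h" using B by (simp add: realizes_def)
  moreover have "set zs \<subseteq> ?E" "?P \<subseteq> ?E" using sub(2,3) U0 by blast+
  ultimately show ?thesis unfolding killable_def using E by blast
qed

definition maximal_pair :: "'t set \<Rightarrow> 't set \<Rightarrow> bool" where
  "maximal_pair E P \<longleftrightarrow> killable E P \<and>
     (\<forall>E' P'. killable E' P' \<longrightarrow> E \<subseteq> E' \<longrightarrow> P \<subseteq> P' \<longrightarrow> E' = E \<and> P' = P)"

lemma ex_maximal_pair:
  assumes "killable E0 P0"
  obtains E P where "maximal_pair E P" "E0 \<subseteq> E"
proof -
  let ?Z = "{U. killable (fst U) (snd U) \<and> E0 \<subseteq> fst U}"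
  let ?le = "\<lambda>U V. fst U \<subseteq> fst V \<and> snd U \<subseteq> snd V"
  have "\<exists>M\<in>?Z. \<forall>U\<in>?Z. ?le M U \<longrightarrow> U = M"
  proof (rule predicate_Zorn)
    show "partial_order_on ?Z (relation_of ?le ?Z)"
      by (rule partial_order_on_relation_ofI) (auto simp: prod_eq_iff)
  next
    fix C assume C: "C \<in> Chains (relation_of ?le ?Z)"
    hence both: "U \<in> ?Z \<and> (?le U V \<or> ?le V U)" if "U \<in> C" "V \<in> C" for U V
      using that unfolding Chains_def relation_of_def by blast
    hence CZ: "C \<subseteq> ?Z" and ch: "\<And>U V. U \<in> C \<Longrightarrow> V \<in> C \<Longrightarrow> ?le U V \<or> ?le V U"
      by blast+
    show "\<exists>V\<in>?Z. \<forall>U\<in>C. ?le U V"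
    proof (cases "C = {}")
      case True
      thus ?thesis using assms by (intro bexI[of _ "(E0, P0)"]) auto
    next
      case False
      have "killable (\<Union>U\<in>C. fst U) (\<Union>U\<in>C. snd U)"
        by (rule killable_chain_union[OF False]) (use CZ ch in auto)
      moreover have "E0 \<subseteq> (\<Union>U\<in>C. fst U)" using False CZ by blast
      ultimately show ?thesis
        by (intro bexI[of _ "(\<Union>U\<in>C. fst U, \<Union>U\<in>C. snd U)"]) auto
    qed
  qed
  then obtain M where "M \<in> ?Z" "\<forall>U\<in>?Z. ?le M U \<longrightarrow> U = M" by blast
  thus thesis by (intro that[of "fst M" "snd M"]) (auto simp: maximal_pair_def prod_eq_iff)
qed

lemma maximal_pair_kernel:
  assumes max: "maximal_pair E P" and f: "realizes E P B f" and s: "s \<in> E"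
  shows "f s = \<zero>\<^bsub>B\<^esub> \<longleftrightarrow> s \<in> P"
proof
  assume "f s = \<zero>\<^bsub>B\<^esub>"
  hence "realizes E (insert s P) B f" using f by (auto simp: realizes_def)
  hence "killable E (insert s P)" using max s by (auto simp: maximal_pair_def killable_def)
  thus "s \<in> P" using max unfolding maximal_pair_def by blast
qed (use f in \<open>simp add: realizes_def\<close>)

lemma maximal_pair_separated:
  assumes max: "maximal_pair E P" and f: "realizes E P B f" and b: "b \<in> E"
    and div: "\<And>Q::nat. f b [^]\<^bsub>B\<^esub> (M::nat) \<in> spn B {\<zero>\<^bsub>B\<^esub>} (map (\<lambda>z. f z [^]\<^bsub>B\<^esub> Q) zs)"
  shows "b \<in> P"
proof -
  have E: "subring E T" "set zs \<subseteq> E" "P \<subseteq> E" using max by (auto simp: maximal_pair_def killable_def)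
  obtain e :: "(nat \<Rightarrow> nat \<Rightarrow> 't universe) \<Rightarrow> 't universe" where e: "inj e"
    using ex_inj_universe(1) by blast
  obtain B' :: "'t universe ring" and h where h: "cring B'" "h \<in> ring_hom (T\<lparr>carrier := E\<rparr>) B'"
    "proper_regular B' (map h zs)" "h b = \<zero>\<^bsub>B'\<^esub>"
    "\<And>s. s \<in> E \<Longrightarrow> f s = \<zero>\<^bsub>B\<^esub> \<Longrightarrow> h s = \<zero>\<^bsub>B'\<^esub>"
    using kill_infinitely_divisible[OF e subring_cring[OF E(1)] _ prime_p realizes_char[OF E(1) f],
        of f zs b M thesis] f E b div that by (auto simp: realizes_def)
  hence "realizes E P B' h" using f E(3) by (auto simp: realizes_def)
  thus ?thesis using maximal_pair_kernel[OF max _ b] h(4) by blast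
qed

text \<open>The condition under which \<open>f b\<close> can be inverted along Frobenius powers.\<close>
lemma maximal_pair_durable:
  assumes max: "maximal_pair E P" and f: "realizes E P B f" and b: "b \<in> E" "b \<notin> P"
  shows "\<exists>n. f b [^]\<^bsub>B\<^esub> (N::nat) \<notin> spn B {\<zero>\<^bsub>B\<^esub>} (map (\<lambda>z. f z [^]\<^bsub>B\<^esub> (p ^ n)) zs)"
proof (rule ccontr)
  have E: "subring E T" "set zs \<subseteq> E" using max by (auto simp: maximal_pair_def killable_def)
  have B: "cring B" using f by (simp add: realizes_def)
  have fz: "set (map f zs) \<subseteq> carrier B" using realizes_hom(1)[OF f] E by auto
  assume "\<not> ?thesis"
  hence "f b [^]\<^bsub>B\<^esub> N \<in> spn B {\<zero>\<^bsub>B\<^esub>} (map (\<lambda>y. y [^]\<^bsub>B\<^esub> (p ^ n)) (map f zs))" for n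
    by (simp add: comp_def)
  from spn_power_witness[OF B fz prime_p this] have "b \<in> P"
    by (intro maximal_pair_separated[OF max f b(1), of N]) (simp add: comp_def)
  thus False using b by blast
qed

text \<open>Inverting \<open>f b\<close> along Frobenius powers kills every \<open>a\<close> with \<open>f a f b = 0\<close>, so \<open>a\<close> lies in
  \<open>P\<close> by maximality.\<close>
lemma maximal_pair_prime:
  assumes max: "maximal_pair E P" and ab: "a \<in> E" "b \<in> E" "a \<otimes> b \<in> P" "b \<notin> P"
  shows "a \<in> P"
proof -
  have E: "subring E T" "set zs \<subseteq> E" "P \<subseteq> E" using max by (auto simp: maximal_pair_def killable_def)
  obtain B f where f: "realizes E P B f" using max by (auto simp: maximal_pair_def killable_def)
  note fh = realizes_hom[OF f]
  interpret B: cring B using f by (simp add: realizes_def)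
  interpret E: cring "T\<lparr>carrier := E\<rparr>" by (rule subring_cring[OF E(1)])
  obtain e :: "(nat \<Rightarrow> nat \<Rightarrow> 't universe) \<Rightarrow> 't universe" where e: "inj e"
    using ex_inj_universe(1) by blast
  have fz: "set (map f zs) \<subseteq> carrier B" using fh(1) E by auto
  have c: "f b \<in> carrier B" using fh(1) ab by simp
  have kills: "kills_colons B (f b) {\<zero>\<^bsub>B\<^esub>} {\<zero>\<^bsub>B\<^esub>} (map (\<lambda>z. f z [^]\<^bsub>B\<^esub> (p ^ n)) zs)" for n
  proof -
    let ?ys = "map (\<lambda>y. y [^]\<^bsub>B\<^esub> (p ^ n)) (map f zs)"
    have reg: "regular_mod B {\<zero>\<^bsub>B\<^esub>} ?ys"
      using B.regular_mod_powers[OF B.zeroideal fz] f by (simp add: realizes_def proper_regular_def)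
    have J: "ideal (spn B {\<zero>\<^bsub>B\<^esub>} (take k ?ys)) B" for k
    proof (rule B.spn_ideal[OF B.zeroideal])
      have "set ?ys \<subseteq> carrier B" using fz by auto
      thus "set (take k ?ys) \<subseteq> carrier B" using set_take_subset[of k ?ys] by (rule subset_trans[rotated])
    qed
    have "kills_colons B (f b) {\<zero>\<^bsub>B\<^esub>} {\<zero>\<^bsub>B\<^esub>} ?ys"
      using reg ideal.I_l_closed[OF J _ c] unfolding kills_colons_def regular_mod_def by blast
    thus ?thesis by (simp add: comp_def)
  qed
  obtain B' :: "'t universe ring" and h where h: "cring B'" "h \<in> ring_hom (T\<lparr>carrier := E\<rparr>) B'"
    "proper_regular B' (map h zs)"
    "\<And>s. s \<in> E \<Longrightarrow> f b \<otimes>\<^bsub>B\<^esub> f s \<in> {\<zero>\<^bsub>B\<^esub>} \<Longrightarrow> h s = \<zero>\<^bsub>B'\<^esub>"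
    using frobenius_localization[OF e E.cring_axioms B.cring_axioms B.zeroideal prime_p
        realizes_char[OF E(1) f], of f "f b" zs thesis]
      fh E c kills maximal_pair_durable[OF max f ab(2,4)] that
    by (auto simp: B.minus_eq B.r_neg)
  have "f b \<otimes>\<^bsub>B\<^esub> f s = \<zero>\<^bsub>B\<^esub>" if "s \<in> P" for s using f c that by (auto simp: realizes_def)
  hence "realizes E P B' h" using h E(3) by (auto simp: realizes_def)
  moreover have "h a = \<zero>\<^bsub>B'\<^esub>"
  proof (rule h(4)[OF ab(1)])
    have "f b \<otimes>\<^bsub>B\<^esub> f a = f (a \<otimes> b)" using fh ab c by (simp add: B.m_comm)
    thus "f b \<otimes>\<^bsub>B\<^esub> f a \<in> {\<zero>\<^bsub>B\<^esub>}" using f ab(3) by (simp add: realizes_def)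
  qed
  ultimately show ?thesis using maximal_pair_kernel[OF max _ ab(1)] by blast
qed

end

section \<open>Spans of the powers of an element over a maximal pair\<close>

lemma (in UP_cring) poly_induct [consumes 1, case_names monom add]:
  assumes u: "u \<in> carrier P"
    and monom: "\<And>a n. a \<in> carrier R \<Longrightarrow> Q (mnm a n)"
    and add: "\<And>u v. u \<in> carrier P \<Longrightarrow> v \<in> carrier P \<Longrightarrow> Q u \<Longrightarrow> Q v \<Longrightarrow> Q (u \<oplus>\<^bsub>P\<^esub> v)"
  shows "Q u"
proof -
  have "Q (\<Oplus>\<^bsub>P\<^esub>i\<in>A. mnm (cf u i) i)" if "finite A" for A
    using that
  proof (induction A)
    case empty
    show ?case using monom[of \<zero> 0] by (simp add: monom_zero)
  next
    case (insert i A)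
    have c: "(\<lambda>i. mnm (cf u i) i) \<in> A \<rightarrow> carrier P" "mnm (cf u i) i \<in> carrier P" using u by auto
    show ?case
      unfolding P.finsum_insert[OF insert(1,2) c]
      using insert.IH c u by (intro add monom P.finsum_closed) auto
  qed
  from this[of "{..deg R u}"] show ?thesis using up_repr[OF u] by simp
qed

text \<open>A maximal pair \<open>(E, P)\<close> with a good map \<open>f\<close>, and an element \<open>t\<close> of \<open>T\<close>. Congruence modulo \<open>P\<close> is
  expressed by equality of values of \<open>f\<close>, whose kernel is \<open>P\<close>.\<close>
locale extension_step = char_p_base T zs p
  for T :: "('t, 'k) ring_scheme" (structure) and zs p +
  fixes E P :: "'t set" and t :: 't and d :: nat
    and B :: "'t universe ring" and f :: "'t \<Rightarrow> 't universe"
  assumes max: "maximal_pair E P" and real: "realizes E P B f"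
    and t_carrier: "t \<in> carrier T"
begin

sublocale B: cring B using real by (simp add: realizes_def)

lemma E_sub: "subring E T" and zs_E: "set zs \<subseteq> E" and P_E: "P \<subseteq> E"
  using max by (auto simp: maximal_pair_def killable_def)

lemmas E_carrier = subsetD[OF subringE(1)[OF E_sub]]
  and E_zero = subringE(2)[OF E_sub] and E_one = subringE(3)[OF E_sub]
  and E_neg = subringE(5)[OF E_sub] and E_mult = subringE(6)[OF E_sub]
  and E_add = subringE(7)[OF E_sub]

lemmas f_closed = realizes_hom(1)[OF real] and f_add = realizes_hom(2)[OF real]
  and f_mult = realizes_hom(3)[OF real] and f_one = realizes_hom(4)[OF real]

lemma f_kernel: "s \<in> E \<Longrightarrow> f s = \<zero>\<^bsub>B\<^esub> \<longleftrightarrow> s \<in> P"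
  by (rule maximal_pair_kernel[OF max real])

lemma E_minus: "a \<in> E \<Longrightarrow> b \<in> E \<Longrightarrow> a \<ominus> b \<in> E"
  by (simp add: a_minus_def E_add E_neg)

lemma f_zero: "f \<zero> = \<zero>\<^bsub>B\<^esub>"
proof -
  have "f \<zero> \<oplus>\<^bsub>B\<^esub> f \<zero> = f \<zero> \<oplus>\<^bsub>B\<^esub> \<zero>\<^bsub>B\<^esub>" using f_add[OF E_zero E_zero] f_closed[OF E_zero] by simp
  thus ?thesis using f_closed[OF E_zero] by (metis B.add.l_cancel B.zero_closed)
qed

lemma f_eq_iff:
  assumes "a \<in> E" "b \<in> E"
  shows "f a = f b \<longleftrightarrow> a \<ominus> b \<in> P"
proof -
  have "f (a \<ominus> b) \<oplus>\<^bsub>B\<^esub> f b = f a"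
  proof -
    have "(a \<ominus> b) \<oplus> b = a" using assms E_carrier by (simp add: minus_eq a_assoc l_neg)
    thus ?thesis using f_add[OF E_minus[OF assms] assms(2)] by simp
  qed
  thus ?thesis using f_kernel[OF E_minus[OF assms]] f_closed assms E_minus[OF assms]
    by (metis B.add.l_cancel_one' B.add.m_comm B.l_zero)
qed

lemma P_zero: "\<zero> \<in> P" using f_kernel[OF E_zero] f_zero by simp

lemma P_add: "a \<in> P \<Longrightarrow> b \<in> P \<Longrightarrow> a \<oplus> b \<in> P"
  using f_kernel[of a] f_kernel[of b] f_kernel[of "a \<oplus> b"] f_add[of a b] P_E E_add[of a b]
  by auto

lemma P_mult: "a \<in> E \<Longrightarrow> b \<in> P \<Longrightarrow> a \<otimes> b \<in> P"
  using f_kernel[of b] f_kernel[of "a \<otimes> b"] f_mult[of a b] P_E E_mult[of a b] f_closed[of a]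
  by auto

lemma one_notin_P: "\<one> \<notin> P"
proof
  assume "\<one> \<in> P"
  hence "\<one>\<^bsub>B\<^esub> = \<zero>\<^bsub>B\<^esub>" using f_kernel[OF E_one] f_one by simp
  moreover have "\<zero>\<^bsub>B\<^esub> \<in> spn B {\<zero>\<^bsub>B\<^esub>} (map f zs)"
    using f_closed zs_E
    by (intro additive_subgroup.zero_closed ideal.axioms(1) B.spn_ideal B.zeroideal) auto
  ultimately show False using real by (simp add: realizes_def proper_regular_def)
qed

lemma notin_P_mult: "a \<in> E - P \<Longrightarrow> b \<in> E - P \<Longrightarrow> a \<otimes> b \<in> E - P"
  using maximal_pair_prime[OF max] E_mult by blast

text \<open>The \<open>E\<close>-submodules of \<open>T\<close>.\<close>
definition submod :: "'t set \<Rightarrow> bool" where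
  "submod N \<longleftrightarrow> N \<subseteq> carrier T \<and> \<zero> \<in> N \<and> (\<forall>a\<in>N. \<forall>b\<in>N. a \<oplus> b \<in> N) \<and> (\<forall>a\<in>E. \<forall>b\<in>N. a \<otimes> b \<in> N)"

lemma submodD:
  assumes "submod N"
  shows "b \<in> N \<Longrightarrow> b \<in> carrier T" "\<zero> \<in> N" "a \<in> N \<Longrightarrow> b \<in> N \<Longrightarrow> a \<oplus> b \<in> N"
    "c \<in> E \<Longrightarrow> b \<in> N \<Longrightarrow> c \<otimes> b \<in> N" "b \<in> N \<Longrightarrow> \<ominus> b \<in> N"
    "a \<in> N \<Longrightarrow> b \<in> N \<Longrightarrow> a \<ominus> b \<in> N"
proof -
  note a = assms[unfolded submod_def]
  show 1: "b \<in> N \<Longrightarrow> b \<in> carrier T" "\<zero> \<in> N" and 2: "a \<in> N \<Longrightarrow> b \<in> N \<Longrightarrow> a \<oplus> b \<in> N"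
    and 3: "c \<in> E \<Longrightarrow> b \<in> N \<Longrightarrow> c \<otimes> b \<in> N" for a b c using a by auto
  show 4: "\<ominus> b \<in> N" if "b \<in> N" for b
    using 3[OF E_neg[OF E_one] that] 1(1)[OF that] by (simp add: l_minus)
  show "a \<ominus> b \<in> N" if "a \<in> N" "b \<in> N" using 2[OF that(1) 4[OF that(2)]] by (simp add: a_minus_def)
qed

lemma submod_E: "submod E" and submod_P: "submod P"
  by (simp_all add: submod_def E_carrier E_zero E_add E_mult P_zero P_add P_mult subset_iff subsetD[OF P_E])

text \<open>The combinations \<open>\<Sum>\<^sub>i\<^sub><\<^sub>n a\<^sub>i t\<^sup>i\<close> with \<open>a\<^sub>i \<in> C\<close>; used for \<open>C = E\<close> and \<open>C = P\<close>.\<close>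
primrec lspan :: "'t set \<Rightarrow> nat \<Rightarrow> 't set" where
  "lspan C 0 = {\<zero>}"
| "lspan C (Suc n) = {u \<oplus> a \<otimes> t [^] n | u a. u \<in> lspan C n \<and> a \<in> C}"

lemma t_pow: "t [^] (n::nat) \<in> carrier T" using t_carrier by simp

lemma lspan_submod:
  assumes C: "submod C"
  shows "submod (lspan C n)"
proof (induction n)
  case 0 show ?case using E_carrier by (auto simp: submod_def)
next
  case (Suc n)
  note IH = submodD[OF Suc.IH] and c = submodD[OF C]
  show ?case unfolding submod_def
  proof (intro conjI ballI subsetI)
    fix x assume "x \<in> lspan C (Suc n)"
    thus "x \<in> carrier T" using IH(1) c(1) t_pow by auto
  next
    have "\<zero> = \<zero> \<oplus> \<zero> \<otimes> t [^] n" using t_pow by simp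
    thus "\<zero> \<in> lspan C (Suc n)" using IH(2) c(2) by auto
  next
    fix x y assume "x \<in> lspan C (Suc n)" "y \<in> lspan C (Suc n)"
    then obtain u v a b where x: "x = u \<oplus> a \<otimes> t [^] n" "u \<in> lspan C n" "a \<in> C"
      and y: "y = v \<oplus> b \<otimes> t [^] n" "v \<in> lspan C n" "b \<in> C" by auto
    have "x \<oplus> y = (u \<oplus> v) \<oplus> (a \<oplus> b) \<otimes> t [^] n"
      unfolding x(1) y(1) using IH(1)[OF x(2)] IH(1)[OF y(2)] c(1)[OF x(3)] c(1)[OF y(3)] t_pow[of n]
      by algebra
    thus "x \<oplus> y \<in> lspan C (Suc n)" using IH(3)[OF x(2) y(2)] c(3)[OF x(3) y(3)] by auto
  next
    fix b x assume b: "b \<in> E" and "x \<in> lspan C (Suc n)"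
    then obtain u a where x: "x = u \<oplus> a \<otimes> t [^] n" "u \<in> lspan C n" "a \<in> C" by auto
    have "b \<otimes> x = b \<otimes> u \<oplus> (b \<otimes> a) \<otimes> t [^] n"
      unfolding x(1) using IH(1)[OF x(2)] c(1)[OF x(3)] E_carrier[OF b] t_pow[of n] by algebra
    thus "b \<otimes> x \<in> lspan C (Suc n)" using IH(4)[OF b x(2)] c(4)[OF b x(3)] by auto
  qed
qed

lemma lspan_Suc_superset:
  assumes C: "submod C"
  shows "lspan C n \<subseteq> lspan C (Suc n)"
proof
  fix u assume u: "u \<in> lspan C n"
  hence "u = u \<oplus> \<zero> \<otimes> t [^] n" using submodD(1)[OF lspan_submod[OF C]] t_pow by simp
  thus "u \<in> lspan C (Suc n)" using u submodD(2)[OF C] by auto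
qed

lemma lspan_mono: "submod C \<Longrightarrow> m \<le> n \<Longrightarrow> lspan C m \<subseteq> lspan C n"
  by (rule lift_Suc_mono_le[of "lspan C", OF lspan_Suc_superset])

lemma lspan_gen:
  assumes C: "submod C" and a: "a \<in> C" and i: "i < n"
  shows "a \<otimes> t [^] i \<in> lspan C n"
proof -
  have "a \<otimes> t [^] i = \<zero> \<oplus> a \<otimes> t [^] i" using submodD(1)[OF C a] t_pow by simp
  hence "a \<otimes> t [^] i \<in> lspan C (Suc i)" using a submodD(2)[OF lspan_submod[OF C]] by auto
  thus ?thesis using lspan_mono[OF C, of "Suc i" n] i by auto
qed

lemma lspan_scale:
  assumes C: "submod C" and a: "a \<in> C" and v: "v \<in> lspan E n"
  shows "a \<otimes> v \<in> lspan C n"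
  using v
proof (induction n arbitrary: v)
  case 0 thus ?case using submodD(1)[OF C a] by simp
next
  case (Suc n)
  then obtain u b where v: "v = u \<oplus> b \<otimes> t [^] n" "u \<in> lspan E n" "b \<in> E" by auto
  have "a \<otimes> v = a \<otimes> u \<oplus> (b \<otimes> a) \<otimes> t [^] n"
    unfolding v(1) using submodD(1)[OF lspan_submod[OF submod_E] v(2)] submodD(1)[OF C a]
      E_carrier[OF v(3)] t_pow[of n] by algebra
  thus ?case using Suc.IH[OF v(2)] submodD(4)[OF C v(3) a] by auto
qed

text \<open>Nakayama's lemma at the prime \<open>P\<close>, with denominators cleared: if \<open>w \<notin> P\<close> maps all generators into
  \<open>P\<close> times their span, then some \<open>w' \<notin> P\<close> annihilates them. The last relation
  \<open>w t\<^sup>n = v + q t\<^sup>n\<close> with \<open>q \<in> P\<close> has \<open>w - q \<notin> P\<close>. Multiplying the other relations by \<open>w - q\<close>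
  eliminates \<open>t\<^sup>n\<close> from them.\<close>
lemma lspan_nakayama:
  assumes "w \<in> E - P" "\<And>i. i < n \<Longrightarrow> w \<otimes> t [^] i \<in> lspan P n"
  shows "\<exists>w'\<in>E - P. \<forall>i<n. w' \<otimes> t [^] i = \<zero>"
  using assms
proof (induction n arbitrary: w)
  case 0 thus ?case by auto
next
  case (Suc n)
  have w: "w \<in> E" "w \<notin> P" "w \<in> carrier T" using Suc.prems(1) E_carrier by auto
  note LP = submodD[OF lspan_submod[OF submod_P, of n]]
  obtain v q where v: "w \<otimes> t [^] n = v \<oplus> q \<otimes> t [^] n" "v \<in> lspan P n" "q \<in> P"
    using Suc.prems(2)[of n] by auto
  have q: "q \<in> E" "q \<in> carrier T" and vc: "v \<in> carrier T" using v P_E E_carrier LP(1) by auto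
  define w1 where "w1 = w \<ominus> q"
  have w1E: "w1 \<in> E" "w1 \<in> carrier T" using E_minus[OF w(1) q(1)] E_carrier by (auto simp: w1_def)
  have "w1 \<notin> P"
  proof
    assume "w1 \<in> P"
    moreover have "w = w1 \<oplus> q" using w q unfolding w1_def by algebra
    ultimately show False using P_add[OF _ v(3)] w(2) by simp
  qed
  hence w1: "w1 \<in> E - P" using w1E by blast
  have w1t: "w1 \<otimes> t [^] n = v"
  proof -
    have "w1 \<otimes> t [^] n = w \<otimes> t [^] n \<ominus> q \<otimes> t [^] n"
      unfolding w1_def using w q t_pow[of n] by algebra
    also have "\<dots> = v" unfolding v(1) using vc q t_pow[of n] by algebra
    finally show ?thesis .
  qed
  have "(w1 \<otimes> w) \<otimes> t [^] i \<in> lspan P n" if i: "i < n" for i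
  proof -
    obtain v' q' where v': "w \<otimes> t [^] i = v' \<oplus> q' \<otimes> t [^] n" "v' \<in> lspan P n" "q' \<in> P"
      using Suc.prems(2)[of i] i by auto
    have q': "q' \<in> E" "q' \<in> carrier T" and vc': "v' \<in> carrier T" using v' P_E E_carrier LP(1) by auto
    have "(w1 \<otimes> w) \<otimes> t [^] i = w1 \<otimes> (w \<otimes> t [^] i)" using w w1E t_pow by (simp add: m_assoc)
    also have "\<dots> = w1 \<otimes> v' \<oplus> q' \<otimes> (w1 \<otimes> t [^] n)"
      unfolding v'(1) using w1E vc' q' t_pow[of n] by algebra
    finally have "(w1 \<otimes> w) \<otimes> t [^] i = w1 \<otimes> v' \<oplus> q' \<otimes> v" by (simp add: w1t)
    thus ?thesis using LP(3)[OF LP(4)[OF w1E(1) v'(2)] LP(4)[OF q'(1) v(2)]] by simp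
  qed
  then obtain w' where w': "w' \<in> E - P" "\<forall>i<n. w' \<otimes> t [^] i = \<zero>"
    using Suc.IH[OF notin_P_mult[OF w1 Suc.prems(1)]] by blast
  have w'c: "w' \<in> carrier T" using w' E_carrier by blast
  have "w' \<otimes> u = \<zero>" if "u \<in> lspan E m" "m \<le> n" for u m
    using that
  proof (induction m arbitrary: u)
    case 0 thus ?case using w'c by simp
  next
    case (Suc m)
    then obtain x b where u: "u = x \<oplus> b \<otimes> t [^] m" "x \<in> lspan E m" "b \<in> E" by auto
    have "w' \<otimes> u = w' \<otimes> x \<oplus> b \<otimes> (w' \<otimes> t [^] m)"
      unfolding u(1) using w'c submodD(1)[OF lspan_submod[OF submod_E] u(2)] E_carrier[OF u(3)] t_pow[of m]
      by algebra
    also have "\<dots> = \<zero>" using Suc.IH[OF u(2)] Suc.prems(2) w'(2) E_carrier[OF u(3)] by simp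
    finally show ?case .
  qed
  moreover have PE: "lspan P m \<subseteq> lspan E m" for m
    by (induction m) (use P_E in auto)
  ultimately have "w' \<otimes> v = \<zero>" using v(2) by blast
  hence "(w' \<otimes> w1) \<otimes> t [^] n = \<zero>" using w'c w1E t_pow by (simp add: m_assoc w1t)
  moreover have "(w' \<otimes> w1) \<otimes> t [^] i = \<zero>" if "i < n" for i
  proof -
    have "(w' \<otimes> w1) \<otimes> t [^] i = w1 \<otimes> (w' \<otimes> t [^] i)" using w'c w1E t_pow[of i] by algebra
    thus ?thesis using w'(2) that w1E by simp
  qed
  ultimately show ?case using notin_P_mult[OF w'(1) w1] less_Suc_eq by metis
qed

text \<open>The functionals \<open>l\<^sub>i\<close>, which are \<open>E\<close>-linear modulo \<open>P\<close> and vanish on \<open>N\<close> modulo \<open>P\<close>, satisfy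
  \<open>\<Sum>\<^sub>i l\<^sub>i(u) t\<^sup>i = c u\<close> modulo \<open>N\<close>. A dual basis lemma up to the factor \<open>c\<close>: it exhibits the span modulo
  \<open>N\<close>, up to \<open>c\<close>, as a direct summand of a free module over \<open>E/P\<close>.\<close>
definition almost_dual_basis :: "'t set \<Rightarrow> nat \<Rightarrow> 't \<Rightarrow> (nat \<Rightarrow> 't \<Rightarrow> 't) \<Rightarrow> bool" where
  "almost_dual_basis N n c l \<longleftrightarrow>
    (\<forall>i<n. \<forall>u\<in>lspan E n. l i u \<in> E) \<and>
    (\<forall>i<n. \<forall>u\<in>lspan E n. \<forall>v\<in>lspan E n. f (l i (u \<oplus> v)) = f (l i u) \<oplus>\<^bsub>B\<^esub> f (l i v)) \<and>
    (\<forall>i<n. \<forall>a\<in>E. \<forall>u\<in>lspan E n. f (l i (a \<otimes> u)) = f a \<otimes>\<^bsub>B\<^esub> f (l i u)) \<and>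
    (\<forall>i<n. \<forall>u\<in>lspan E n. u \<in> N \<longrightarrow> f (l i u) = \<zero>\<^bsub>B\<^esub>) \<and>
    (\<forall>u\<in>lspan E n. c \<otimes> u \<ominus> (\<Oplus>i\<in>{..<n}. l i u \<otimes> t [^] i) \<in> N)"

lemma almost_dual_basisD:
  assumes "almost_dual_basis N n c l"
  shows "i < n \<Longrightarrow> u \<in> lspan E n \<Longrightarrow> l i u \<in> E"
    "i < n \<Longrightarrow> u \<in> lspan E n \<Longrightarrow> v \<in> lspan E n \<Longrightarrow> f (l i (u \<oplus> v)) = f (l i u) \<oplus>\<^bsub>B\<^esub> f (l i v)"
    "i < n \<Longrightarrow> a \<in> E \<Longrightarrow> u \<in> lspan E n \<Longrightarrow> f (l i (a \<otimes> u)) = f a \<otimes>\<^bsub>B\<^esub> f (l i u)"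
    "i < n \<Longrightarrow> u \<in> lspan E n \<Longrightarrow> u \<in> N \<Longrightarrow> f (l i u) = \<zero>\<^bsub>B\<^esub>"
    "u \<in> lspan E n \<Longrightarrow> c \<otimes> u \<ominus> (\<Oplus>i\<in>{..<n}. l i u \<otimes> t [^] i) \<in> N"
  using assms by (simp_all only: almost_dual_basis_def)

text \<open>Generators are added one at a time. Either some multiple \<open>a t\<^sup>n\<close> with \<open>a \<notin> P\<close> lies in the previous
  span modulo \<open>N\<close>, and the old functionals are precomposed with multiplication by \<open>a\<close>; or \<open>t\<^sup>n\<close> is
  independent of the previous span, and its coefficient is a new functional.\<close>
lemma lspan_almost_projective:
  assumes N: "submod N" and PN: "\<And>q i. q \<in> P \<Longrightarrow> i < n \<Longrightarrow> q \<otimes> t [^] i \<in> N"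
  shows "\<exists>c\<in>E - P. \<exists>l. almost_dual_basis N n c l"
  using PN
proof (induction n)
  case 0
  have "\<one> \<otimes> \<zero> \<ominus> \<zero> \<in> N" using submodD(2)[OF N] by (simp add: minus_eq)
  thus ?case using E_one one_notin_P
    by (intro bexI[of _ \<one>] exI[of _ "\<lambda>_ _. \<zero>"]) (simp_all add: almost_dual_basis_def)
next
  case (Suc n)
  note Nd = submodD[OF N] and Ld = submodD[OF lspan_submod[OF submod_E]]
  have "\<exists>c\<in>E - P. \<exists>l. almost_dual_basis N n c l"
    by (rule Suc.IH) (rule Suc.prems, auto)
  then obtain c l where c: "c \<in> E - P" and l: "almost_dual_basis N n c l" by blast
  note lE = almost_dual_basisD(1)[OF l] and l_add = almost_dual_basisD(2)[OF l]
    and l_mult = almost_dual_basisD(3)[OF l] and l_N = almost_dual_basisD(4)[OF l]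
    and l_sum = almost_dual_basisD(5)[OF l]
  have cE: "c \<in> E" "c \<in> carrier T" using c E_carrier by auto
  have l_cong: "f (l i u) = f (l i v)"
    if i: "i < n" and uv: "u \<in> lspan E n" "v \<in> lspan E n" "u \<ominus> v \<in> N" for i u v
  proof -
    have "u = (u \<ominus> v) \<oplus> v" using Ld(1)[OF uv(1)] Ld(1)[OF uv(2)] by algebra
    hence "f (l i u) = f (l i (u \<ominus> v)) \<oplus>\<^bsub>B\<^esub> f (l i v)"
      using l_add[OF i Ld(6)[OF uv(1,2)] uv(2)] by simp
    thus ?thesis using l_N[OF i Ld(6)[OF uv(1,2)] uv(3)] f_closed[OF lE[OF i uv(2)]] by simp
  qed
  have sum_closed: "(\<Oplus>i\<in>{..<n}. l i u \<otimes> t [^] i) \<in> carrier T" if "u \<in> lspan E n" for u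
    using lE[OF _ that] E_carrier t_pow by (intro finsum_closed) auto
  have tn: "t [^] n \<in> carrier T" by (rule t_pow)
  have dec: "\<exists>w a. w \<in> lspan E n \<and> a \<in> E \<and> u = w \<oplus> a \<otimes> t [^] n" if "u \<in> lspan E (Suc n)" for u
    using that by auto
  show ?case
  proof (cases "\<exists>a\<in>E - P. \<exists>w\<in>lspan E n. a \<otimes> t [^] n \<ominus> w \<in> N")
    case True
    then obtain a w where a: "a \<in> E - P" and w: "w \<in> lspan E n" "a \<otimes> t [^] n \<ominus> w \<in> N" by blast
    have aE: "a \<in> E" "a \<in> carrier T" and wc: "w \<in> carrier T" using a E_carrier w Ld(1) by auto
    have "\<exists>v\<in>lspan E n. a \<otimes> u \<ominus> v \<in> N" if "u \<in> lspan E (Suc n)" for u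
    proof -
      obtain x s where u: "x \<in> lspan E n" "s \<in> E" "u = x \<oplus> s \<otimes> t [^] n" using dec[OF \<open>u \<in> _\<close>] by blast
      have "a \<otimes> u \<ominus> (a \<otimes> x \<oplus> s \<otimes> w) = s \<otimes> (a \<otimes> t [^] n \<ominus> w)"
        unfolding u(3) using aE wc Ld(1)[OF u(1)] E_carrier[OF u(2)] tn by algebra
      thus ?thesis using Nd(4)[OF u(2) w(2)] Ld(3)[OF Ld(4)[OF aE(1) u(1)] Ld(4)[OF u(2) w(1)]]
        by (intro bexI[of _ "a \<otimes> x \<oplus> s \<otimes> w"]) simp_all
    qed
    then obtain W where W: "\<And>u. u \<in> lspan E (Suc n) \<Longrightarrow> W u \<in> lspan E n"
      "\<And>u. u \<in> lspan E (Suc n) \<Longrightarrow> a \<otimes> u \<ominus> W u \<in> N" by metis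
    have Wc: "W u \<in> carrier T" if "u \<in> lspan E (Suc n)" for u using W(1)[OF that] Ld(1) by blast
    define l' where "l' i u = (if i < n then l i (W u) else \<zero>)" for i u
    show ?thesis
    proof (intro bexI[OF _ notin_P_mult[OF c a]] exI[of _ l'],
        unfold almost_dual_basis_def, intro conjI allI impI ballI)
      fix u assume u: "u \<in> lspan E (Suc n)"
      note uc = Ld(1)[OF u]
      show "l' i u \<in> E" for i using lE W(1)[OF u] E_zero by (simp add: l'_def)
      show "f (l' i (u \<oplus> v)) = f (l' i u) \<oplus>\<^bsub>B\<^esub> f (l' i v)" if v: "v \<in> lspan E (Suc n)" for i v
      proof (cases "i < n")
        case True
        have uv: "u \<oplus> v \<in> lspan E (Suc n)" by (rule Ld(3)[OF u v])
        have "W (u \<oplus> v) \<ominus> (W u \<oplus> W v) =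
            ((a \<otimes> u \<ominus> W u) \<oplus> (a \<otimes> v \<ominus> W v)) \<ominus> (a \<otimes> (u \<oplus> v) \<ominus> W (u \<oplus> v))"
          using uc Ld(1)[OF v] Wc[OF u] Wc[OF v] Wc[OF uv] aE by algebra
        hence "W (u \<oplus> v) \<ominus> (W u \<oplus> W v) \<in> N"
          using Nd(6)[OF Nd(3)[OF W(2)[OF u] W(2)[OF v]] W(2)[OF uv]] by simp
        thus ?thesis using l_cong[OF True W(1)[OF uv] Ld(3)[OF W(1)[OF u] W(1)[OF v]]]
          l_add[OF True W(1)[OF u] W(1)[OF v]] True by (simp add: l'_def)
      qed (simp add: l'_def f_zero)
      show "f (l' i (b \<otimes> u)) = f b \<otimes>\<^bsub>B\<^esub> f (l' i u)" if b: "b \<in> E" for i b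
      proof (cases "i < n")
        case True
        have bu: "b \<otimes> u \<in> lspan E (Suc n)" by (rule Ld(4)[OF b u])
        have "W (b \<otimes> u) \<ominus> b \<otimes> W u =
            b \<otimes> (a \<otimes> u \<ominus> W u) \<ominus> (a \<otimes> (b \<otimes> u) \<ominus> W (b \<otimes> u))"
          using uc Wc[OF u] Wc[OF bu] aE E_carrier[OF b] by algebra
        hence "W (b \<otimes> u) \<ominus> b \<otimes> W u \<in> N"
          using Nd(6)[OF Nd(4)[OF b W(2)[OF u]] W(2)[OF bu]] by simp
        thus ?thesis using l_cong[OF True W(1)[OF bu] Ld(4)[OF b W(1)[OF u]]]
          l_mult[OF True b W(1)[OF u]] True by (simp add: l'_def)
      qed (use f_closed[OF b] in \<open>simp add: l'_def f_zero\<close>)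
      show "f (l' i u) = \<zero>\<^bsub>B\<^esub>" if uN: "u \<in> N" for i
      proof -
        have "W u = a \<otimes> u \<ominus> (a \<otimes> u \<ominus> W u)" using uc Wc[OF u] aE by algebra
        hence "W u \<in> N" using Nd(6)[OF Nd(4)[OF aE(1) uN] W(2)[OF u]] by simp
        thus ?thesis using l_N[OF _ W(1)[OF u]] by (simp add: l'_def f_zero)
      qed
      show "c \<otimes> a \<otimes> u \<ominus> (\<Oplus>i\<in>{..<Suc n}. l' i u \<otimes> t [^] i) \<in> N"
      proof -
        let ?s = "\<Oplus>i\<in>{..<n}. l i (W u) \<otimes> t [^] i"
        have "(\<Oplus>i\<in>{..<n}. l' i u \<otimes> t [^] i) = ?s"
          using lE[OF _ W(1)[OF u]] E_carrier t_pow by (intro finsum_cong') (auto simp: l'_def)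
        moreover have "(\<Oplus>i\<in>{..<Suc n}. l' i u \<otimes> t [^] i) =
            l' n u \<otimes> t [^] n \<oplus> (\<Oplus>i\<in>{..<n}. l' i u \<otimes> t [^] i)"
          unfolding lessThan_Suc using lE[OF _ W(1)[OF u]] E_carrier t_pow
          by (intro finsum_insert) (auto simp: l'_def)
        ultimately have s: "(\<Oplus>i\<in>{..<Suc n}. l' i u \<otimes> t [^] i) = ?s"
          using sum_closed[OF W(1)[OF u]] tn by (simp add: l'_def)
        have "c \<otimes> a \<otimes> u \<ominus> r = c \<otimes> (a \<otimes> u \<ominus> W u) \<oplus> (c \<otimes> W u \<ominus> r)"
          if "r \<in> carrier T" for r
          using uc Wc[OF u] aE cE that by algebra
        note this[OF sum_closed[OF W(1)[OF u]]]
        with Nd(3)[OF Nd(4)[OF cE(1) W(2)[OF u]] l_sum[OF W(1)[OF u]]] show ?thesis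
          unfolding s by simp
      qed
    qed
  next
    case False
    hence free: "a \<in> P" if "a \<in> E" "w \<in> lspan E n" "a \<otimes> t [^] n \<ominus> w \<in> N" for a w using that by blast
    have unique: "x \<ominus> y \<in> N \<and> f a = f b"
      if xy: "x \<in> lspan E n" "y \<in> lspan E n" "a \<in> E" "b \<in> E"
        and eq: "(x \<oplus> a \<otimes> t [^] n) \<ominus> (y \<oplus> b \<otimes> t [^] n) \<in> N" for x y a b
    proof -
      note cc = Ld(1)[OF xy(1)] Ld(1)[OF xy(2)] E_carrier[OF xy(3)] E_carrier[OF xy(4)] tn
      have "(a \<ominus> b) \<otimes> t [^] n \<ominus> (y \<ominus> x) = (x \<oplus> a \<otimes> t [^] n) \<ominus> (y \<oplus> b \<otimes> t [^] n)"
        using cc by algebra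
      hence ab: "a \<ominus> b \<in> P" using free[OF E_minus[OF xy(3,4)] Ld(6)[OF xy(2,1)]] eq by simp
      have "x \<ominus> y = ((x \<oplus> a \<otimes> t [^] n) \<ominus> (y \<oplus> b \<otimes> t [^] n)) \<ominus> (a \<ominus> b) \<otimes> t [^] n"
        using cc by algebra
      hence "x \<ominus> y \<in> N" using Nd(6)[OF eq Suc.prems[OF ab, of n]] by simp
      thus ?thesis using f_eq_iff[OF xy(3,4)] ab by simp
    qed
    have "\<forall>u\<in>lspan E (Suc n). \<exists>x. fst x \<in> lspan E n \<and> snd x \<in> E \<and> u = fst x \<oplus> snd x \<otimes> t [^] n"
      using dec by fastforce
    then obtain V where V: "\<And>u. u \<in> lspan E (Suc n) \<Longrightarrow>
        fst (V u) \<in> lspan E n \<and> snd (V u) \<in> E \<and> u = fst (V u) \<oplus> snd (V u) \<otimes> t [^] n" by metis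
    define W where "W u = fst (V u)" for u
    define s where "s u = snd (V u)" for u
    have W: "W u \<in> lspan E n" "W u \<in> carrier T" and s: "s u \<in> E" "s u \<in> carrier T"
      and Ws: "u = W u \<oplus> s u \<otimes> t [^] n" if "u \<in> lspan E (Suc n)" for u
      using V[OF that] Ld(1) E_carrier by (auto simp: W_def s_def)
    have same: "W u \<ominus> x \<in> N \<and> f (s u) = f a"
      if "u \<in> lspan E (Suc n)" "x \<in> lspan E n" "a \<in> E" "u \<ominus> (x \<oplus> a \<otimes> t [^] n) \<in> N" for u x a
      using unique[OF W(1) that(2) s(1) that(3)] that(1,4) Ws[OF that(1)] by simp
    have same_eq: "W u \<ominus> x \<in> N \<and> f (s u) = f a"
      if "u \<in> lspan E (Suc n)" "x \<in> lspan E n" "a \<in> E" "u = x \<oplus> a \<otimes> t [^] n" for u x a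
    proof (rule same[OF that(1-3)])
      have "u \<ominus> u = \<zero>" using Ld(1)[OF that(1)] by (simp add: minus_eq r_neg)
      thus "u \<ominus> (x \<oplus> a \<otimes> t [^] n) \<in> N" using Nd(2) that(4) by simp
    qed
    define l' where "l' i u = (if i < n then l i (W u) else c \<otimes> s u)" for i u
    show ?thesis
    proof (intro bexI[OF _ c] exI[of _ l'],
        unfold almost_dual_basis_def, intro conjI allI impI ballI)
      fix u assume u: "u \<in> lspan E (Suc n)"
      note uc = Ld(1)[OF u]
      show "l' i u \<in> E" for i using lE W(1)[OF u] E_mult[OF cE(1) s(1)[OF u]] by (simp add: l'_def)
      show "f (l' i (u \<oplus> v)) = f (l' i u) \<oplus>\<^bsub>B\<^esub> f (l' i v)" if v: "v \<in> lspan E (Suc n)" for i v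
      proof -
        have "u \<oplus> v = (W u \<oplus> s u \<otimes> t [^] n) \<oplus> (W v \<oplus> s v \<otimes> t [^] n)"
          using Ws[OF u] Ws[OF v] by simp
        also have "\<dots> = (W u \<oplus> W v) \<oplus> (s u \<oplus> s v) \<otimes> t [^] n"
          using W(2)[OF u] W(2)[OF v] s(2)[OF u] s(2)[OF v] tn by algebra
        finally have *: "W (u \<oplus> v) \<ominus> (W u \<oplus> W v) \<in> N" "f (s (u \<oplus> v)) = f (s u \<oplus> s v)"
          using same_eq[OF Ld(3)[OF u v] Ld(3)[OF W(1)[OF u] W(1)[OF v]] E_add[OF s(1)[OF u] s(1)[OF v]]]
          by auto
        have uv: "u \<oplus> v \<in> lspan E (Suc n)" by (rule Ld(3)[OF u v])
        show ?thesis
        proof (cases "i < n")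
          case True
          thus ?thesis using l_cong[OF True W(1)[OF uv] Ld(3)[OF W(1)[OF u] W(1)[OF v]] *(1)]
            l_add[OF True W(1)[OF u] W(1)[OF v]] by (simp add: l'_def)
        next
          case False
          thus ?thesis using *(2) s(1)[OF u] s(1)[OF v] s(1)[OF uv] cE f_closed
            by (simp add: l'_def f_mult f_add B.r_distr)
        qed
      qed
      show "f (l' i (b \<otimes> u)) = f b \<otimes>\<^bsub>B\<^esub> f (l' i u)" if b: "b \<in> E" for i b
      proof -
        have "b \<otimes> u = b \<otimes> (W u \<oplus> s u \<otimes> t [^] n)" using Ws[OF u] by simp
        also have "\<dots> = b \<otimes> W u \<oplus> (b \<otimes> s u) \<otimes> t [^] n"
          using W(2)[OF u] s(2)[OF u] E_carrier[OF b] tn by algebra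
        finally have *: "W (b \<otimes> u) \<ominus> b \<otimes> W u \<in> N" "f (s (b \<otimes> u)) = f (b \<otimes> s u)"
          using same_eq[OF Ld(4)[OF b u] Ld(4)[OF b W(1)[OF u]] E_mult[OF b s(1)[OF u]]] by auto
        have bu: "b \<otimes> u \<in> lspan E (Suc n)" by (rule Ld(4)[OF b u])
        show ?thesis
        proof (cases "i < n")
          case True
          thus ?thesis using l_cong[OF True W(1)[OF bu] Ld(4)[OF b W(1)[OF u]] *(1)]
            l_mult[OF True b W(1)[OF u]] by (simp add: l'_def)
        next
          case False
          thus ?thesis using *(2) s(1)[OF u] s(1)[OF bu] cE b f_closed
            by (simp add: l'_def f_mult B.m_lcomm)
        qed
      qed
      show "f (l' i u) = \<zero>\<^bsub>B\<^esub>" if uN: "u \<in> N" for i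
      proof -
        have z: "\<zero> \<in> lspan E n" by (rule Ld(2))
        have "u \<ominus> (\<zero> \<oplus> \<zero> \<otimes> t [^] n) = u" using uc tn by (simp add: minus_eq)
        hence "W u \<ominus> \<zero> \<in> N" and su: "f (s u) = \<zero>\<^bsub>B\<^esub>"
          using same[OF u z E_zero] uN f_zero by auto
        hence "W u \<in> N" using W(2)[OF u] by (simp add: minus_eq)
        thus ?thesis using l_N[OF _ W(1)[OF u]] su f_mult[OF cE(1) s(1)[OF u]] f_closed[OF cE(1)]
          by (simp add: l'_def)
      qed
      show "c \<otimes> u \<ominus> (\<Oplus>i\<in>{..<Suc n}. l' i u \<otimes> t [^] i) \<in> N"
      proof -
        let ?s = "\<Oplus>i\<in>{..<n}. l i (W u) \<otimes> t [^] i"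
        have "(\<Oplus>i\<in>{..<n}. l' i u \<otimes> t [^] i) = ?s"
          using lE[OF _ W(1)[OF u]] E_carrier t_pow by (intro finsum_cong') (auto simp: l'_def)
        moreover have "(\<Oplus>i\<in>{..<Suc n}. l' i u \<otimes> t [^] i) =
            l' n u \<otimes> t [^] n \<oplus> (\<Oplus>i\<in>{..<n}. l' i u \<otimes> t [^] i)"
          unfolding lessThan_Suc using lE[OF _ W(1)[OF u]] E_carrier t_pow cE s(2)[OF u]
          by (intro finsum_insert) (auto simp: l'_def)
        ultimately have sum: "(\<Oplus>i\<in>{..<Suc n}. l' i u \<otimes> t [^] i) = c \<otimes> s u \<otimes> t [^] n \<oplus> ?s"
          by (simp add: l'_def)
        have "c \<otimes> u \<ominus> (c \<otimes> s u \<otimes> t [^] n \<oplus> ?s) =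
            c \<otimes> (W u \<oplus> s u \<otimes> t [^] n) \<ominus> (c \<otimes> s u \<otimes> t [^] n \<oplus> ?s)"
          using Ws[OF u] by simp
        also have "c \<otimes> (W u \<oplus> s u \<otimes> t [^] n) \<ominus> (c \<otimes> s u \<otimes> t [^] n \<oplus> r) = c \<otimes> W u \<ominus> r"
          if "r \<in> carrier T" for r
          using W(2)[OF u] s(2)[OF u] cE tn that by algebra
        note this[OF sum_closed[OF W(1)[OF u]]]
        finally show ?thesis unfolding sum using l_sum[OF W(1)[OF u]] by simp
      qed
    qed
  qed
qed

end

section \<open>Base change of the adjoined element to a good map\<close>

context extension_step
begin

abbreviation "M \<equiv> lspan E (Suc d)"
abbreviation "N \<equiv> lspan P (Suc d)"

end

text \<open>\<open>M = E[t]\<close> is spanned by \<open>1, t, \<dots>, t\<^sup>d\<close>, and \<open>N = P M\<close>.\<close>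
locale integral_step = extension_step T zs p E P t d B f
  for T :: "('t, 'k) ring_scheme" (structure) and zs p E P t d B f +
  assumes integral: "t [^] Suc d \<in> lspan E (Suc d)"
begin

lemmas M_submod = lspan_submod[OF submod_E, of "Suc d"]
  and N_submod = lspan_submod[OF submod_P, of "Suc d"]

lemmas M_carrier = submodD(1)[OF M_submod]

lemma t_mult_lspan:
  assumes C: "submod C" and u: "u \<in> lspan C (Suc d)"
  shows "t \<otimes> u \<in> lspan C (Suc d)"
proof -
  note LC = submodD[OF lspan_submod[OF C]]
  have "t \<otimes> v \<in> lspan C (Suc d)" if "v \<in> lspan C k" "k \<le> Suc d" for v k
    using that
  proof (induction k arbitrary: v)
    case 0 thus ?case using t_carrier LC(2)[of "Suc d"] by (simp del: lspan.simps(2))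
  next
    case (Suc k)
    then obtain x a where v: "v = x \<oplus> a \<otimes> t [^] k" "x \<in> lspan C k" "a \<in> C" by auto
    have "a \<otimes> t [^] Suc k \<in> lspan C (Suc d)"
    proof (cases "Suc k < Suc d")
      case True thus ?thesis by (rule lspan_gen[OF C v(3)])
    next
      case False
      hence "Suc k = Suc d" using Suc.prems by simp
      thus ?thesis using lspan_scale[OF C v(3) integral] by simp
    qed
    moreover have "t \<otimes> v = t \<otimes> x \<oplus> a \<otimes> t [^] Suc k"
      unfolding v(1) nat_pow_Suc using t_carrier LC(1)[OF v(2)] submodD(1)[OF C v(3)] t_pow[of k]
      by algebra
    ultimately show ?case using LC(3) Suc.IH[OF v(2)] Suc.prems by (simp del: lspan.simps(2))
  qed
  thus ?thesis using u by blast
qed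

lemma t_pow_mult_lspan:
  assumes C: "submod C" and u: "u \<in> lspan C (Suc d)"
  shows "t [^] (n::nat) \<otimes> u \<in> lspan C (Suc d)"
proof (induction n)
  case 0 thus ?case using u submodD(1)[OF lspan_submod[OF C] u] by (simp del: lspan.simps)
next
  case (Suc n)
  have "t [^] Suc n \<otimes> u = t \<otimes> (t [^] n \<otimes> u)"
    using t_carrier submodD(1)[OF lspan_submod[OF C] u] t_pow[of n] by (simp add: m_ac del: lspan.simps)
  thus ?case using t_mult_lspan[OF C Suc.IH] by (simp del: lspan.simps)
qed

lemma M_mult_lspan:
  assumes C: "submod C" and v: "v \<in> M" and u: "u \<in> lspan C (Suc d)"
  shows "v \<otimes> u \<in> lspan C (Suc d)"
proof -
  note LC = submodD[OF lspan_submod[OF C]]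
  have "x \<otimes> u \<in> lspan C (Suc d)" if "x \<in> lspan E k" for x k
    using that
  proof (induction k arbitrary: x)
    case 0 thus ?case using LC(1)[OF u] LC(2)[of "Suc d"] by (simp del: lspan.simps(2))
  next
    case (Suc k)
    then obtain w a where x: "x = w \<oplus> a \<otimes> t [^] k" "w \<in> lspan E k" "a \<in> E" by auto
    have "x \<otimes> u = w \<otimes> u \<oplus> a \<otimes> (t [^] k \<otimes> u)"
      unfolding x(1) using LC(1)[OF u] submodD(1)[OF lspan_submod[OF submod_E] x(2)] E_carrier[OF x(3)] t_pow[of k]
      by algebra
    thus ?case using LC(3)[OF Suc.IH[OF x(2)] LC(4)[OF x(3) t_pow_mult_lspan[OF C u, of k]]] by simp
  qed
  thus ?thesis using v by blast
qed

lemma E_M: "E \<subseteq> M"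
proof
  fix a assume "a \<in> E"
  thus "a \<in> M" using lspan_gen[OF submod_E, of a 0 "Suc d"] E_carrier by (simp del: lspan.simps)
qed

lemmas M_one = subsetD[OF E_M E_one]

lemma t_pow_M: "t [^] (n::nat) \<in> M"
  using t_pow_mult_lspan[OF submod_E M_one, of n] t_pow by (simp del: lspan.simps)

lemma t_M: "t \<in> M"
  using t_pow_M[of 1] t_carrier by (simp add: nat_pow_eone del: lspan.simps)

lemma M_mult: "u \<in> M \<Longrightarrow> v \<in> M \<Longrightarrow> u \<otimes> v \<in> M"
  by (rule M_mult_lspan[OF submod_E])

lemma M_subring: "subring M T"
proof (rule subringI)
  show "M \<subseteq> carrier T" using M_carrier by blast
  show "\<one> \<in> M" by (rule M_one)
  show "h \<in> M \<Longrightarrow> \<ominus> h \<in> M" for h by (rule submodD(5)[OF M_submod])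
  show "h \<in> M \<Longrightarrow> h' \<in> M \<Longrightarrow> h \<otimes> h' \<in> M" for h h' by (rule M_mult)
  show "h \<in> M \<Longrightarrow> h' \<in> M \<Longrightarrow> h \<oplus> h' \<in> M" for h h' by (rule submodD(3)[OF M_submod])
qed

text \<open>Lying over, in the form needed here: if \<open>c\<close> were in \<open>P M\<close>, then by Nakayama some
  \<open>w \<notin> P\<close> would annihilate \<open>M\<close>, which contains \<open>1\<close>.\<close>
lemma nontorsion:
  assumes c: "c \<in> E - P"
  shows "c \<notin> N"
proof
  assume cN: "c \<in> N"
  have "c \<otimes> t [^] i \<in> N" for i :: nat
    using t_pow_mult_lspan[OF submod_P cN, of i] t_pow[of i] E_carrier[of c] c
    by (simp add: m_comm del: lspan.simps)
  then obtain w where w: "w \<in> E - P" "\<forall>i<Suc d. w \<otimes> t [^] i = \<zero>"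
    using lspan_nakayama[OF c] by blast
  hence "w = \<zero>" using E_carrier[of w] by auto
  thus False using w P_zero by blast
qed

end

text \<open>The ring \<open>M \<otimes>\<^sub>E B\<close> is replaced by a quotient of \<open>B[X]\<close> in which \<open>X\<close> takes the place of \<open>t\<close>. The
  functionals \<open>l\<^sub>i\<close> extend to \<open>B[X]\<close>, and the polynomials to be divided out are those on which all
  functionals vanish, even after multiplication by elements of \<open>M\<close>.\<close>
locale almost_projective_step = integral_step T zs p E P t d B f
  for T :: "('t, 'k) ring_scheme" (structure) and zs p E P t d B f +
  fixes c :: 't and l :: "nat \<Rightarrow> 't \<Rightarrow> 't"
  assumes c: "c \<in> E - P" and dual: "almost_dual_basis N (Suc d) c l"
begin

declare lspan.simps [simp del]

sublocale U: UP_cring B "UP B" by unfold_locales simp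

abbreviation "UB \<equiv> UP B"

definition mu :: "nat \<Rightarrow> 't \<Rightarrow> 't universe" where "mu i u = f (l i u)"

lemmas l_E = almost_dual_basisD(1)[OF dual]

lemma mu_closed: "i \<le> d \<Longrightarrow> u \<in> M \<Longrightarrow> mu i u \<in> carrier B"
  unfolding mu_def by (intro f_closed l_E) auto

lemma mu_add: "i \<le> d \<Longrightarrow> u \<in> M \<Longrightarrow> v \<in> M \<Longrightarrow> mu i (u \<oplus> v) = mu i u \<oplus>\<^bsub>B\<^esub> mu i v"
  unfolding mu_def by (rule almost_dual_basisD(2)[OF dual]) auto

lemma mu_mult: "i \<le> d \<Longrightarrow> a \<in> E \<Longrightarrow> u \<in> M \<Longrightarrow> mu i (a \<otimes> u) = f a \<otimes>\<^bsub>B\<^esub> mu i u"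
  unfolding mu_def by (rule almost_dual_basisD(3)[OF dual]) auto

lemma mu_cong:
  assumes i: "i \<le> d" and uv: "u \<in> M" "v \<in> M" "u \<ominus> v \<in> N"
  shows "mu i u = mu i v"
proof -
  have m: "u \<ominus> v \<in> M" by (rule submodD(6)[OF M_submod uv(1,2)])
  have "u = (u \<ominus> v) \<oplus> v" using M_carrier[OF uv(1)] M_carrier[OF uv(2)] by algebra
  hence "mu i u = mu i (u \<ominus> v) \<oplus>\<^bsub>B\<^esub> mu i v" using mu_add[OF i m uv(2)] by simp
  moreover have "mu i (u \<ominus> v) = \<zero>\<^bsub>B\<^esub>"
    unfolding mu_def using i m uv(3) by (intro almost_dual_basisD(4)[OF dual]) auto
  ultimately show ?thesis using mu_closed[OF i uv(2)] by simp
qed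

lemma mu_zero: "i \<le> d \<Longrightarrow> mu i \<zero> = \<zero>\<^bsub>B\<^esub>"
  unfolding mu_def
  by (intro almost_dual_basisD(4)[OF dual]) (auto intro: submodD(2) M_submod N_submod)

text \<open>The \<open>B\<close>-linear extension of \<open>u \<mapsto> mu i (u y)\<close> to \<open>B[X]\<close>.\<close>
definition pair :: "nat \<Rightarrow> (nat \<Rightarrow> 't universe) \<Rightarrow> 't \<Rightarrow> 't universe" where
  "pair i u y = (\<Oplus>\<^bsub>B\<^esub>n\<in>{..deg B u}. U.cf u n \<otimes>\<^bsub>B\<^esub> mu i (t [^] n \<otimes> y))"

lemma pair_term_closed:
  assumes "i \<le> d" "y \<in> M" "u \<in> carrier UB"
  shows "U.cf u n \<otimes>\<^bsub>B\<^esub> mu i (t [^] n \<otimes> y) \<in> carrier B"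
  using assms by (intro B.m_closed U.coeff_closed mu_closed M_mult t_pow_M)

lemma pair_closed:
  assumes "i \<le> d" "y \<in> M" "u \<in> carrier UB"
  shows "pair i u y \<in> carrier B"
  unfolding pair_def using pair_term_closed[OF assms] by (intro B.finsum_closed) auto

lemma pair_bound:
  assumes "i \<le> d" "y \<in> M" "u \<in> carrier UB" and k: "\<And>n. n > k \<Longrightarrow> U.cf u n = \<zero>\<^bsub>B\<^esub>"
  shows "pair i u y = (\<Oplus>\<^bsub>B\<^esub>n\<in>{..k}. U.cf u n \<otimes>\<^bsub>B\<^esub> mu i (t [^] n \<otimes> y))"
  unfolding pair_def
proof (rule B.add.finprod_mono_neutral_cong_left)
  show "{..deg B u} \<subseteq> {..k}" using U.deg_aboveI[OF k assms(3)] by simp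
  show "U.cf u n \<otimes>\<^bsub>B\<^esub> mu i (t [^] n \<otimes> y) = \<zero>\<^bsub>B\<^esub>" if "n \<in> {..k} - {..deg B u}" for n
    using that U.deg_aboveD[of u n] assms mu_closed M_mult t_pow_M by simp
qed (use pair_term_closed[OF assms(1-3)] in auto)

lemma pair_add:
  assumes "i \<le> d" "y \<in> M" "u \<in> carrier UB" "v \<in> carrier UB"
  shows "pair i (u \<oplus>\<^bsub>UB\<^esub> v) y = pair i u y \<oplus>\<^bsub>B\<^esub> pair i v y"
proof -
  let ?k = "max (deg B u) (deg B v)"
  have u: "pair i u y = (\<Oplus>\<^bsub>B\<^esub>n\<in>{..?k}. U.cf u n \<otimes>\<^bsub>B\<^esub> mu i (t [^] n \<otimes> y))"
    and v: "pair i v y = (\<Oplus>\<^bsub>B\<^esub>n\<in>{..?k}. U.cf v n \<otimes>\<^bsub>B\<^esub> mu i (t [^] n \<otimes> y))"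
    and uv: "pair i (u \<oplus>\<^bsub>UB\<^esub> v) y =
      (\<Oplus>\<^bsub>B\<^esub>n\<in>{..?k}. U.cf (u \<oplus>\<^bsub>UB\<^esub> v) n \<otimes>\<^bsub>B\<^esub> mu i (t [^] n \<otimes> y))"
    by (rule pair_bound; use assms in \<open>auto intro: U.deg_aboveD simp: U.deg_aboveD\<close>)+
  have "(\<Oplus>\<^bsub>B\<^esub>n\<in>{..?k}. U.cf (u \<oplus>\<^bsub>UB\<^esub> v) n \<otimes>\<^bsub>B\<^esub> mu i (t [^] n \<otimes> y)) =
      (\<Oplus>\<^bsub>B\<^esub>n\<in>{..?k}. U.cf u n \<otimes>\<^bsub>B\<^esub> mu i (t [^] n \<otimes> y) \<oplus>\<^bsub>B\<^esub> U.cf v n \<otimes>\<^bsub>B\<^esub> mu i (t [^] n \<otimes> y))"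
    using assms mu_closed M_mult t_pow_M
    by (intro B.finsum_cong') (auto simp: B.l_distr)
  thus ?thesis unfolding u v uv
    using pair_term_closed[OF assms(1,2,3)] pair_term_closed[OF assms(1,2,4)]
    by (simp add: B.finsum_addf)
qed

lemma pair_monom:
  assumes "i \<le> d" "y \<in> M" "b \<in> carrier B"
  shows "pair i (U.mnm b n) y = b \<otimes>\<^bsub>B\<^esub> mu i (t [^] n \<otimes> y)"
proof -
  have mc: "mu i (t [^] m \<otimes> y) \<in> carrier B" for m :: nat
    using assms by (intro mu_closed M_mult t_pow_M)
  have "pair i (U.mnm b n) y = (\<Oplus>\<^bsub>B\<^esub>m\<in>{..n}. U.cf (U.mnm b n) m \<otimes>\<^bsub>B\<^esub> mu i (t [^] m \<otimes> y))"
    using assms by (intro pair_bound) auto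
  also have "\<dots> = (\<Oplus>\<^bsub>B\<^esub>m\<in>{..n}. if n = m then b \<otimes>\<^bsub>B\<^esub> mu i (t [^] m \<otimes> y) else \<zero>\<^bsub>B\<^esub>)"
    using assms mc by (intro B.finsum_cong') auto
  also have "\<dots> = b \<otimes>\<^bsub>B\<^esub> mu i (t [^] n \<otimes> y)"
    using assms mc by (intro B.finsum_singleton) auto
  finally show ?thesis .
qed

lemma pair_minus:
  assumes "i \<le> d" "y \<in> M" "u \<in> carrier UB" "v \<in> carrier UB"
  shows "pair i (u \<ominus>\<^bsub>UB\<^esub> v) y = pair i u y \<ominus>\<^bsub>B\<^esub> pair i v y"
proof -
  have w: "u \<ominus>\<^bsub>UB\<^esub> v \<in> carrier UB" using assms by simp
  have "(u \<ominus>\<^bsub>UB\<^esub> v) \<oplus>\<^bsub>UB\<^esub> v = u" using assms U.P.minus_eq U.P.a_assoc U.P.l_neg by simp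
  hence "pair i u y = pair i (u \<ominus>\<^bsub>UB\<^esub> v) y \<oplus>\<^bsub>B\<^esub> pair i v y"
    using pair_add[OF assms(1,2) w assms(4)] by simp
  thus ?thesis
    using pair_closed[OF assms(1,2) w] pair_closed[OF assms(1,2,4)]
    by (simp add: B.minus_eq B.a_assoc B.r_neg)
qed

lemma pair_monom_mult:
  assumes i: "i \<le> d" and y: "y \<in> M" and b: "b \<in> carrier B" and u: "u \<in> carrier UB"
  shows "pair i (U.mnm b k \<otimes>\<^bsub>UB\<^esub> u) y = b \<otimes>\<^bsub>B\<^esub> pair i u (t [^] k \<otimes> y)"
  using u
proof (induction u rule: U.poly_induct)
  case (monom a n)
  have ky: "t [^] k \<otimes> y \<in> M" using y by (intro M_mult t_pow_M)
  have eq: "U.mnm b k \<otimes>\<^bsub>UB\<^esub> U.mnm a n = U.mnm (b \<otimes>\<^bsub>B\<^esub> a) (k + n)" using b monom by simp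
  have "t [^] (k + n) \<otimes> y = t [^] n \<otimes> (t [^] k \<otimes> y)"
    using t_carrier M_carrier[OF y] t_pow by (simp add: nat_pow_mult[symmetric] m_ac)
  moreover have "mu i (t [^] n \<otimes> (t [^] k \<otimes> y)) \<in> carrier B"
    by (rule mu_closed[OF i M_mult[OF t_pow_M ky]])
  ultimately show ?case
    unfolding eq pair_monom[OF i y B.m_closed[OF b monom]] pair_monom[OF i ky monom]
    using b monom by (simp add: B.m_assoc)
next
  case (add u v)
  have ky: "t [^] k \<otimes> y \<in> M" using y by (intro M_mult t_pow_M)
  show ?case using add b pair_add[OF i] y ky pair_closed[OF i ky]
    by (simp add: U.P.r_distr B.r_distr)
qed

text \<open>For the zero ideal \<open>J\<close> this is the ideal to be divided out. Taking \<open>J\<close> variable shows how ideals of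
  \<open>B\<close> extend to the quotient: the functionals map the extension of \<open>J\<close> back to \<open>J\<close>.\<close>
definition pair_ideal :: "'t universe set \<Rightarrow> (nat \<Rightarrow> 't universe) set" where
  "pair_ideal J = {u \<in> carrier UB. \<forall>i\<le>d. \<forall>y\<in>M. pair i u y \<in> J}"

lemma pair_ideal_ideal:
  assumes J: "ideal J B"
  shows "ideal (pair_ideal J) UB"
proof (rule idealI[OF U.P.ring_axioms])
  have z: "\<zero>\<^bsub>B\<^esub> \<in> J" using additive_subgroup.zero_closed[OF ideal.axioms(1)[OF J]] .
  have "pair i \<zero>\<^bsub>UB\<^esub> y = \<zero>\<^bsub>B\<^esub>" if "i \<le> d" "y \<in> M" for i y
    using pair_monom[OF that, of "\<zero>\<^bsub>B\<^esub>" 0] mu_closed[OF that(1) M_mult[OF t_pow_M that(2)], of 0]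
    by (simp add: U.monom_zero)
  hence 0: "\<zero>\<^bsub>UB\<^esub> \<in> pair_ideal J" using z by (simp add: pair_ideal_def)
  have minus: "u \<ominus>\<^bsub>UB\<^esub> v \<in> pair_ideal J" if "u \<in> pair_ideal J" "v \<in> pair_ideal J" for u v
    using that by (auto simp: pair_ideal_def pair_minus B.ideal_minus_closed[OF J])
  have plus: "u \<oplus>\<^bsub>UB\<^esub> v \<in> pair_ideal J" if "u \<in> pair_ideal J" "v \<in> pair_ideal J" for u v
    using that by (auto simp: pair_ideal_def pair_add B.ideal_add_closed[OF J])
  show "subgroup (pair_ideal J) (add_monoid UB)"
  proof (rule U.P.add.subgroupI)
    show "pair_ideal J \<subseteq> carrier UB" by (auto simp: pair_ideal_def)
    show "pair_ideal J \<noteq> {}" using 0 by blast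
    show "\<ominus>\<^bsub>UB\<^esub> u \<in> pair_ideal J" if "u \<in> pair_ideal J" for u
    proof -
      have "u \<in> carrier UB" using that by (simp add: pair_ideal_def)
      thus ?thesis using minus[OF 0 that] by (simp add: U.P.minus_eq)
    qed
    show "u \<oplus>\<^bsub>UB\<^esub> v \<in> pair_ideal J" if "u \<in> pair_ideal J" "v \<in> pair_ideal J" for u v
      using that by (rule plus)
  qed
  fix u w assume u: "u \<in> pair_ideal J" and w: "w \<in> carrier UB"
  have uc: "u \<in> carrier UB" using u by (simp add: pair_ideal_def)
  show wu: "w \<otimes>\<^bsub>UB\<^esub> u \<in> pair_ideal J"
    using w
  proof (induction w rule: U.poly_induct)
    case (monom b n)
    have "pair i (U.mnm b n \<otimes>\<^bsub>UB\<^esub> u) y \<in> J" if "i \<le> d" "y \<in> M" for i y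
      using pair_monom_mult[OF that monom uc] u that monom M_mult[OF t_pow_M that(2)]
      by (simp add: pair_ideal_def ideal.I_l_closed[OF J])
    thus ?case using monom uc by (simp add: pair_ideal_def)
  next
    case (add w w')
    thus ?case using plus uc by (simp add: U.P.l_distr)
  qed
  show "u \<otimes>\<^bsub>UB\<^esub> w \<in> pair_ideal J" using wu uc w by (simp add: U.P.m_comm)
qed


text \<open>A representative in \<open>B[X]\<close> of the image of \<open>s\<close>, namely \<open>\<Sum> f(a\<^sub>i) X\<^sup>i\<close> for \<open>s = \<Sum> a\<^sub>i t\<^sup>i\<close>. On \<open>E\<close> the constant
  polynomials are preferred, so that the sequence \<open>zs\<close> and its powers are represented by constants.\<close>
lemma ex_lift:
  assumes s: "s \<in> M"
  shows "\<exists>v\<in>carrier UB. (\<forall>i\<le>d. \<forall>y\<in>M. pair i v y = mu i (s \<otimes> y)) \<and> (s \<in> E \<longrightarrow> v = U.mnm (f s) 0)"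
proof (cases "s \<in> E")
  case True
  have "pair i (U.mnm (f s) 0) y = mu i (s \<otimes> y)" if "i \<le> d" "y \<in> M" for i y
    using pair_monom[OF that f_closed[OF True], of 0] mu_mult[OF that(1) True that(2)] M_carrier[OF that(2)]
    by simp
  thus ?thesis using f_closed[OF True] by (intro bexI[of _ "U.mnm (f s) 0"]) auto
next
  case False
  have "\<exists>v\<in>carrier UB. \<forall>i\<le>d. \<forall>y\<in>M. pair i v y = mu i (s \<otimes> y)" if "s \<in> lspan E k" "k \<le> Suc d" for s k
    using that
  proof (induction k arbitrary: s)
    case 0
    have "pair i (U.mnm (f \<zero>) 0) y = mu i (\<zero> \<otimes> y)" if "i \<le> d" "y \<in> M" for i y
      using pair_monom[OF that f_closed[OF E_zero], of 0] mu_mult[OF that(1) E_zero that(2)] M_carrier[OF that(2)]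
      by simp
    moreover have "s = \<zero>" using 0 by (simp add: lspan.simps)
    ultimately show ?case using f_closed[OF E_zero] by (intro bexI[of _ "U.mnm (f \<zero>) 0"]) auto
  next
    case (Suc k)
    then obtain u a where s: "s = u \<oplus> a \<otimes> t [^] k" "u \<in> lspan E k" "a \<in> E" by (auto simp: lspan.simps)
    obtain v where v: "v \<in> carrier UB" "\<forall>i\<le>d. \<forall>y\<in>M. pair i v y = mu i (u \<otimes> y)"
      using Suc.IH[OF s(2)] Suc.prems by auto
    have u: "u \<in> M" using s(2) lspan_mono[OF submod_E, of k "Suc d"] Suc.prems by auto
    have "pair i (v \<oplus>\<^bsub>UB\<^esub> U.mnm (f a) k) y = mu i (s \<otimes> y)" if iy: "i \<le> d" "y \<in> M" for i y
    proof -
      have ty: "t [^] k \<otimes> y \<in> M" by (intro M_mult t_pow_M iy)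
      have aty: "a \<otimes> (t [^] k \<otimes> y) \<in> M" by (rule submodD(4)[OF M_submod s(3) ty])
      have "s \<otimes> y = u \<otimes> y \<oplus> a \<otimes> (t [^] k \<otimes> y)"
        unfolding s(1) using M_carrier[OF u] M_carrier[OF iy(2)] E_carrier[OF s(3)] t_pow[of k] by algebra
      hence "mu i (s \<otimes> y) = mu i (u \<otimes> y) \<oplus>\<^bsub>B\<^esub> f a \<otimes>\<^bsub>B\<^esub> mu i (t [^] k \<otimes> y)"
        using mu_add[OF iy(1) M_mult[OF u iy(2)] aty] mu_mult[OF iy(1) s(3) ty] by simp
      thus ?thesis
        using pair_add[OF iy v(1), of "U.mnm (f a) k"] pair_monom[OF iy f_closed[OF s(3)], of k] v(2) iy f_closed[OF s(3)]
        by simp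
    qed
    thus ?case using v(1) f_closed[OF s(3)] by (intro bexI[of _ "v \<oplus>\<^bsub>UB\<^esub> U.mnm (f a) k"]) auto
  qed
  thus ?thesis using s False by blast
qed

definition lift :: "'t \<Rightarrow> nat \<Rightarrow> 't universe" where
  "lift s = (SOME v. v \<in> carrier UB \<and> (\<forall>i\<le>d. \<forall>y\<in>M. pair i v y = mu i (s \<otimes> y)) \<and>
     (s \<in> E \<longrightarrow> v = U.mnm (f s) 0))"

lemma lift:
  assumes "s \<in> M"
  shows "lift s \<in> carrier UB" "i \<le> d \<Longrightarrow> y \<in> M \<Longrightarrow> pair i (lift s) y = mu i (s \<otimes> y)"
    "s \<in> E \<Longrightarrow> lift s = U.mnm (f s) 0"
proof -
  have "\<exists>v. v \<in> carrier UB \<and> (\<forall>i\<le>d. \<forall>y\<in>M. pair i v y = mu i (s \<otimes> y)) \<and>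
     (s \<in> E \<longrightarrow> v = U.mnm (f s) 0)" using ex_lift[OF assms] by blast
  note * = someI_ex[OF this, folded lift_def]
  show "lift s \<in> carrier UB" "i \<le> d \<Longrightarrow> y \<in> M \<Longrightarrow> pair i (lift s) y = mu i (s \<otimes> y)"
    "s \<in> E \<Longrightarrow> lift s = U.mnm (f s) 0" using * by blast+
qed

lemma pair_mult_lift:
  assumes i: "i \<le> d" and y: "y \<in> M" and s: "s \<in> M" and u: "u \<in> carrier UB"
  shows "pair i (u \<otimes>\<^bsub>UB\<^esub> lift s) y = pair i u (s \<otimes> y)"
  using u
proof (induction u rule: U.poly_induct)
  case (monom b k)
  have ky: "t [^] k \<otimes> y \<in> M" by (intro M_mult t_pow_M y)
  have "s \<otimes> (t [^] k \<otimes> y) = t [^] k \<otimes> (s \<otimes> y)"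
    using M_carrier[OF s] M_carrier[OF y] t_pow[of k] by algebra
  thus ?case
    by (simp add: pair_monom_mult[OF i y monom lift(1)[OF s]] pair_monom[OF i M_mult[OF s y] monom]
        lift(2)[OF s i ky])
next
  case (add u v)
  have sy: "s \<otimes> y \<in> M" by (rule M_mult[OF s y])
  show ?case using add lift(1)[OF s] by (simp add: U.P.l_distr pair_add[OF i y] pair_add[OF i sy])
qed

lemma mu_finsum:
  assumes j: "j \<le> d" and y: "y \<in> M" and g: "\<And>i. i \<in> A \<Longrightarrow> g i \<in> E" and "finite A"
  shows "(\<Oplus>i\<in>A. g i \<otimes> t [^] (i::nat)) \<in> M \<and> mu j ((\<Oplus>i\<in>A. g i \<otimes> t [^] i) \<otimes> y) =
    (\<Oplus>\<^bsub>B\<^esub>i\<in>A. f (g i) \<otimes>\<^bsub>B\<^esub> mu j (t [^] i \<otimes> y))"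
  using assms(4) g
proof (induction A)
  case empty
  show ?case using submodD(2)[OF M_submod] M_carrier[OF y] mu_zero[OF j] by simp
next
  case (insert k A)
  let ?s = "\<Oplus>i\<in>A. g i \<otimes> t [^] i"
  have IH: "?s \<in> M" "mu j (?s \<otimes> y) = (\<Oplus>\<^bsub>B\<^esub>i\<in>A. f (g i) \<otimes>\<^bsub>B\<^esub> mu j (t [^] i \<otimes> y))"
    using insert by auto
  have gk: "g k \<in> E" and gA: "\<And>i. i \<in> A \<Longrightarrow> g i \<in> E" using insert.prems by auto
  have ty: "t [^] i \<otimes> y \<in> M" for i :: nat by (intro M_mult t_pow_M y)
  have tk: "g k \<otimes> t [^] k \<in> M" by (rule submodD(4)[OF M_submod gk t_pow_M])
  have s: "(\<Oplus>i\<in>insert k A. g i \<otimes> t [^] i) = g k \<otimes> t [^] k \<oplus> ?s"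
    using insert(1,2) E_carrier[OF gk] E_carrier[OF gA] t_pow by (intro finsum_insert) auto
  have b: "(\<Oplus>\<^bsub>B\<^esub>i\<in>insert k A. f (g i) \<otimes>\<^bsub>B\<^esub> mu j (t [^] i \<otimes> y)) =
      f (g k) \<otimes>\<^bsub>B\<^esub> mu j (t [^] k \<otimes> y) \<oplus>\<^bsub>B\<^esub> (\<Oplus>\<^bsub>B\<^esub>i\<in>A. f (g i) \<otimes>\<^bsub>B\<^esub> mu j (t [^] i \<otimes> y))"
    using insert(1,2) f_closed[OF gk] f_closed[OF gA] mu_closed[OF j ty] by (intro B.finsum_insert) auto
  have "(g k \<otimes> t [^] k \<oplus> r) \<otimes> y = g k \<otimes> (t [^] k \<otimes> y) \<oplus> r \<otimes> y" if "r \<in> carrier T" for r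
    using that M_carrier[OF y] t_pow[of k] E_carrier[OF gk] by algebra
  note this[OF M_carrier[OF IH(1)]]
  hence "mu j ((g k \<otimes> t [^] k \<oplus> ?s) \<otimes> y) = f (g k) \<otimes>\<^bsub>B\<^esub> mu j (t [^] k \<otimes> y) \<oplus>\<^bsub>B\<^esub> mu j (?s \<otimes> y)"
    using mu_add[OF j submodD(4)[OF M_submod gk ty] M_mult[OF IH(1) y]] mu_mult[OF j gk ty] by simp
  thus ?case unfolding s b IH(2)[symmetric] using submodD(3)[OF M_submod tk IH(1)] by simp
qed

text \<open>The dual basis identity for \<open>t\<^sup>k\<close>, multiplied by \<open>y\<close> and evaluated by the \<open>j\<close>-th functional.\<close>
lemma mu_expansion:
  assumes j: "j \<le> d" and y: "y \<in> M"
  shows "f c \<otimes>\<^bsub>B\<^esub> mu j (t [^] k \<otimes> y) =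
    (\<Oplus>\<^bsub>B\<^esub>i\<in>{..d}. mu i (t [^] (k::nat)) \<otimes>\<^bsub>B\<^esub> mu j (t [^] i \<otimes> y))"
proof -
  let ?s = "\<Oplus>i\<in>{..d}. l i (t [^] k) \<otimes> t [^] i"
  have cE: "c \<in> E" "c \<in> carrier T" using c E_carrier by auto
  have ty: "t [^] k \<otimes> y \<in> M" by (intro M_mult t_pow_M y)
  have lk: "\<And>i. i \<in> {..d} \<Longrightarrow> l i (t [^] k) \<in> E" by (intro l_E t_pow_M) auto
  note fs = mu_finsum[of j y "{..d}" "\<lambda>i. l i (t [^] k)", OF j y lk]
  have sM: "?s \<in> M" using fs by simp
  have ct: "c \<otimes> t [^] k \<in> M" by (rule submodD(4)[OF M_submod cE(1) t_pow_M])
  have N: "c \<otimes> t [^] k \<ominus> ?s \<in> N"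
    using almost_dual_basisD(5)[OF dual t_pow_M[of k]] by (simp add: lessThan_Suc_atMost)
  have "c \<otimes> (t [^] k \<otimes> y) \<ominus> r \<otimes> y = y \<otimes> (c \<otimes> t [^] k \<ominus> r)" if "r \<in> carrier T" for r
    using that cE M_carrier[OF y] t_pow[of k] by algebra
  note this[OF M_carrier[OF sM]]
  hence "c \<otimes> (t [^] k \<otimes> y) \<ominus> ?s \<otimes> y \<in> N" using M_mult_lspan[OF submod_P y N] by simp
  hence "mu j (c \<otimes> (t [^] k \<otimes> y)) = mu j (?s \<otimes> y)"
    by (intro mu_cong j submodD(4)[OF M_submod cE(1) ty] M_mult sM y)
  thus ?thesis using fs mu_mult[OF j cE(1) ty] by (simp add: mu_def)
qed

lemma pair_expansion:
  assumes j: "j \<le> d" and y: "y \<in> M" and u: "u \<in> carrier UB"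
  shows "f c \<otimes>\<^bsub>B\<^esub> pair j u y = (\<Oplus>\<^bsub>B\<^esub>i\<in>{..d}. pair i u \<one> \<otimes>\<^bsub>B\<^esub> mu j (t [^] i \<otimes> y))"
  using u
proof (induction u rule: U.poly_induct)
  case (monom b k)
  have ty: "t [^] i \<otimes> y \<in> M" for i :: nat by (intro M_mult t_pow_M y)
  have fc: "f c \<in> carrier B" using c f_closed by blast
  have m: "i \<in> {..d} \<Longrightarrow> mu i (t [^] k) \<in> carrier B" for i by (intro mu_closed t_pow_M) auto
  have "f c \<otimes>\<^bsub>B\<^esub> pair j (U.mnm b k) y = b \<otimes>\<^bsub>B\<^esub> (f c \<otimes>\<^bsub>B\<^esub> mu j (t [^] k \<otimes> y))"
    using monom fc mu_closed[OF j ty] by (simp add: pair_monom[OF j y monom] B.m_lcomm)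
  also have "\<dots> = (\<Oplus>\<^bsub>B\<^esub>i\<in>{..d}. b \<otimes>\<^bsub>B\<^esub> (mu i (t [^] k) \<otimes>\<^bsub>B\<^esub> mu j (t [^] i \<otimes> y)))"
    unfolding mu_expansion[OF j y] using monom m mu_closed[OF j ty] by (intro B.finsum_rdistr) auto
  also have "\<dots> = (\<Oplus>\<^bsub>B\<^esub>i\<in>{..d}. pair i (U.mnm b k) \<one> \<otimes>\<^bsub>B\<^esub> mu j (t [^] i \<otimes> y))"
    using monom m mu_closed[OF j ty] t_pow[of k]
    by (intro B.finsum_cong') (auto simp: pair_monom[OF _ M_one] B.m_assoc)
  finally show ?case .
next
  case (add u v)
  have ty: "t [^] i \<otimes> y \<in> M" for i :: nat by (intro M_mult t_pow_M y)
  have fc: "f c \<in> carrier B" using c f_closed by blast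
  note m = mu_closed[OF j ty] and p1 = pair_closed[OF _ M_one]
  have "(\<Oplus>\<^bsub>B\<^esub>i\<in>{..d}. pair i (u \<oplus>\<^bsub>UB\<^esub> v) \<one> \<otimes>\<^bsub>B\<^esub> mu j (t [^] i \<otimes> y)) =
      (\<Oplus>\<^bsub>B\<^esub>i\<in>{..d}. pair i u \<one> \<otimes>\<^bsub>B\<^esub> mu j (t [^] i \<otimes> y) \<oplus>\<^bsub>B\<^esub> pair i v \<one> \<otimes>\<^bsub>B\<^esub> mu j (t [^] i \<otimes> y))"
    using add m p1 by (intro B.finsum_cong') (auto simp: pair_add[OF _ M_one] B.l_distr)
  also have "\<dots> = (\<Oplus>\<^bsub>B\<^esub>i\<in>{..d}. pair i u \<one> \<otimes>\<^bsub>B\<^esub> mu j (t [^] i \<otimes> y)) \<oplus>\<^bsub>B\<^esub>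
      (\<Oplus>\<^bsub>B\<^esub>i\<in>{..d}. pair i v \<one> \<otimes>\<^bsub>B\<^esub> mu j (t [^] i \<otimes> y))"
    using add m p1 by (intro B.finsum_addf) auto
  finally show ?case
    unfolding add(3,4)[symmetric] using add fc pair_closed[OF j y] by (simp add: pair_add[OF j y] B.r_distr)
qed

abbreviation "J0 \<equiv> pair_ideal {\<zero>\<^bsub>B\<^esub>}"

lemma J0_ideal: "ideal J0 UB"
  by (rule pair_ideal_ideal[OF B.zeroideal])

lemma spn_pair:
  assumes ws: "set ws \<subseteq> carrier B"
  shows "spn UB J0 (map (\<lambda>w. U.mnm w 0) ws) \<subseteq> pair_ideal (spn B {\<zero>\<^bsub>B\<^esub>} ws)"
proof (rule U.P.spn_least)
  let ?J = "spn B {\<zero>\<^bsub>B\<^esub>} ws"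
  have J: "ideal ?J B" by (rule B.spn_ideal[OF B.zeroideal ws])
  show "ideal (pair_ideal ?J) UB" by (rule pair_ideal_ideal[OF J])
  show "J0 \<subseteq> pair_ideal ?J"
    using additive_subgroup.zero_closed[OF ideal.axioms(1)[OF J]] by (auto simp: pair_ideal_def)
  show "ideal J0 UB" by (rule J0_ideal)
  have "pair i (U.mnm w 0) y \<in> ?J" if "w \<in> set ws" "i \<le> d" "y \<in> M" for w i y
    using B.spn_superset(2)[OF B.zeroideal ws] that ws M_carrier[OF that(3)] mu_closed[OF that(2,3)]
    by (auto simp: pair_monom ideal.I_r_closed[OF J] subset_iff)
  thus "set (map (\<lambda>w. U.mnm w 0) ws) \<subseteq> pair_ideal ?J" using ws by (auto simp: pair_ideal_def)
qed

text \<open>Let \<open>w u\<close> be in the ideal generated by the first \<open>k\<close> members of the sequence. Applying the functionals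
  gives the same for elements of \<open>B\<close>, where \<open>w\<close> can be cancelled. So all \<open>pair i u 1\<close> lie in the
  ideal generated in \<open>B\<close>, and by the dual basis identity \<open>c u\<close> is represented by the polynomial
  \<open>\<Sum> (pair i u 1) X\<^sup>i\<close> with these coefficients.\<close>
lemma fiber_kills_colons:
  assumes ws: "set ws \<subseteq> carrier B" and reg: "regular_mod B {\<zero>\<^bsub>B\<^esub>} ws"
  shows "kills_colons UB (U.mnm (f c) 0) J0 J0 (map (\<lambda>w. U.mnm w 0) ws)"
  unfolding kills_colons_def
proof (intro allI impI ballI)
  fix k u assume k: "k < length (map (\<lambda>w. U.mnm w 0) ws)" and u: "u \<in> carrier UB"
    and m: "map (\<lambda>w. U.mnm w 0) ws ! k \<otimes>\<^bsub>UB\<^esub> u \<in> spn UB J0 (take k (map (\<lambda>w. U.mnm w 0) ws))"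
  let ?J = "spn B {\<zero>\<^bsub>B\<^esub>} (take k ws)"
  have tk: "set (take k ws) \<subseteq> carrier B" using ws by (auto dest: in_set_takeD)
  have tkU: "set (map (\<lambda>w. U.mnm w 0) (take k ws)) \<subseteq> carrier UB" using tk by auto
  have w: "ws ! k \<in> carrier B" using ws k by auto
  have fc: "f c \<in> carrier B" using c f_closed by blast
  have J: "ideal ?J B" by (rule B.spn_ideal[OF B.zeroideal tk])
  have zu: "U.mnm (ws ! k) 0 \<otimes>\<^bsub>UB\<^esub> u \<in> pair_ideal ?J"
    using spn_pair[OF tk] m k by (auto simp: take_map)
  have pJ: "pair i u y \<in> ?J" if iy: "i \<le> d" "y \<in> M" for i y
  proof -
    have "pair i (U.mnm (ws ! k) 0 \<otimes>\<^bsub>UB\<^esub> u) y \<in> ?J"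
      using zu iy unfolding pair_ideal_def by blast
    hence "ws ! k \<otimes>\<^bsub>B\<^esub> pair i u y \<in> ?J"
      using M_carrier[OF iy(2)] unfolding pair_monom_mult[OF iy w u] by simp
    thus ?thesis using reg k pair_closed[OF iy u] by (simp add: regular_mod_def)
  qed
  define g where "g n = (if n \<le> d then pair n u \<one> else \<zero>\<^bsub>B\<^esub>)" for n
  obtain v where v: "v \<in> carrier UB" "\<And>n. U.cf v n = g n"
    by (rule U.poly_of_coeffs[of g d]) (auto simp: g_def pair_closed[OF _ M_one u])
  have "v \<in> poly_ideal B ?J"
    using v pJ[OF _ M_one] additive_subgroup.zero_closed[OF ideal.axioms(1)[OF J]]
    by (auto simp: U.poly_ideal_alt g_def)
  hence "v \<in> spn UB (poly_ideal B {\<zero>\<^bsub>B\<^esub>}) (map (\<lambda>w. U.mnm w 0) (take k ws))"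
    using U.spn_poly_ideal[OF B.zeroideal tk] by simp
  moreover have "poly_ideal B {\<zero>\<^bsub>B\<^esub>} \<subseteq> J0"
  proof
    fix x assume x: "x \<in> poly_ideal B {\<zero>\<^bsub>B\<^esub>}"
    hence "x = \<zero>\<^bsub>UB\<^esub>" by (intro U.up_eqI) (auto simp: U.poly_ideal_alt)
    thus "x \<in> J0" using additive_subgroup.zero_closed[OF ideal.axioms(1)[OF J0_ideal]] by simp
  qed
  ultimately have vs: "v \<in> spn UB J0 (map (\<lambda>w. U.mnm w 0) (take k ws))"
    using U.P.spn_mono by blast
  have cu: "U.mnm (f c) 0 \<otimes>\<^bsub>UB\<^esub> u \<in> carrier UB" using fc u by simp
  have "pair j (U.mnm (f c) 0 \<otimes>\<^bsub>UB\<^esub> u) y = pair j v y" if jy: "j \<le> d" "y \<in> M" for j y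
  proof -
    have ty: "t [^] i \<otimes> y \<in> M" for i :: nat by (intro M_mult t_pow_M jy)
    have "pair j v y = (\<Oplus>\<^bsub>B\<^esub>i\<in>{..d}. U.cf v i \<otimes>\<^bsub>B\<^esub> mu j (t [^] i \<otimes> y))"
      by (rule pair_bound[OF jy v(1)]) (simp add: v(2) g_def)
    also have "\<dots> = (\<Oplus>\<^bsub>B\<^esub>i\<in>{..d}. pair i u \<one> \<otimes>\<^bsub>B\<^esub> mu j (t [^] i \<otimes> y))"
      using pair_closed[OF _ M_one u] mu_closed[OF jy(1) ty]
      by (intro B.finsum_cong') (auto simp: v(2) g_def)
    also have "\<dots> = f c \<otimes>\<^bsub>B\<^esub> pair j u y" by (rule pair_expansion[OF jy u, symmetric])
    finally show ?thesis using pair_monom_mult[OF jy fc u, of 0] M_carrier[OF jy(2)] by simp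
  qed
  hence "U.mnm (f c) 0 \<otimes>\<^bsub>UB\<^esub> u \<ominus>\<^bsub>UB\<^esub> v \<in> J0"
    using cu v(1) pair_closed by (simp add: pair_ideal_def pair_minus B.minus_eq B.r_neg)
  hence "U.mnm (f c) 0 \<otimes>\<^bsub>UB\<^esub> u \<ominus>\<^bsub>UB\<^esub> v \<in> spn UB J0 (map (\<lambda>w. U.mnm w 0) (take k ws))"
    using U.P.spn_superset(1)[OF J0_ideal tkU] by blast
  thus "U.mnm (f c) 0 \<otimes>\<^bsub>UB\<^esub> u \<in> spn UB J0 (take k (map (\<lambda>w. U.mnm w 0) ws))"
    unfolding take_map by (rule U.P.ideal_diff_mem[OF U.P.spn_ideal[OF J0_ideal tkU] cu vs])
qed

text \<open>If a power \<open>c\<^sup>K\<close> were in the ideals generated by all the Frobenius powers of the sequence, then so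
  would be all \<open>f(c\<^sup>K l\<^sub>i(1))\<close>, by applying the functionals. Then \<open>c\<^sup>K l\<^sub>i(1)\<close> lies in \<open>P\<close>, hence
  \<open>l\<^sub>i(1) \<in> P\<close>, and the dual basis identity at \<open>1\<close> puts \<open>c\<close> into \<open>P M\<close>.\<close>
lemma fiber_durable:
  "\<exists>n. U.mnm (f c) 0 [^]\<^bsub>UB\<^esub> (K::nat) \<notin> spn UB J0 (map (\<lambda>z. U.mnm (f z [^]\<^bsub>B\<^esub> (p ^ n)) 0) zs)"
proof (rule ccontr)
  assume neg: "\<not> ?thesis"
  have cE: "c \<in> E" "c \<in> carrier T" using c E_carrier by auto
  have fz: "set (map f zs) \<subseteq> carrier B" using f_closed zs_E by auto
  have cK: "c [^] k \<in> E - P" for k :: nat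
    by (induction k) (use E_one one_notin_P notin_P_mult c in auto)
  have fcK: "f (c [^] k) = f c [^]\<^bsub>B\<^esub> k" for k :: nat
    by (induction k) (use f_one f_mult cK cE in auto)
  have pw: "U.mnm (f c) 0 [^]\<^bsub>UB\<^esub> K = U.mnm (f (c [^] K)) 0"
    using U.monom_pow[OF f_closed[OF cE(1)], of 0 K] by (simp add: fcK)
  have lP: "l i \<one> \<in> P" if i: "i \<le> d" for i
  proof -
    have li: "l i \<one> \<in> E" using i by (intro l_E M_one) auto
    have cl: "c [^] K \<otimes> l i \<one> \<in> E" using E_mult cK li by blast
    have "f (c [^] K \<otimes> l i \<one>) \<in> spn B {\<zero>\<^bsub>B\<^esub>} (map (\<lambda>y. y [^]\<^bsub>B\<^esub> (p ^ n)) (map f zs))" for n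
    proof -
      let ?ws = "map (\<lambda>y. y [^]\<^bsub>B\<^esub> (p ^ n)) (map f zs)"
      have ws: "set ?ws \<subseteq> carrier B" using fz by auto
      have eqm: "map (\<lambda>w. U.mnm w 0) ?ws = map (\<lambda>z. U.mnm (f z [^]\<^bsub>B\<^esub> (p ^ n)) 0) zs" by simp
      have "U.mnm (f (c [^] K)) 0 \<in> spn UB J0 (map (\<lambda>w. U.mnm w 0) ?ws)"
        using neg unfolding pw eqm by blast
      hence "U.mnm (f (c [^] K)) 0 \<in> pair_ideal (spn B {\<zero>\<^bsub>B\<^esub>} ?ws)"
        using spn_pair[OF ws] by blast
      hence "pair i (U.mnm (f (c [^] K)) 0) \<one> \<in> spn B {\<zero>\<^bsub>B\<^esub>} ?ws"
        using i M_one by (simp add: pair_ideal_def)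
      thus ?thesis
        using pair_monom[OF i M_one f_closed, of "c [^] K" 0] cK[of K] f_mult[of "c [^] K" "l i \<one>"] li
        by (simp add: mu_def)
    qed
    from spn_power_witness[OF B.cring_axioms fz prime_p this]
    have "c [^] K \<otimes> l i \<one> \<in> P"
      using f_closed[OF cl]
      by (intro maximal_pair_separated[OF max real cl, of 1]) (simp add: comp_def nat_pow_eone)
    thus ?thesis using notin_P_mult[OF cK] li by blast
  qed
  have "(\<Oplus>i\<in>A. l i \<one> \<otimes> t [^] i) \<in> N" if "finite A" "A \<subseteq> {..d}" for A
    using that
  proof (induction A rule: finite_induct)
    case empty show ?case using submodD(2)[OF N_submod] by simp
  next
    case (insert k A)
    have lE: "i \<le> d \<Longrightarrow> l i \<one> \<in> carrier T" for i using E_carrier l_E[OF _ M_one, of i] by simp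
    have "(\<Oplus>i\<in>insert k A. l i \<one> \<otimes> t [^] i) = l k \<one> \<otimes> t [^] k \<oplus> (\<Oplus>i\<in>A. l i \<one> \<otimes> t [^] i)"
      using insert lE t_pow by (intro finsum_insert) auto
    moreover have "l k \<one> \<otimes> t [^] k \<in> N" using insert by (intro lspan_gen submod_P lP) auto
    ultimately show ?case using insert submodD(3)[OF N_submod] by simp
  qed
  hence sN: "(\<Oplus>i\<in>{..d}. l i \<one> \<otimes> t [^] i) \<in> N" by simp
  have "c \<otimes> \<one> \<ominus> (\<Oplus>i\<in>{..d}. l i \<one> \<otimes> t [^] i) \<in> N"
    using almost_dual_basisD(5)[OF dual M_one] by (simp add: lessThan_Suc_atMost)
  note submodD(3)[OF N_submod this sN]
  moreover have "(c \<otimes> \<one> \<ominus> r) \<oplus> r = c" if "r \<in> carrier T" for r using that cE by algebra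
  note this[OF submodD(1)[OF N_submod sN]]
  ultimately show False using nontorsion[OF c] by simp
qed

text \<open>Inverting \<open>c\<close> along Frobenius powers turns \<open>M \<rightarrow> M \<otimes>\<^sub>E B\<close> into a good map on \<open>M\<close>.\<close>
theorem M_killable: "killable M P"
proof -
  obtain e :: "(nat \<Rightarrow> nat \<Rightarrow> nat \<Rightarrow> 't universe) \<Rightarrow> 't universe" where e: "inj e"
    using ex_inj_universe(2) by blast
  have fz: "set (map f zs) \<subseteq> carrier B" using f_closed zs_E by auto
  have fc: "f c \<in> carrier B" using c f_closed by blast
  let ?M = "T\<lparr>carrier := M\<rparr>"
  have ch: "[p] \<cdot>\<^bsub>UB\<^esub> \<one>\<^bsub>UB\<^esub> = \<zero>\<^bsub>UB\<^esub>"
    by (rule char_ring_hom[OF B.ring_axioms U.P.ring_axioms U.const_ring_hom realizes_char[OF E_sub real]])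
  have ws: "map (\<lambda>z. lift z [^]\<^bsub>UB\<^esub> (p ^ n)) zs = map (\<lambda>z. U.mnm (f z [^]\<^bsub>B\<^esub> (p ^ n)) 0) zs" for n
  proof -
    have "lift z [^]\<^bsub>UB\<^esub> (p ^ n) = U.mnm (f z [^]\<^bsub>B\<^esub> (p ^ n)) 0" if "z \<in> set zs" for z
    proof -
      have zE: "z \<in> E" using that zs_E by blast
      hence "lift z = U.mnm (f z) 0" using lift(3)[OF subsetD[OF E_M]] by blast
      thus ?thesis using U.monom_pow[OF f_closed[OF zE], of 0 "p ^ n"] by simp
    qed
    thus ?thesis by simp
  qed
  have memJ: "u \<ominus>\<^bsub>UB\<^esub> v \<in> J0" if "u \<in> carrier UB" "v \<in> carrier UB"
    "\<And>i y. i \<le> d \<Longrightarrow> y \<in> M \<Longrightarrow> pair i u y = pair i v y" for u v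
    using that pair_closed by (simp add: pair_ideal_def pair_minus B.minus_eq B.r_neg)
  obtain B' :: "'t universe ring" and h where B': "cring B'" "h \<in> ring_hom ?M B'"
    "proper_regular B' (map h zs)"
    "\<And>s. s \<in> carrier ?M \<Longrightarrow> U.mnm (f c) 0 \<otimes>\<^bsub>UB\<^esub> lift s \<in> J0 \<Longrightarrow> h s = \<zero>\<^bsub>B'\<^esub>"
  proof (rule frobenius_localization[OF e subring_cring[OF M_subring] U.P.cring_axioms J0_ideal prime_p ch,
        of lift "U.mnm (f c) 0" zs])
    show "lift s \<in> carrier UB" if "s \<in> carrier ?M" for s using that lift(1) by simp
    show "lift \<one>\<^bsub>?M\<^esub> \<ominus>\<^bsub>UB\<^esub> \<one>\<^bsub>UB\<^esub> \<in> J0"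
      using lift[OF M_one] pair_monom[OF _ _ B.one_closed, of _ _ 0] M_carrier mu_closed
      by (intro memJ) simp_all
    show "lift (s \<oplus>\<^bsub>?M\<^esub> s') \<ominus>\<^bsub>UB\<^esub> (lift s \<oplus>\<^bsub>UB\<^esub> lift s') \<in> J0"
      if "s \<in> carrier ?M" "s' \<in> carrier ?M" for s s'
    proof -
      have s: "s \<in> M" "s' \<in> M" using that by auto
      note ss = submodD(3)[OF M_submod s]
      show ?thesis
      proof (rule memJ)
        fix i y assume iy: "i \<le> d" "y \<in> M"
        show "pair i (lift (s \<oplus>\<^bsub>?M\<^esub> s')) y = pair i (lift s \<oplus>\<^bsub>UB\<^esub> lift s') y"
          using lift(2)[OF ss iy] lift(2)[OF s(1) iy] lift(2)[OF s(2) iy]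
            pair_add[OF iy lift(1)[OF s(1)] lift(1)[OF s(2)]]
            mu_add[OF iy(1) M_mult[OF s(1) iy(2)] M_mult[OF s(2) iy(2)]]
            M_carrier[OF s(1)] M_carrier[OF s(2)] M_carrier[OF iy(2)]
          by (simp add: l_distr)
      qed (use lift(1) s ss in auto)
    qed
    show "lift (s \<otimes>\<^bsub>?M\<^esub> s') \<ominus>\<^bsub>UB\<^esub> (lift s \<otimes>\<^bsub>UB\<^esub> lift s') \<in> J0"
      if "s \<in> carrier ?M" "s' \<in> carrier ?M" for s s'
    proof -
      have s: "s \<in> M" "s' \<in> M" using that by auto
      note ss = M_mult[OF s]
      show ?thesis
      proof (rule memJ)
        fix i y assume iy: "i \<le> d" "y \<in> M"
        show "pair i (lift (s \<otimes>\<^bsub>?M\<^esub> s')) y = pair i (lift s \<otimes>\<^bsub>UB\<^esub> lift s') y"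
          using lift(2)[OF ss iy] lift(2)[OF s(1) iy(1) M_mult[OF s(2) iy(2)]]
            pair_mult_lift[OF iy s(2) lift(1)[OF s(1)]]
            M_carrier[OF s(1)] M_carrier[OF s(2)] M_carrier[OF iy(2)]
          by (simp add: m_assoc)
      qed (use lift(1) s ss in auto)
    qed
    show "U.mnm (f c) 0 \<in> carrier UB" using fc by simp
    show "set zs \<subseteq> carrier ?M" using zs_E E_M by auto
    show "kills_colons UB (U.mnm (f c) 0) J0 J0 (map (\<lambda>z. lift z [^]\<^bsub>UB\<^esub> (p ^ n)) zs)" for n
    proof -
      let ?ws = "map (\<lambda>y. y [^]\<^bsub>B\<^esub> (p ^ n)) (map f zs)"
      have "regular_mod B {\<zero>\<^bsub>B\<^esub>} ?ws"
        using B.regular_mod_powers[OF B.zeroideal fz] real by (simp add: realizes_def proper_regular_def)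
      moreover have "set ?ws \<subseteq> carrier B" using fz by auto
      ultimately have "kills_colons UB (U.mnm (f c) 0) J0 J0 (map (\<lambda>w. U.mnm w 0) ?ws)"
        by (intro fiber_kills_colons)
      moreover have "map (\<lambda>w. U.mnm w 0) ?ws = map (\<lambda>z. lift z [^]\<^bsub>UB\<^esub> (p ^ n)) zs"
        unfolding ws by simp
      ultimately show ?thesis by (rule subst[rotated])
    qed
    show "\<exists>n. U.mnm (f c) 0 [^]\<^bsub>UB\<^esub> K \<notin> spn UB J0 (map (\<lambda>z. lift z [^]\<^bsub>UB\<^esub> (p ^ n)) zs)" for K :: nat
      unfolding ws by (rule fiber_durable)
  qed (rule that)
  have "h s = \<zero>\<^bsub>B'\<^esub>" if s: "s \<in> P" for s
  proof (rule B'(4))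
    have sE: "s \<in> E" and "f s = \<zero>\<^bsub>B\<^esub>" using s P_E f_kernel by auto
    thus "s \<in> carrier ?M" using E_M by auto
    have "lift s = \<zero>\<^bsub>UB\<^esub>" using lift(3)[of s] sE E_M \<open>f s = _\<close> by (auto simp: U.monom_zero)
    thus "U.mnm (f c) 0 \<otimes>\<^bsub>UB\<^esub> lift s \<in> J0"
      using fc additive_subgroup.zero_closed[OF ideal.axioms(1)[OF J0_ideal]] by simp
  qed
  hence "realizes M P B' h" using B' by (simp add: realizes_def)
  thus ?thesis unfolding killable_def using M_subring zs_E P_E E_M by blast
qed

end

context char_p_base
begin

text \<open>\<open>(E[t], P)\<close> is again a pair, so \<open>E[t] = E\<close> by maximality.\<close>
theorem maximal_pair_integrally_closed:
  assumes max: "maximal_pair E P" and t: "t \<in> carrier T" and int: "integral_over T E t"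
  shows "t \<in> E"
proof -
  obtain B f where real: "realizes E P B f" using max by (auto simp: maximal_pair_def killable_def)
  obtain q where q: "set q \<subseteq> E" "eval (\<one> # q) t = \<zero>" using int by (auto simp: integral_over_def)
  interpret step: extension_step T zs p E P t "length q - 1" B f
    using max real t by unfold_locales
  have ev: "eval r t \<in> step.lspan E (length r)" if "set r \<subseteq> E" for r
    using that
  proof (induction r)
    case (Cons a r)
    have a: "a \<in> E" and IH: "eval r t \<in> step.lspan E (length r)" using Cons by auto
    have "eval (a # r) t = eval r t \<oplus> a \<otimes> t [^] length r"
      using step.E_carrier[OF a] step.t_pow step.submodD(1)[OF step.lspan_submod[OF step.submod_E] IH]
      by (simp add: a_comm)
    thus ?case using a IH by auto
  qed simp
  have "eval q t \<in> step.lspan E (length q)" using ev q by blast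
  note * = step.submodD[OF step.lspan_submod[OF step.submod_E, of "length q"]]
  have "t [^] length q \<oplus> eval q t = \<zero>" using q t by simp
  hence "\<ominus> eval q t = t [^] length q"
    using t *(1)[OF \<open>eval q t \<in> _\<close>] by (intro minus_equality) simp_all
  hence tq: "t [^] length q \<in> step.lspan E (length q)" using *(5)[OF \<open>eval q t \<in> _\<close>] by simp
  have "length q \<noteq> 0"
  proof
    assume "length q = 0"
    hence "\<one> = \<zero>" using tq by simp
    thus False using step.P_zero step.one_notin_P by simp
  qed
  hence len: "Suc (length q - 1) = length q" by simp
  interpret step: integral_step T zs p E P t "length q - 1" B f
    by unfold_locales (simp only: len tq)
  have "\<exists>c\<in>E - P. \<exists>l. step.almost_dual_basis step.N (Suc (length q - 1)) c l"
    by (rule step.lspan_almost_projective[OF step.N_submod]) (rule step.lspan_gen[OF step.submod_P])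
  then obtain c l where c: "c \<in> E - P"
    and l: "step.almost_dual_basis step.N (Suc (length q - 1)) c l" by blast
  interpret step: almost_projective_step T zs p E P t "length q - 1" B f c l
    using c l by unfold_locales
  have "step.M = E" using max step.M_killable step.E_M unfolding maximal_pair_def by blast
  thus ?thesis using step.t_M by simp
qed

corollary killable_integral_extension:
  assumes "killable E0 {}" and int: "\<And>t. t \<in> carrier T \<Longrightarrow> integral_over T E0 t"
  shows "killable (carrier T) {}"
proof -
  obtain E P where max: "maximal_pair E P" and E: "E0 \<subseteq> E"
    using ex_maximal_pair[OF assms(1)] by blast
  have "integral_over T E t" if "t \<in> carrier T" for t
    using int[OF that] E unfolding integral_over_def by blast
  hence "carrier T \<subseteq> E" using maximal_pair_integrally_closed[OF max] by blast
  moreover have "E \<subseteq> carrier T"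
    using max subringE(1) by (auto simp: maximal_pair_def killable_def)
  ultimately have "killable (carrier T) P" using max by (simp add: maximal_pair_def)
  thus ?thesis by (auto simp: killable_def realizes_def)
qed

end


section \<open>From regular sequences back to algebras over the base ring\<close>

lemma algebra_structure_hom:
  assumes "algebra R B"
  shows "(\<lambda>r. r \<odot>\<^bsub>B\<^esub> \<one>\<^bsub>B\<^esub>) \<in> ring_hom R B"
proof -
  interpret M: cring B by (rule algebra.M_cring) fact
  interpret B: algebra R B by fact
  show ?thesis
  proof (rule ring_hom_memI)
    fix r s assume rs: "r \<in> carrier R" "s \<in> carrier R"
    show "(r \<otimes>\<^bsub>R\<^esub> s) \<odot>\<^bsub>B\<^esub> \<one>\<^bsub>B\<^esub> = (r \<odot>\<^bsub>B\<^esub> \<one>\<^bsub>B\<^esub>) \<otimes>\<^bsub>B\<^esub> (s \<odot>\<^bsub>B\<^esub> \<one>\<^bsub>B\<^esub>)"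
      using rs by (simp add: B.smult_assoc1 B.smult_assoc2)
    show "(r \<oplus>\<^bsub>R\<^esub> s) \<odot>\<^bsub>B\<^esub> \<one>\<^bsub>B\<^esub> = (r \<odot>\<^bsub>B\<^esub> \<one>\<^bsub>B\<^esub>) \<oplus>\<^bsub>B\<^esub> (s \<odot>\<^bsub>B\<^esub> \<one>\<^bsub>B\<^esub>)"
      using rs by (simp add: B.smult_l_distr)
  qed simp_all
qed

lemma expand_eq_spn:
  assumes "algebra R B" and xs: "set xs \<subseteq> carrier R"
  shows "expand B xs = spn B {\<zero>\<^bsub>B\<^esub>} (map (\<lambda>x. x \<odot>\<^bsub>B\<^esub> \<one>\<^bsub>B\<^esub>) xs)"
proof -
  interpret M: cring B by (rule algebra.M_cring) fact
  interpret B: algebra R B by fact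
  let ?ys = "map (\<lambda>x. x \<odot>\<^bsub>B\<^esub> \<one>\<^bsub>B\<^esub>) xs"
  have ys: "set ?ys \<subseteq> carrier B" using xs by auto
  have I: "ideal (Idl\<^bsub>B\<^esub> (set ?ys)) B" by (rule M.genideal_ideal[OF ys])
  have "spn B {\<zero>\<^bsub>B\<^esub>} ?ys = Idl\<^bsub>B\<^esub> (set ?ys)"
  proof
    show "spn B {\<zero>\<^bsub>B\<^esub>} ?ys \<subseteq> Idl\<^bsub>B\<^esub> (set ?ys)"
      using additive_subgroup.zero_closed[OF ideal.axioms(1)[OF I]] M.genideal_self[OF ys]
      by (intro M.spn_least[OF I _ _ M.zeroideal]) auto
    show "Idl\<^bsub>B\<^esub> (set ?ys) \<subseteq> spn B {\<zero>\<^bsub>B\<^esub>} ?ys"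
      by (rule M.genideal_minimal[OF M.spn_ideal[OF M.zeroideal ys] M.spn_superset(2)[OF M.zeroideal ys]])
  qed
  thus ?thesis by (simp add: expand_def)
qed

lemma regular_sequence_iff_proper_regular:
  assumes B: "algebra R B" and xs: "set xs \<subseteq> carrier R"
  shows "regular_sequence B xs \<longleftrightarrow> proper_regular B (map (\<lambda>x. x \<odot>\<^bsub>B\<^esub> \<one>\<^bsub>B\<^esub>) xs)"
proof -
  interpret M: cring B by (rule algebra.M_cring) fact
  interpret B: algebra R B by fact
  have I: "ideal (expand B xs) B" by (rule expand_ideal[OF B xs])
  have "expand B xs \<noteq> carrier B \<longleftrightarrow> \<one>\<^bsub>B\<^esub> \<notin> expand B xs"
    using ideal.one_imp_carrier[OF I] by auto
  moreover have "expand B (take i xs) = spn B {\<zero>\<^bsub>B\<^esub>} (take i (map (\<lambda>x. x \<odot>\<^bsub>B\<^esub> \<one>\<^bsub>B\<^esub>) xs))" for i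
    unfolding take_map using xs by (intro expand_eq_spn[OF B]) (auto dest: in_set_takeD)
  moreover have "(xs ! i \<odot>\<^bsub>B\<^esub> \<one>\<^bsub>B\<^esub>) \<otimes>\<^bsub>B\<^esub> b = (xs ! i) \<odot>\<^bsub>B\<^esub> b"
    if "i < length xs" "b \<in> carrier B" for i b
  proof -
    have "xs ! i \<in> carrier R" using xs that by auto
    thus ?thesis using that by (simp add: B.smult_assoc2)
  qed
  ultimately show ?thesis
    unfolding regular_sequence_def proper_regular_def regular_mod_def expand_eq_spn[OF B xs, symmetric]
    by auto
qed

lemma restrict_scalars_algebra:
  assumes R: "cring R" and T: "algebra R T" and B: "cring B" and h: "h \<in> ring_hom T B"
  defines "B' \<equiv> \<lparr>carrier = carrier B, monoid.mult = (\<otimes>\<^bsub>B\<^esub>), one = \<one>\<^bsub>B\<^esub>, ring.zero = \<zero>\<^bsub>B\<^esub>,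
      ring.add = (\<oplus>\<^bsub>B\<^esub>), smult = (\<lambda>r b. h (r \<odot>\<^bsub>T\<^esub> \<one>\<^bsub>T\<^esub>) \<otimes>\<^bsub>B\<^esub> b)\<rparr>"
  shows "algebra R B'" and "h \<in> algebra_hom R T B'"
proof -
  interpret TM: cring T by (rule algebra.M_cring) fact
  interpret T: algebra R T by fact
  interpret B: cring B by fact
  note s = algebra_structure_hom[OF T]
  note hh = ring_hom_closed[OF h] ring_hom_mult[OF h] ring_hom_add[OF h] ring_hom_one[OF h]
  have B': "cring B'"
  proof (rule cringI)
    show "abelian_group B'"
    proof (rule abelian_groupI)
      fix x assume "x \<in> carrier B'"
      thus "\<exists>y\<in>carrier B'. y \<oplus>\<^bsub>B'\<^esub> x = \<zero>\<^bsub>B'\<^esub>"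
        by (intro bexI[of _ "\<ominus>\<^bsub>B\<^esub> x"]) (simp_all add: B'_def B.l_neg)
    qed (simp_all add: B'_def B.a_ac)
    show "comm_monoid B'"
      by (rule comm_monoidI) (simp_all add: B'_def B.m_ac)
  qed (simp add: B'_def B.l_distr)
  show "algebra R B'"
  proof (rule algebraI[OF R B'])
    fix a b x assume "a \<in> carrier R" "b \<in> carrier R" "x \<in> carrier B'"
    thus "(a \<oplus>\<^bsub>R\<^esub> b) \<odot>\<^bsub>B'\<^esub> x = a \<odot>\<^bsub>B'\<^esub> x \<oplus>\<^bsub>B'\<^esub> b \<odot>\<^bsub>B'\<^esub> x"
      and "(a \<otimes>\<^bsub>R\<^esub> b) \<odot>\<^bsub>B'\<^esub> x = a \<odot>\<^bsub>B'\<^esub> (b \<odot>\<^bsub>B'\<^esub> x)"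
      using ring_hom_add[OF s, of a b] ring_hom_mult[OF s, of a b]
      by (simp_all add: B'_def hh B.l_distr B.m_assoc)
  qed (simp_all add: B'_def hh B.r_distr B.m_assoc)
  show "h \<in> algebra_hom R T B'"
    unfolding algebra_hom_def
  proof (intro CollectI conjI ballI)
    show "h \<in> ring_hom T B'" by (rule ring_hom_memI) (simp_all add: B'_def hh)
    fix r u assume "r \<in> carrier R" "u \<in> carrier T"
    thus "h (r \<odot>\<^bsub>T\<^esub> u) = r \<odot>\<^bsub>B'\<^esub> h u"
      using hh(2)[of "r \<odot>\<^bsub>T\<^esub> \<one>\<^bsub>T\<^esub>" u] by (simp add: B'_def T.smult_assoc2)
  qed
qed

text \<open>Replaces \<open>S\<close> by its image in \<open>T\<close>. This bounds the type of the big Cohen-Macaulay algebra in terms of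
  the type of the elements of \<open>T\<close>.\<close>
lemma seed_image:
  fixes R :: "('r, 'k) ring_scheme" and S :: "('r, 's, 'l) module_scheme"
    and T :: "('r, 't, 'n) module_scheme"
  assumes m: "ideal m R" and S: "seed R m S" and T: "algebra R T"
    and i: "i \<in> algebra_hom R S T" and inj: "inj_on i (carrier S)"
  shows "seed R m (T\<lparr>carrier := i ` carrier S\<rparr>)" and "subring (i ` carrier S) T"
proof -
  interpret TM: cring T by (rule algebra.M_cring) fact
  interpret T: algebra R T by fact
  have Sa: "algebra R S" using S by (simp add: seed_def)
  interpret SM: cring S by (rule algebra.M_cring) fact
  interpret S: algebra R S by fact
  have ih: "i \<in> ring_hom S T" and ismult: "\<And>r s. r \<in> carrier R \<Longrightarrow> s \<in> carrier S \<Longrightarrow> i (r \<odot>\<^bsub>S\<^esub> s) = r \<odot>\<^bsub>T\<^esub> i s"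
    using i by (auto simp: algebra_hom_def)
  interpret i: ring_hom_ring S T i by (rule ring_hom_ringI2[OF SM.ring_axioms TM.ring_axioms ih])
  let ?E = "i ` carrier S"
  let ?T = "T\<lparr>carrier := ?E\<rparr>"
  show E: "subring ?E T" by (rule i.img_is_subring[OF SM.carrier_is_subring])
  note e = subringE[OF E]
  have A: "algebra R ?T"
  proof (rule algebra_pullback[OF T, of "\<lambda>x. x"])
    show "x \<in> carrier ?T \<Longrightarrow> \<exists>y\<in>carrier ?T. y = \<ominus>\<^bsub>T\<^esub> x" for x using e(5) by simp
    show "r \<odot>\<^bsub>?T\<^esub> x \<in> carrier ?T" if "r \<in> carrier R" "x \<in> carrier ?T" for r x
    proof -
      obtain s where s: "s \<in> carrier S" "x = i s" using \<open>x \<in> carrier ?T\<close> by auto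
      hence "r \<odot>\<^bsub>T\<^esub> x = i (r \<odot>\<^bsub>S\<^esub> s)" using ismult that by simp
      thus ?thesis using s that by auto
    qed
  qed (use e in auto)
  obtain B :: "('r, 's + nat) module" and f where B: "big_CM_algebra R m B" and f: "f \<in> algebra_hom R S B"
    using S by (auto simp: seed_def)
  define g where "g = f \<circ> inv_into (carrier S) i"
  have gi: "g (i s) = f s" if "s \<in> carrier S" for s
    using inv_into_f_f[OF inj that] by (simp add: g_def)
  have fr: "f \<in> ring_hom S B" and fs: "\<And>r s. r \<in> carrier R \<Longrightarrow> s \<in> carrier S \<Longrightarrow> f (r \<odot>\<^bsub>S\<^esub> s) = r \<odot>\<^bsub>B\<^esub> f s"
    using f by (auto simp: algebra_hom_def)
  have "g \<in> algebra_hom R ?T B"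
    unfolding algebra_hom_def
  proof (intro CollectI conjI ballI)
    show "g \<in> ring_hom ?T B"
    proof (rule ring_hom_memI)
      fix x y assume "x \<in> carrier ?T" "y \<in> carrier ?T"
      then obtain s u where s: "s \<in> carrier S" "x = i s" "u \<in> carrier S" "y = i u" by auto
      show "g x \<in> carrier B" using s gi ring_hom_closed[OF fr] by simp
      show "g (x \<otimes>\<^bsub>?T\<^esub> y) = g x \<otimes>\<^bsub>B\<^esub> g y"
        using s gi gi[of "s \<otimes>\<^bsub>S\<^esub> u"] ring_hom_mult[OF fr] by simp
      show "g (x \<oplus>\<^bsub>?T\<^esub> y) = g x \<oplus>\<^bsub>B\<^esub> g y"
        using s gi gi[of "s \<oplus>\<^bsub>S\<^esub> u"] ring_hom_add[OF fr] by simp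
    next
      show "g \<one>\<^bsub>?T\<^esub> = \<one>\<^bsub>B\<^esub>" using gi[of "\<one>\<^bsub>S\<^esub>"] ring_hom_one[OF fr] by simp
    qed
    fix r x assume r: "r \<in> carrier R" and "x \<in> carrier ?T"
    then obtain s where s: "s \<in> carrier S" "x = i s" by auto
    thus "g (r \<odot>\<^bsub>?T\<^esub> x) = r \<odot>\<^bsub>B\<^esub> g x"
      using gi[of "r \<odot>\<^bsub>S\<^esub> s"] gi[of s] ismult fs r by simp
  qed
  thus "seed R m ?T" by (rule seedI[OF A m B])
qed

theorem theorem6p9:
  fixes R :: "('r, 'k) ring_scheme" and m :: "'r set" and p :: nat
    and S :: "('r, 's, 'l) module_scheme" and T :: "('r, 't, 'n) module_scheme"
    and \<iota> :: "'s \<Rightarrow> 't"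
  assumes "noetherian_local_ring R m"
    and "Factorial_Ring.prime p" and "has_characteristic R p"
    and "seed R m S"
    and "integral_extension R S T \<iota>"
  shows "seed R m T"
proof -
  interpret noetherian_local_ring R m by fact
  have m: "ideal m R" using maximal by (rule maximalideal.axioms(1))
  have T: "algebra R T" and \<iota>: "\<iota> \<in> algebra_hom R S T" "inj_on \<iota> (carrier S)"
    and int: "\<And>t. t \<in> carrier T \<Longrightarrow> integral_over T (\<iota> ` carrier S) t"
    using assms(5) by (auto simp: integral_extension_def)
  interpret TM: cring T by (rule algebra.M_cring) fact
  interpret T: algebra R T by fact
  define E where "E = \<iota> ` carrier S"
  let ?E = "T\<lparr>carrier := E\<rparr>"
  have E: "subring E T" and seedE: "seed R m ?E"
    unfolding E_def using seed_image[OF m assms(4) T \<iota>] by auto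
  obtain B :: "('r, 't + nat) module" and f xs where Ea: "algebra R ?E" and B: "algebra R B"
    and sop: "system_of_parameters R m xs" and reg: "regular_sequence B xs"
    and f: "f \<in> algebra_hom R ?E B"
    using seedE unfolding seed_def big_CM_algebra_def by blast
  have xs: "set xs \<subseteq> carrier R"
    using sop ideal_carrier[OF m] by (auto simp: system_of_parameters_def)
  define zs where "zs = map (\<lambda>x. x \<odot>\<^bsub>T\<^esub> \<one>\<^bsub>T\<^esub>) xs"
  have "[p] \<cdot>\<^bsub>R\<^esub> \<one>\<^bsub>R\<^esub> = \<zero>\<^bsub>R\<^esub>" using assms(3) by (auto simp: has_characteristic_def)
  hence ch: "[p] \<cdot>\<^bsub>T\<^esub> \<one>\<^bsub>T\<^esub> = \<zero>\<^bsub>T\<^esub>"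
    by (rule char_ring_hom[OF ring_axioms TM.ring_axioms algebra_structure_hom[OF T]])
  interpret base: char_p_base T zs p using assms(2) ch by unfold_locales
  interpret Em: algebra R ?E by fact
  interpret BM: cring B by (rule algebra.M_cring) fact
  interpret B: algebra R B by fact
  have one: "\<one>\<^bsub>T\<^esub> \<in> E" by (rule subringE(3)[OF E])
  have zsE: "set zs \<subseteq> E" using xs one Em.smult_closed[of _ "\<one>\<^bsub>T\<^esub>"] by (auto simp: zs_def)
  have fr: "f \<in> ring_hom ?E B"
    and fz: "\<And>r. r \<in> carrier R \<Longrightarrow> f (r \<odot>\<^bsub>T\<^esub> \<one>\<^bsub>T\<^esub>) = r \<odot>\<^bsub>B\<^esub> \<one>\<^bsub>B\<^esub>"
    using f one ring_hom_one[of f ?E B] by (auto simp: algebra_hom_def)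
  have fzs: "map f zs = map (\<lambda>x. x \<odot>\<^bsub>B\<^esub> \<one>\<^bsub>B\<^esub>) xs" using fz xs by (auto simp: zs_def)
  have regB: "proper_regular B (map f zs)"
    unfolding fzs using reg regular_sequence_iff_proper_regular[OF B xs] by simp
  \<comment> \<open>\<open>B\<close> is copied into the universe, where the maximal pairs live\<close>
  obtain e :: "'t + nat \<Rightarrow> 't universe" where e: "inj e"
  proof
    show "inj (case_sum (\<lambda>s. {({s}, {}, 0)}) (\<lambda>n. {({}, UNIV, n)}) :: 't + nat \<Rightarrow> 't universe)"
      by (auto simp: inj_def split: sum.splits)
  qed
  obtain Q :: "'t universe ring" and \<pi> where Q: "cring Q" and \<pi>: "\<pi> \<in> ring_hom B Q"
    and surj: "\<pi> ` carrier B = carrier Q"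
    and ker: "\<And>u. u \<in> carrier B \<Longrightarrow> \<pi> u = \<zero>\<^bsub>Q\<^esub> \<longleftrightarrow> u \<in> {\<zero>\<^bsub>B\<^esub>}"
    using BM.quotient_realization[OF BM.zeroideal e] by metis
  have fB: "set (map f zs) \<subseteq> carrier B" using ring_hom_closed[OF fr] zsE by auto
  have "proper_regular Q (map \<pi> (map f zs))"
    by (rule proper_regular_surjective_image[OF BM.cring_axioms Q \<pi> surj ker fB])
      (use regB in \<open>simp_all add: proper_regular_def\<close>)
  hence "base.realizes E {} Q (\<pi> \<circ> f)"
    using Q ring_hom_trans[OF fr \<pi>] by (simp add: base.realizes_def)
  hence "base.killable E {}" unfolding base.killable_def using E zsE by blast
  hence "base.killable (carrier T) {}"
    by (rule base.killable_integral_extension) (use int in \<open>simp add: E_def\<close>)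
  then obtain C :: "'t universe ring" and h where C: "cring C" and h: "h \<in> ring_hom T C"
    and regC: "proper_regular C (map h zs)"
    by (auto simp: base.killable_def base.realizes_def)
  define C' where "C' = \<lparr>carrier = carrier C, monoid.mult = (\<otimes>\<^bsub>C\<^esub>), one = \<one>\<^bsub>C\<^esub>, ring.zero = \<zero>\<^bsub>C\<^esub>,
      ring.add = (\<oplus>\<^bsub>C\<^esub>), smult = (\<lambda>r b. h (r \<odot>\<^bsub>T\<^esub> \<one>\<^bsub>T\<^esub>) \<otimes>\<^bsub>C\<^esub> b)\<rparr>"
  note C' = restrict_scalars_algebra[OF cring_axioms T C h, folded C'_def]
  interpret CM: cring C by fact
  have "map (\<lambda>x. x \<odot>\<^bsub>C'\<^esub> \<one>\<^bsub>C'\<^esub>) xs = map h zs"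
    using xs ring_hom_closed[OF h] by (auto simp: C'_def zs_def)
  moreover have "proper_regular C' (map h zs)"
  proof -
    have "adj C' = adj C" by (intro ext) (simp add: adj_def C'_def a_minus_def a_inv_def m_inv_def)
    thus ?thesis using regC
      by (simp add: proper_regular_def regular_mod_def spn_def C'_def)
  qed
  ultimately have "regular_sequence C' xs"
    using regular_sequence_iff_proper_regular[OF C'(1) xs] by simp
  hence "big_CM_algebra R m C'" using C'(1) sop by (auto simp: big_CM_algebra_def)
  thus ?thesis using seedI[OF T m _ C'(2)] by blast
qed

end
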